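(* Let $b\ge0$, $c>0$, and consider the stochastic recurrence equation in $\mathbb R^d$ with equal coefficients $$\boldsymbol X_t=(b+cM_t)\boldsymbol X_{t-1}+\boldsymbol Q_t,\qquad t\in\mathbb Z.$$ Assume (A1)--(A5) (listed in the context) for all $1\le i\le d$, let $\boldsymbol X_0$ have the stationary distribution, and let $\widetilde{\boldsymbol\Theta}_0$ be its spectral component. Then $$\mathrm{supp}(\widetilde{\boldsymbol\Theta}_0)\subset\mathrm{span}\big(\mathrm{supp}(\boldsymbol Q)\big)\cap S_\infty^{d-1}.$$ In addition, the following implications hold: (a) If $b=0$, $c>0$ and $\mathrm{supp}(M)$ is dense in $\mathbb R$, then $\mathrm{supp}(\widetilde{\boldsymbol\Theta}_0)=\mathrm{span}\big(\mathrm{supp}(\boldsymbol Q)\big)\cap S_\infty^{d-1}$. (b) If $b>0$, $c>0$ and $\mathrm{supp}(M)$ is dense in $\mathbb R_+$, then $$\mathrm{supp}(\widetilde{\boldsymbol\Theta}_0)=\{a_1\boldsymbol q_1+\dots+a_n\boldsymbol q_n:\ n\in\mathbb N,\ a_i>0,\ \boldsymbol q_i\in\mathrm{supp}(\boldsymbol Q)\}\cap S_\infty^{d-1},$$ i.e. it equals the convex cone generated by $\mathrm{supp}(\boldsymbol Q)$ intersected with the unit sphere. (c) If $\mathrm{supp}(\boldsymbol Q)$ is dense in $\mathbb R^d$, then $\mathrm{supp}(\widetilde{\boldsymbol\Theta}_0)=S_\infty^{d-1}$.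
   Context: Setting: $(M_t)$ are iid real random variables, $(\boldsymbol Q_t)$ are iid $\mathbb R^d$-valued random vectors independent of $(M_t)$, and $(M,\boldsymbol Q)$ with $\boldsymbol Q=(Q_1,\dots,Q_d)$ is a generic copy of $(M_t,\boldsymbol Q_t)$. The stationary distribution is the law of $\sum_{k\ge1}\big(\prod_{l=1}^{k-1}(b+cM_l)\big)\boldsymbol Q_k$. Assumptions, for all $1\le i\le d$: (A1) $\mathbb E[\log|b+cM|]<0$. (A2) There is $\alpha>0$ with $\mathbb E[|b+cM|^{\alpha}]=1$. (A3) $\mathbb E[|M|^{\alpha+\epsilon}]<\infty$ and $\mathbb E[\|\boldsymbol Q\|^{\alpha+\epsilon}]<\infty$ for some $\epsilon>0$. (A4) The distribution of $\log|b+cM|$ is non-arithmetic. (A5) $\mathbb P((b+cM)x+Q_i=x)<1$ for all $x\in\mathbb R$, and $\mathbb P(Q_i>0)>0$. Notation: $\|\cdot\|$ is the max-norm and $S_\infty^{d-1}$ its unit sphere in $\mathbb R^d$. For a random variable or vector $Y$, $\mathrm{supp}(Y)$ is the support of its law; $\mathrm{span}(E)$ is the linear span of $E\subset\mathbb R^d$. Under these assumptions $\boldsymbol X_0$ is regularly varying with index $\alpha$, and its spectral component $\widetilde{\boldsymbol\Theta}_0$ (with values in $S_\infty^{d-1}$) is defined by the weak limit $\lim_{x\to\infty}\mathbb P\big(\|\boldsymbol X_0\|^{-1}\boldsymbol X_0\in\cdot\,\big|\,\|\boldsymbol X_0\|>x\big)=\mathbb P(\widetilde{\boldsymbol\Theta}_0\in\cdot)$.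 (Since all tail indices equal $\alpha$, this coincides with the vector-scaled limit of $\|\boldsymbol X_0\|_{\boldsymbol\alpha}^{-1/\boldsymbol\alpha}\boldsymbol X_0$ given $\|\boldsymbol X_0\|_{\boldsymbol\alpha}>x$, where $\|\boldsymbol x\|_{\boldsymbol\alpha}=\max_i|x_i|^{\alpha}$ and, for $\lambda>0$, $\lambda^{-1/\boldsymbol\alpha}\boldsymbol x=\lambda^{-1/\alpha}\boldsymbol x$.)
   Formalization: In (b) the support is shown to equal the closure of the convex cone intersected with the unit sphere; without the closure the claim fails, e.g. for Q=(Z,Z²) with Z exponential, where the cone misses (1,0) although supports are closed. *)

theory Defs
  imports "HOL-Probability.Probability"
begin

definition iid :: "'a measure \<Rightarrow> ('i \<Rightarrow> 'a \<Rightarrow> 'b::topological_space) \<Rightarrow> bool" where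
  "iid P Y \<longleftrightarrow> prob_space.indep_vars P (\<lambda>_. borel) Y UNIV \<and>
     (\<forall>s t. distr P borel (Y s) = distr P borel (Y t))"

text \<open>
  Independence of two families, as independence of the sigma-algebras they generate.
  (\<^const>\<open>prob_space.indep_var\<close> would force both families to have the same value type.)
\<close>
definition indep_families ::
  "'a measure \<Rightarrow> ('i \<Rightarrow> 'a \<Rightarrow> 'b::topological_space) \<Rightarrow> ('j \<Rightarrow> 'a \<Rightarrow> 'c::topological_space) \<Rightarrow> bool" where
  "indep_families P Y Z \<longleftrightarrow> prob_space.indep_set P
     (sets (vimage_algebra (space P) (\<lambda>\<omega> t. Y t \<omega>) (PiM UNIV (\<lambda>_. borel))))
     (sets (vimage_algebra (space P) (\<lambda>\<omega> t. Z t \<omega>) (PiM UNIV (\<lambda>_. borel))))"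

text \<open>
  The logarithm of the absolute value, with the value minus infinity at 0
  (whereas \<^term>\<open>ln (0::real) = 0\<close>).
\<close>
definition log_abs :: "real \<Rightarrow> ereal" where
  "log_abs y = (if y = 0 then - \<infinity> else ereal (ln \<bar>y\<bar>))"

text \<open>
  Expectation of an extended-real random variable as the difference of the expectations of its
  positive and negative parts; if both are infinite, the value is \<^term>\<open>\<infinity> - \<infinity> = (\<infinity>::ereal)\<close>,
  so an upper bound on it other than infinity implies that the expectation is well defined.
\<close>
definition ext_expectation :: "'a measure \<Rightarrow> ('a \<Rightarrow> ereal) \<Rightarrow> ereal" where
  "ext_expectation P Y =
     enn2ereal (\<integral>\<^sup>+ \<omega>. e2ennreal (Y \<omega>) \<partial>P) - enn2ereal (\<integral>\<^sup>+ \<omega>. e2ennreal (- Y \<omega>) \<partial>P)"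

text \<open>
  The law of an extended-real random variable with values below infinity is non-arithmetic if its
  finite part is not carried by a lattice \<open>h \<int>\<close>. A possible atom at minus infinity is disregarded,
  as usual for stochastic recurrence equations whose multiplier may vanish.
\<close>
definition nonarithmetic :: "'a measure \<Rightarrow> ('a \<Rightarrow> ereal) \<Rightarrow> bool" where
  "nonarithmetic P Y \<longleftrightarrow>
     (\<forall>h>0. measure P {\<omega> \<in> space P. Y \<omega> = - \<infinity> \<or> (\<exists>k::int. Y \<omega> = ereal (h * of_int k))} < 1)"

definition supp :: "'a measure \<Rightarrow> ('a \<Rightarrow> 'b::topological_space) \<Rightarrow> 'b set" where
  "supp P Y = {y. \<forall>U. open U \<and> y \<in> U \<longrightarrow> measure (distr P borel Y) U > 0}"

text \<open>\<^const>\<open>infnorm\<close> is the max-norm.\<close>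
definition max_sphere :: "(real ^ 'd) set" where
  "max_sphere = {x. infnorm x = 1}"

definition weak_limit ::
  "('i \<Rightarrow> 'b::metric_space measure) \<Rightarrow> 'b measure \<Rightarrow> 'i filter \<Rightarrow> bool" where
  "weak_limit \<mu> \<nu> F \<longleftrightarrow>
     (\<forall>f :: 'b \<Rightarrow> real. continuous_on UNIV f \<and> bounded (range f) \<longrightarrow>
        ((\<lambda>i. integral\<^sup>L (\<mu> i) f) \<longlongrightarrow> integral\<^sup>L \<nu> f) F)"

text \<open>
  The random vector \<open>\<Theta>\<close>, possibly on another probability space, has the limit law of
  \<open>X / infnorm X\<close> conditionally on \<open>infnorm X > x\<close>. If the conditioning event is null,
  \<^const>\<open>uniform_measure\<close> is the null measure, so that the weak limit cannot
  be a probability measure unless \<open>infnorm X\<close> is unbounded.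
\<close>
definition spectral_component ::
  "'a measure \<Rightarrow> ('a \<Rightarrow> real ^ 'd) \<Rightarrow> 'b measure \<Rightarrow> ('b \<Rightarrow> real ^ 'd) \<Rightarrow> bool" where
  "spectral_component P X R \<Theta> \<longleftrightarrow>
     weak_limit
       (\<lambda>x::real. distr (uniform_measure P {\<omega> \<in> space P. infnorm (X \<omega>) > x}) borel
                    (\<lambda>\<omega>. inverse (infnorm (X \<omega>)) *\<^sub>R X \<omega>))
       (distr R borel \<Theta>) at_top"

text \<open>The sum over \<open>k \<ge> 1\<close> is written with the index shifted to start at 0.\<close>
definition stationary_series ::
  "real \<Rightarrow> real \<Rightarrow> (int \<Rightarrow> 'a \<Rightarrow> real) \<Rightarrow> (int \<Rightarrow> 'a \<Rightarrow> real ^ 'd) \<Rightarrow> 'a \<Rightarrow> real ^ 'd" where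
  "stationary_series b c M Q \<omega> =
     (\<Sum>k. (\<Prod>l=1..k. b + c * M (int l) \<omega>) *\<^sub>R Q (int (Suc k)) \<omega>)"

text \<open>
  This cone need not be closed if \<open>E\<close> is unbounded or contains 0, e.g. for
  \<open>E = {(z, z\<^sup>2). z \<ge> 0}\<close>, whereas the support of a law is always closed.
\<close>
definition positive_combinations :: "(real ^ 'd) set \<Rightarrow> (real ^ 'd) set" where
  "positive_combinations E =
     {\<Sum>i=1..n. a i *\<^sub>R q i | (n::nat) a q. n \<ge> 1 \<and> (\<forall>i\<in>{1..n}. a i > 0 \<and> q i \<in> E)}"

end

theory Submission
  imports Defs "HOL-Real_Asymp.Real_Asymp"
begin

text \<open>
  Write \<open>\<Pi>\<^sub>k = \<Prod>\<^sub>l\<^sub>\<le>\<^sub>k (b + c M\<^sub>l)\<close> and \<open>h \<beta> = E \<bar>b + c M\<bar>\<^sup>\<beta>\<close>, so that \<open>h < 1\<close> on \<open>(0, \<alpha>)\<close> and \<open>h \<beta> \<rightarrow> 1\<close> as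
  \<open>\<beta> \<rightarrow> \<alpha>\<close>. No precise tail asymptotics are needed: since the weak limit is assumed to exist, it
  suffices to see that the part of the tail of \<open>X\<close> in a given direction is not negligible, and this
  can be read off from the moments of order \<open>\<beta> < \<alpha>\<close>. On the one hand
  \<open>E \<bar>X\<bar>\<^sup>\<beta> \<le> C / (1 - h \<beta>)\<close>, on the other hand \<open>E (max\<^sub>k \<bar>\<Pi>\<^sub>k\<bar>)\<^sup>\<beta> \<ge> c / (1 - h \<beta>)\<close>. At the first time
  \<open>\<bar>\<Pi>\<^sub>k\<bar>\<close> exceeds \<open>x\<close>, either the partial sum up to \<open>k\<close> is much larger than \<open>\<bar>\<Pi>\<^sub>k\<bar>\<close>, in which case \<open>\<bar>X\<bar>\<close>
  is much larger than \<open>x\<close> with probability at least \<open>1/2\<close>; or the remaining series, an independent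
  copy of \<open>X\<close>, has positive probability to be far out near the direction \<open>\<plusminus>u\<close> and then turns \<open>X\<close> into
  the direction \<open>u\<close>. Hence every direction \<open>u\<close> is charged by the spectral component if the support \<open>K\<close>
  of \<open>X\<close> extends to infinity in the direction \<open>u\<close> and, unless \<open>b + c M \<ge> 0\<close>, also in the direction
  \<open>- u\<close>. Which directions these are follows from \<open>a K + q \<subseteq> K\<close> for \<open>a\<close> in
  the support of \<open>b + c M\<close> and \<open>q\<close> in that of \<open>Q\<close>.
\<close>

subsection \<open>Powers and moments\<close>

text \<open>The argument closes because both moment bounds have the same order
  \<open>1 / (1 - h \<beta>)\<close>: after multiplication by \<open>1 - h \<beta>\<close> and
  passage to the limit \<open>\<beta> \<rightarrow> \<alpha>\<close>, contributions from bounded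
  levels vanish and only constants are compared. The constants must be chosen in a fixed order.
  First B is taken so large that the passages with a dominating partial sum use up at most half of
  the lower bound; they force \<open>2 / B * norm X > x\<close>, which brings the factor
  \<open>(2 / B) powr \<beta>\<close> into the moment. Only then comes p, the probability that a
  fresh copy of X is so far out that a perturbation of size B hardly turns it; it depends on B and
  may be tiny. Finally \<epsilon> is taken small compared with p. The running maximum of the
  products serves as lower comparison for two reasons: its moments obey an exact recursion, and its
  tail splits into disjoint first-passage events, each determined by the steps before the
  passage.\<close>

lemma powr_add_le_weighted:
  fixes x y \<delta> \<beta> :: real
  assumes "x \<ge> 0" "y \<ge> 0" "\<delta> > 0" "\<beta> \<ge> 0"
  shows "(x + y) powr \<beta> \<le> (1 + \<delta>) powr \<beta> * x powr \<beta> + (1 + 1 / \<delta>) powr \<beta> * y powr \<beta>"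
proof (cases "y \<le> \<delta> * x")
  case True
  then have "(x + y) powr \<beta> \<le> ((1 + \<delta>) * x) powr \<beta>"
    using assms by (intro powr_mono2) (auto simp: algebra_simps)
  then show ?thesis
    using assms by (simp add: powr_mult add_increasing2)
next
  case False
  then have "(x + y) powr \<beta> \<le> ((1 + 1 / \<delta>) * y) powr \<beta>"
    using assms by (intro powr_mono2) (auto simp: field_simps)
  then show ?thesis
    using assms by (simp add: powr_mult add_increasing)
qed

text \<open>The derivative \<open>\<beta> * \<xi> powr (\<beta> - 1)\<close> at a point
  \<open>\<xi>\<close> of (1, 2) is at most \<open>\<alpha> * 2 powr \<alpha>\<close>, whatever the
  sign of \<open>\<beta> - 1\<close>. The constant has to be the same for all
  \<open>\<beta> \<le> \<alpha>\<close>.\<close>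

lemma powr_one_add_le:
  fixes t \<beta> \<alpha> :: real
  assumes "0 \<le> t" "t \<le> 1" "0 \<le> \<beta>" "\<beta> \<le> \<alpha>"
  shows "(1 + t) powr \<beta> \<le> 1 + \<alpha> * 2 powr \<alpha> * t"
proof (cases "t = 0 \<or> \<beta> = 0")
  case True
  then show ?thesis using assms by auto
next
  case False
  have "\<exists>\<xi>. 1 < \<xi> \<and> \<xi> < 1 + t \<and> (1 + t) powr \<beta> - 1 powr \<beta> = (1 + t - 1) * (\<beta> * \<xi> powr (\<beta> - 1))"
    using False assms
    by (intro MVT2) (auto intro!: derivative_eq_intros simp: powr_diff field_simps)
  then obtain \<xi> where \<xi>: "1 < \<xi>" "\<xi> < 1 + t" "(1 + t) powr \<beta> = 1 + t * (\<beta> * \<xi> powr (\<beta> - 1))"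
    by auto
  have "\<xi> powr (\<beta> - 1) \<le> \<xi> powr \<alpha>" using \<xi> assms by (intro powr_mono) auto
  also have "\<dots> \<le> 2 powr \<alpha>" using \<xi> assms by (intro powr_mono2) auto
  finally have "\<beta> * \<xi> powr (\<beta> - 1) \<le> \<alpha> * 2 powr \<alpha>" using assms by (intro mult_mono) auto
  then have "t * (\<beta> * \<xi> powr (\<beta> - 1)) \<le> t * (\<alpha> * 2 powr \<alpha>)" 
    using assms by (intro mult_left_mono) auto
  then show ?thesis using \<xi>(3) by (simp add: mult_ac)
qed

text \<open>The coefficient of \<open>x powr \<beta>\<close> is exactly 1, so that a moment
  recursion built on it keeps the factor \<open>h \<beta>\<close>. If \<open>y \<le> x\<close>, the
  relative excess \<open>y / x\<close> is at most \<open>(y / x) powr \<theta>\<close>, which leaves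
  a lower power of x; otherwise the whole sum is at most \<open>2 * y\<close>.\<close>

lemma powr_add_le_interpolated:
  fixes x y \<theta> \<beta> \<alpha> :: real
  assumes "x \<ge> 0" "y \<ge> 0" "0 < \<theta>" "\<theta> \<le> 1" "0 \<le> \<beta>" "\<beta> \<le> \<alpha>"
  shows "(x + y) powr \<beta> \<le>
    x powr \<beta> + \<alpha> * 2 powr \<alpha> * (y powr \<theta> * x powr (\<beta> - \<theta>)) + 2 powr \<alpha> * y powr \<beta>"
proof (cases "y \<le> x \<and> 0 < x")
  case True
  have "(x + y) powr \<beta> = (x * (1 + y / x)) powr \<beta>" using True by (simp add: distrib_left)
  also have "\<dots> = x powr \<beta> * (1 + y / x) powr \<beta>" using True assms by (simp add: powr_mult)
  also have "\<dots> \<le> x powr \<beta> * (1 + \<alpha> * 2 powr \<alpha> * (y / x))"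
    using True assms by (intro mult_left_mono powr_one_add_le) auto
  also have "\<dots> \<le> x powr \<beta> * (1 + \<alpha> * 2 powr \<alpha> * (y / x) powr \<theta>)"
  proof -
    have "(y / x) powr 1 \<le> (y / x) powr \<theta>"
      using True assms by (intro powr_mono') auto
    then have "y / x \<le> (y / x) powr \<theta>" using True assms by simp
    then show ?thesis using assms
      by (intro mult_left_mono add_left_mono) (auto intro: mult_left_mono)
  qed
  also have "\<dots> = x powr \<beta> + \<alpha> * 2 powr \<alpha> * (y powr \<theta> * x powr (\<beta> - \<theta>))"
    using True assms by (simp add: powr_divide powr_diff field_simps)
  finally show ?thesis by (simp add: add_increasing2)
next
  case False
  then have "(x + y) powr \<beta> \<le> (2 * y) powr \<beta>" using assms by (intro powr_mono2) auto
  also have "\<dots> = 2 powr \<beta> * y powr \<beta>" using assms by (simp add: powr_mult)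
  also have "\<dots> \<le> 2 powr \<alpha> * y powr \<beta>" using assms by (intro mult_right_mono powr_mono) auto
  finally show ?thesis using assms by (simp add: add_increasing)
qed

lemma powr_le_one_add_powr:
  fixes x \<beta> \<alpha> :: real
  assumes "x \<ge> 0" "0 \<le> \<beta>" "\<beta> \<le> \<alpha>"
  shows "x powr \<beta> \<le> 1 + x powr \<alpha>"
proof (cases "x \<le> 1")
  case True
  then have "x powr \<beta> \<le> 1" using assms by (intro powr_le1) auto
  then show ?thesis by (simp add: add_increasing2)
next
  case False
  then show ?thesis using assms by (simp add: powr_mono add_increasing)
qed

text \<open>Both factors are dominated by powers of the larger of x and y. This controls the mixed
  moment of the two coordinates of one step, which may depend on each other under
  \<open>N\<close>.\<close>

lemma powr_mult_powr_le:
  fixes x y \<theta> \<beta> :: real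
  assumes "x \<ge> 0" "y \<ge> 0" "0 \<le> \<theta>" "\<theta> \<le> \<beta>"
  shows "y powr \<theta> * x powr (\<beta> - \<theta>) \<le> y powr \<beta> + x powr \<beta>"
proof -
  define m where "m = max x y"
  have "y powr \<theta> * x powr (\<beta> - \<theta>) \<le> m powr \<theta> * m powr (\<beta> - \<theta>)"
    using assms unfolding m_def by (intro mult_mono powr_mono2) auto
  also have "\<dots> = m powr \<beta>" using assms by (simp flip: powr_add)
  also have "\<dots> \<le> y powr \<beta> + x powr \<beta>" by (auto simp: m_def max_def)
  finally show ?thesis .
qed

text \<open>Tonelli: \<open>t powr \<beta>\<close> is the integral of its derivative over
  \<open>0 < x < t\<close>, and integrating over \<open>T\<close> first leaves the tails of
  f.\<close>

lemma nn_integral_powr_layer_cake: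
  fixes f :: "'a \<Rightarrow> real"
  assumes "sigma_finite_measure T" and [measurable]: "f \<in> borel_measurable T"
    and "\<And>z. 0 \<le> f z" and "0 < \<beta>"
  shows "(\<integral>\<^sup>+z. ennreal (f z powr \<beta>) \<partial>T) =
    (\<integral>\<^sup>+x. ennreal (\<beta> * x powr (\<beta> - 1)) * indicator {0<..} x * emeasure T {z \<in> space T. x < f z} \<partial>lborel)"
proof -
  interpret sigma_finite_measure T by fact
  interpret pair_sigma_finite lborel T
    by (intro pair_sigma_finite.intro sigma_finite_lborel) fact
  have slice: "ennreal (c powr \<beta>) =
      (\<integral>\<^sup>+x. ennreal (\<beta> * x powr (\<beta> - 1)) * indicator {0<..} x * indicator {x. x < c} x \<partial>lborel)"
    if "0 \<le> c" for c :: real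
  proof -
    have "((\<lambda>x. x powr (\<beta> - 1)) has_integral (c powr (\<beta> - 1 + 1) / (\<beta> - 1 + 1))) {0..c}"
      using assms that by (intro has_integral_powr_from_0) auto
    then have "((\<lambda>x. \<beta> * x powr (\<beta> - 1)) has_integral \<beta> * (c powr \<beta> / \<beta>)) {0..c}"
      by (intro has_integral_mult_right) simp
    then have "((\<lambda>x. \<beta> * x powr (\<beta> - 1)) has_integral c powr \<beta>) {0..c}" using assms by simp
    from nn_integral_has_integral_lborel[OF _ _ this[THEN has_integral_restrict_UNIV[THEN iffD2]]]
    have "ennreal (c powr \<beta>) = (\<integral>\<^sup>+x. ennreal (if x \<in> {0..c} then \<beta> * x powr (\<beta> - 1) else 0) \<partial>lborel)"
      using assms by auto
    also have "\<dots> = (\<integral>\<^sup>+x. ennreal (\<beta> * x powr (\<beta> - 1)) * indicator {0<..} x * indicator {x. x < c} x \<partial>lborel)"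
    proof (rule nn_integral_cong_AE)
      \<comment> \<open>Only the endpoint \<open>c\<close> must be excluded. At 0 both sides vanish,
        since \<open>0 powr _ = 0\<close> also for negative exponents.\<close>
      have "AE x in lborel. x \<noteq> c" by (rule AE_lborel_singleton)
      then show "AE x in lborel. ennreal (if x \<in> {0..c} then \<beta> * x powr (\<beta> - 1) else 0) =
          ennreal (\<beta> * x powr (\<beta> - 1)) * indicator {0<..} x * indicator {x. x < c} x"
        by eventually_elim (auto simp: indicator_def)
    qed
    finally show ?thesis .
  qed
  have "(\<integral>\<^sup>+z. ennreal (f z powr \<beta>) \<partial>T) =
    (\<integral>\<^sup>+z. (\<integral>\<^sup>+x. ennreal (\<beta> * x powr (\<beta> - 1)) * indicator {0<..} x * indicator {x. x < f z} x \<partial>lborel) \<partial>T)"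
    by (simp add: slice assms)
  also have "\<dots> = (\<integral>\<^sup>+x. (\<integral>\<^sup>+z. ennreal (\<beta> * x powr (\<beta> - 1)) * indicator {0<..} x * indicator {x. x < f z} x \<partial>T) \<partial>lborel)"
    by (intro Fubini') measurable
  also have "\<dots> = (\<integral>\<^sup>+x. (\<integral>\<^sup>+z. ennreal (\<beta> * x powr (\<beta> - 1)) * indicator {0<..} x * indicator {z\<in>space T. x < f z} z \<partial>T) \<partial>lborel)"
    by (intro nn_integral_cong) (auto simp: indicator_def)
  also have "\<dots> = (\<integral>\<^sup>+x. ennreal (\<beta> * x powr (\<beta> - 1)) * indicator {0<..} x * emeasure T {z \<in> space T. x < f z} \<partial>lborel)"
    by (intro nn_integral_cong) (simp add: nn_integral_cmult)
  finally show ?thesis .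
qed

text \<open>First passage compares probabilities of events, not functions pointwise. Integrating the
  tails against \<open>\<beta> * x powr (\<beta> - 1)\<close> turns such a comparison into one of
  moments whose coefficients do not depend on \<beta>.\<close>

lemma nn_integral_powr_tail_mono:
  fixes f g k :: "'a \<Rightarrow> real"
  assumes T: "sigma_finite_measure T" and f: "f \<in> borel_measurable T" "\<And>z. 0 \<le> f z"
    and g: "g \<in> borel_measurable T" "\<And>z. 0 \<le> g z"
    and k: "k \<in> borel_measurable T" "\<And>z. 0 \<le> k z" and "0 < \<beta>"
    and le: "\<And>x. 0 < x \<Longrightarrow> emeasure T {z \<in> space T. x < f z} \<le>
      u * emeasure T {z \<in> space T. x < g z} + v * emeasure T {z \<in> space T. x < k z}"
  shows "(\<integral>\<^sup>+z. ennreal (f z powr \<beta>) \<partial>T) \<le>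
    u * (\<integral>\<^sup>+z. ennreal (g z powr \<beta>) \<partial>T) + v * (\<integral>\<^sup>+z. ennreal (k z powr \<beta>) \<partial>T)"
proof -
  interpret sigma_finite_measure T by fact
  note [measurable] = f(1) g(1) k(1)
  let ?w = "\<lambda>x. ennreal (\<beta> * x powr (\<beta> - 1)) * indicator {0<..} x"
  have tail: "(\<lambda>x. emeasure T {z \<in> space T. x < h z}) \<in> borel_measurable lborel"
    if [measurable]: "h \<in> borel_measurable T" for h :: "'a \<Rightarrow> real"
    by measurable
  have [measurable]: "(\<lambda>x. ?w x * emeasure T {z \<in> space T. x < h z}) \<in> borel_measurable lborel"
    if "h \<in> borel_measurable T" for h :: "'a \<Rightarrow> real"
    using tail[OF that] by measurable
  have "(\<integral>\<^sup>+z. ennreal (f z powr \<beta>) \<partial>T) \<le>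
    (\<integral>\<^sup>+x. u * (?w x * emeasure T {z \<in> space T. x < g z}) + v * (?w x * emeasure T {z \<in> space T. x < k z}) \<partial>lborel)"
    unfolding nn_integral_powr_layer_cake[OF T f \<open>0 < \<beta>\<close>]
  proof (intro nn_integral_mono)
    fix x :: real
    show "?w x * emeasure T {z \<in> space T. x < f z} \<le>
      u * (?w x * emeasure T {z \<in> space T. x < g z}) + v * (?w x * emeasure T {z \<in> space T. x < k z})"
      using mult_left_mono[OF le[of x], of "?w x"]
      by (cases "0 < x") (simp_all add: distrib_left mult_ac)
  qed
  also have "\<dots> = u * (\<integral>\<^sup>+z. ennreal (g z powr \<beta>) \<partial>T) + v * (\<integral>\<^sup>+z. ennreal (k z powr \<beta>) \<partial>T)"
    unfolding nn_integral_powr_layer_cake[OF T g \<open>0 < \<beta>\<close>] nn_integral_powr_layer_cake[OF T k \<open>0 < \<beta>\<close>]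
    by (simp add: nn_integral_add nn_integral_cmult)
  finally show ?thesis .
qed

text \<open>Strict concavity: with \<open>s = t powr \<alpha>\<close>, the function
  \<open>s powr (\<beta> / \<alpha>)\<close> lies below its tangent at 1. The proof is Jensen's
  inequality for \<open>ln\<close> at s and 1: \<open>ln y \<le> y - 1\<close> is used at
  \<open>s / m\<close> and \<open>1 / m\<close>, where m is the weighted mean, and it is strict at
  \<open>1 / m\<close>.\<close>

lemma powr_less_affine:
  fixes t \<beta> \<alpha> :: real
  assumes "0 \<le> t" "t \<noteq> 1" "0 < \<beta>" "\<beta> < \<alpha>"
  shows "t powr \<beta> < 1 + \<beta> / \<alpha> * (t powr \<alpha> - 1)"
proof (cases "t = 0")
  case True
  then show ?thesis using assms by simp
next
  case False
  define r s where "r = \<beta> / \<alpha>" and "s = t powr \<alpha>"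
  define m where "m = 1 + r * (s - 1)"
  have r: "0 < r" "r < 1" using assms by (auto simp: r_def)
  have s: "0 < s" using False assms by (auto simp: s_def)
  have "s \<noteq> 1"
  proof
    assume "s = 1"
    then have "\<alpha> * ln t = 0" using False assms by (metis ln_one ln_powr s_def)
    then show False using False assms by auto
  qed
  have "m = (1 - r) + r * s" by (simp add: m_def algebra_simps)
  then have m: "0 < m" using r s by (simp add: add_pos_pos)
  have lt: "ln (s / m) \<le> s / m - 1" "ln (1 / m) \<le> 1 / m - 1"
    using s m by (intro ln_le_minus_one; simp)+
  have "1 / m \<noteq> 1" using \<open>s \<noteq> 1\<close> r by (simp add: m_def)
  then have "ln (1 / m) \<noteq> 1 / m - 1" using ln_eq_minus_one[of "1 / m"] m by auto
  then have "r * ln (s / m) + (1 - r) * ln (1 / m) < r * (s / m - 1) + (1 - r) * (1 / m - 1)"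
    using lt r by (intro add_le_less_mono mult_left_mono mult_strict_left_mono) auto
  also have "\<dots> = ((1 - r) + r * s) / m - 1" using m by (simp add: field_simps)
  also have "\<dots> = 0" using m by (simp add: m_def algebra_simps)
  finally have "r * ln s < ln m" using s m by (simp add: ln_div algebra_simps)
  moreover have "r * ln s = ln (t powr \<beta>)" using assms False by (simp add: r_def s_def ln_powr)
  ultimately have "t powr \<beta> < m" using m False ln_less_cancel_iff[of "t powr \<beta>" m] by simp
  then show ?thesis by (simp add: m_def r_def s_def)
qed

subsection \<open>Random affine recursions on the sequence space\<close>

definition cprod :: "nat \<Rightarrow> (nat \<Rightarrow> real \<times> 'v) \<Rightarrow> real" where
  "cprod n z = (\<Prod>l<n. fst (z l))"

definition psum :: "nat \<Rightarrow> (nat \<Rightarrow> real \<times> 'v::real_normed_vector) \<Rightarrow> 'v" where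
  "psum n z = (\<Sum>k<n. cprod k z *\<^sub>R snd (z k))"

text \<open>Off the almost sure event of \<open>AE_summable\<close> the value is unspecified, hence
  the summability assumptions and almost sure statements below.\<close>

definition perp_series :: "(nat \<Rightarrow> real \<times> 'v::real_normed_vector) \<Rightarrow> 'v" where
  "perp_series z = (\<Sum>k. cprod k z *\<^sub>R snd (z k))"

text \<open>Nondecreasing in n and an upper bound for \<open>norm (psum n z)\<close>, so its moments
  give both convergence of the series and bounds for the limit.\<close>

definition asum :: "nat \<Rightarrow> (nat \<Rightarrow> real \<times> 'v::real_normed_vector) \<Rightarrow> real" where
  "asum n z = (\<Sum>k<n. \<bar>cprod k z\<bar> * norm (snd (z k)))"

text \<open>The maximum of \<open>\<bar>cprod k z\<bar>\<close> over \<open>k \<le> n\<close>,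
  unfolded at the first step rather than the last, because moments are computed by prepending an
  independent step.\<close>

primrec cmax :: "nat \<Rightarrow> (nat \<Rightarrow> real \<times> 'v) \<Rightarrow> real" where
  "cmax 0 z = 1"
| "cmax (Suc n) z = max 1 (\<bar>fst (z 0)\<bar> * cmax n (\<lambda>i. z (Suc i)))"

lemma cprod_0 [simp]: "cprod 0 z = 1"
  by (simp add: cprod_def)

lemma cprod_Suc_shift: "cprod (Suc n) z = fst (z 0) * cprod n (\<lambda>i. z (Suc i))"
  unfolding cprod_def by (rule prod.lessThan_Suc_shift)

lemma cprod_case_nat [simp]: "cprod (Suc n) (case_nat s z) = fst s * cprod n z"
  by (simp add: cprod_Suc_shift)

lemma asum_case_nat [simp]:
  "asum (Suc n) (case_nat s z) = \<bar>fst s\<bar> * asum n z + norm (snd s)"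
  by (simp add: asum_def sum.lessThan_Suc_shift sum_distrib_left abs_mult mult_ac
      del: sum.lessThan_Suc)

lemma cmax_case_nat [simp]: "cmax (Suc n) (case_nat s z) = max 1 (\<bar>fst s\<bar> * cmax n z)"
  by simp

declare cmax.simps(2) [simp del]

lemma asum_nonneg: "0 \<le> asum n z"
  unfolding asum_def by (intro sum_nonneg) auto

lemma cmax_ge_1: "1 \<le> cmax n z"
  by (cases n) (auto simp: cmax.simps)

lemma cmax_le_Suc: "cmax n z \<le> cmax (Suc n) z"
proof (induction n arbitrary: z)
  case 0
  then show ?case by (simp add: cmax_ge_1)
next
  case (Suc n)
  have "\<bar>fst (z 0)\<bar> * cmax n (\<lambda>i. z (Suc i)) \<le> \<bar>fst (z 0)\<bar> * cmax (Suc n) (\<lambda>i. z (Suc i))"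
    by (intro mult_left_mono Suc.IH) auto
  then show ?case unfolding cmax.simps(2)[of _ z] by linarith
qed

lemma less_cmax_iff: "0 < x \<Longrightarrow> x < cmax n z \<longleftrightarrow> (\<exists>k\<le>n. x < \<bar>cprod k z\<bar>)"
proof (induction n arbitrary: z x)
  case (Suc n)
  have "x < \<bar>fst (z 0)\<bar> * cmax n (\<lambda>i. z (Suc i)) \<longleftrightarrow> (\<exists>k\<le>n. x < \<bar>cprod (Suc k) z\<bar>)"
  proof (cases "fst (z 0) = 0")
    case True
    then show ?thesis using Suc.prems by (auto simp: cprod_Suc_shift)
  next
    case False
    then have "x < \<bar>fst (z 0)\<bar> * cmax n (\<lambda>i. z (Suc i)) \<longleftrightarrow> x / \<bar>fst (z 0)\<bar> < cmax n (\<lambda>i. z (Suc i))"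
      by (simp add: field_simps)
    also have "\<dots> \<longleftrightarrow> (\<exists>k\<le>n. x / \<bar>fst (z 0)\<bar> < \<bar>cprod k (\<lambda>i. z (Suc i))\<bar>)"
      using False Suc.prems by (intro Suc.IH) auto
    also have "\<dots> \<longleftrightarrow> (\<exists>k\<le>n. x < \<bar>cprod (Suc k) z\<bar>)"
      using False by (auto simp: cprod_Suc_shift abs_mult field_simps)
    finally show ?thesis .
  qed
  then have "x < cmax (Suc n) z \<longleftrightarrow> x < 1 \<or> (\<exists>k\<le>n. x < \<bar>cprod (Suc k) z\<bar>)"
    by (auto simp: cmax.simps(2) less_max_iff_disj)
  also have "\<dots> \<longleftrightarrow> (\<exists>k\<le>Suc n. x < \<bar>cprod k z\<bar>)"
    by (auto simp: less_Suc_eq_le[symmetric] Ex_less_Suc2)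
  finally show ?case .
qed simp

lemma cprod_comb_seq_le: "j \<le> k \<Longrightarrow> cprod j (comb_seq k z z') = cprod j z"
  unfolding cprod_def by (intro prod.cong) (auto simp: comb_seq_less)

lemma cprod_comb_seq_add: "cprod (n + k) (comb_seq k z z') = cprod k z * cprod n z'"
proof (induction n)
  case 0
  then show ?case by (simp add: cprod_comb_seq_le)
next
  case (Suc n)
  then show ?case by (simp add: cprod_def comb_seq_add mult_ac)
qed

lemma psum_comb_seq: "psum k (comb_seq k z z') = psum k z"
  unfolding psum_def by (intro sum.cong) (auto simp: comb_seq_less cprod_comb_seq_le)

text \<open>\<open>comb_seq k z z'\<close> follows z for k steps and z' afterwards. From time k on
  the series restarts, driven by z' and scaled by \<open>cprod k z\<close>; this is the
  decomposition behind every conditioning on the past.\<close>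

lemma perp_comb_seq:
  assumes "summable (\<lambda>n. cprod n z' *\<^sub>R snd (z' n))"
  shows "perp_series (comb_seq k z z') = psum k z + cprod k z *\<^sub>R perp_series z'"
proof -
  let ?f = "\<lambda>n. cprod n (comb_seq k z z') *\<^sub>R snd (comb_seq k z z' n)"
  have shift: "?f (n + k) = cprod k z *\<^sub>R (cprod n z' *\<^sub>R snd (z' n))" for n
    by (simp add: cprod_comb_seq_add comb_seq_add)
  have "summable (\<lambda>n. ?f (n + k))"
    unfolding shift using assms by (rule summable_scaleR_right)
  then have "summable ?f" by (subst (asm) summable_iff_shift)
  then have "suminf ?f = (\<Sum>n. ?f (n + k)) + sum ?f {..<k}" by (rule suminf_split_initial_segment)
  also have "(\<Sum>n. ?f (n + k)) = cprod k z *\<^sub>R perp_series z'"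
    unfolding shift perp_series_def using assms by (rule suminf_scaleR_right[symmetric])
  also have "sum ?f {..<k} = psum k z" using psum_comb_seq[of k z z'] by (simp add: psum_def)
  finally show ?thesis by (simp add: perp_series_def)
qed

lemma perp_case_nat:
  assumes "summable (\<lambda>n. cprod n z *\<^sub>R snd (z n))"
  shows "perp_series (case_nat s z) = fst s *\<^sub>R perp_series z + snd s"
  using perp_comb_seq[OF assms, of 1 "\<lambda>_. s"] by (simp add: psum_def cprod_def)

text \<open>\<open>N\<close> is the joint law of multiplier and translation in one step, and the
  locale keeps just what the moment method consumes. \<open>not_unimodular\<close> excludes the
  degenerate case in which \<open>\<bar>fst s\<bar> powr \<beta>\<close> has mean 1 for every
  \<beta>.\<close>

locale perpetuity = sequence_space N for N :: "(real \<times> 'v::euclidean_space) measure" +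
  fixes \<alpha> :: real
  assumes sets_N [measurable_cong]: "sets N = sets borel"
    and \<alpha>_pos: "0 < \<alpha>"
    and integral_fst: "(\<integral>s. \<bar>fst s\<bar> powr \<alpha> \<partial>N) = 1"
    and not_unimodular: "\<not> (AE s in N. \<bar>fst s\<bar> = 1)"
    and integrable_snd: "integrable N (\<lambda>s. norm (snd s) powr \<alpha>)"
begin

lemma measurable_fst_N [measurable]: "fst \<in> borel_measurable N"
  and measurable_snd_N [measurable]: "snd \<in> borel_measurable N"
  unfolding measurable_cong_sets[OF sets_N refl]
  by (intro borel_measurable_continuous_onI continuous_intros)+

lemma measurable_cprod [measurable]: "cprod n \<in> borel_measurable S"
  unfolding cprod_def by measurable

lemma measurable_psum [measurable]: "psum n \<in> borel_measurable S"
  unfolding psum_def by measurable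

lemma measurable_perp_series [measurable]: "perp_series \<in> borel_measurable S"
  unfolding perp_series_def by measurable

lemma measurable_asum [measurable]: "asum n \<in> borel_measurable S"
  unfolding asum_def by measurable

lemma measurable_cmax [measurable]: "cmax n \<in> borel_measurable S"
proof (induction n)
  case 0
  then show ?case by simp
next
  case (Suc n)
  note [measurable] = Suc.IH
  have [measurable]: "(\<lambda>z i. z (Suc i)) \<in> S \<rightarrow>\<^sub>M S"
    by (rule measurable_PiM_single') (auto simp: space_PiM)
  show ?case unfolding cmax.simps(2) by measurable
qed

lemma nn_integral_iter:
  assumes [measurable]: "f \<in> borel_measurable S"
  shows "(\<integral>\<^sup>+z. f z \<partial>S) = (\<integral>\<^sup>+s. (\<integral>\<^sup>+z. f (case_nat s z) \<partial>S) \<partial>N)"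
  by (subst PiM_iter[symmetric], subst nn_integral_distr)
    (simp_all add: split_beta flip: P.nn_integral_fst)

lemma nn_integral_comb_seq:
  assumes [measurable]: "f \<in> borel_measurable S"
  shows "(\<integral>\<^sup>+z. f z \<partial>S) = (\<integral>\<^sup>+z. (\<integral>\<^sup>+z'. f (comb_seq k z z') \<partial>S) \<partial>S)"
  by (subst PiM_comb_seq[symmetric, of k], subst nn_integral_distr)
    (simp_all add: split_beta flip: P.nn_integral_fst)

definition h :: "real \<Rightarrow> real" where
  "h \<beta> = (\<integral>s. \<bar>fst s\<bar> powr \<beta> \<partial>N)"

lemma h_nonneg: "0 \<le> h \<beta>"
  unfolding h_def by (intro integral_nonneg_AE) auto

lemma integrable_fst: "0 \<le> \<beta> \<Longrightarrow> \<beta> \<le> \<alpha> \<Longrightarrow> integrable N (\<lambda>s. \<bar>fst s\<bar> powr \<beta>)"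
proof (rule Bochner_Integration.integrable_bound)
  \<comment> \<open>A function that is not integrable has Bochner integral 0, so the value 1 in
    \<open>integral_fst\<close> includes integrability.\<close>
  have "integrable N (\<lambda>s. \<bar>fst s\<bar> powr \<alpha>)"
    using integral_fst not_integrable_integral_eq by force
  then show "integrable N (\<lambda>s. 1 + \<bar>fst s\<bar> powr \<alpha>)" by simp
qed (auto intro!: AE_I2 powr_le_one_add_powr simp: abs_of_nonneg)

lemma nn_integral_fst: "0 \<le> \<beta> \<Longrightarrow> \<beta> \<le> \<alpha> \<Longrightarrow> (\<integral>\<^sup>+s. ennreal (\<bar>fst s\<bar> powr \<beta>) \<partial>N) = ennreal (h \<beta>)"
  unfolding h_def by (intro nn_integral_eq_integral integrable_fst) auto

text \<open>The gap in \<open>powr_less_affine\<close> has mean \<open>1 - h \<beta>\<close>,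
  because the moment of order \<alpha> is 1. It is positive off
  \<open>\<bar>fst s\<bar> = 1\<close>, and by \<open>not_unimodular\<close> that happens with
  positive probability.\<close>

lemma h_less_1:
  assumes "0 < \<beta>" "\<beta> < \<alpha>"
  shows "h \<beta> < 1"
proof -
  let ?g = "\<lambda>s. 1 + \<beta> / \<alpha> * (\<bar>fst s\<bar> powr \<alpha> - 1) - \<bar>fst s\<bar> powr \<beta>"
  have int: "integrable N ?g"
    using assms integrable_fst[of \<alpha>] integrable_fst[of \<beta>] by simp
  have pos: "0 \<le> ?g s" "\<bar>fst s\<bar> \<noteq> 1 \<Longrightarrow> 0 < ?g s" for s
    using powr_less_affine[of "\<bar>fst s\<bar>" \<beta> \<alpha>] assms by (cases "\<bar>fst s\<bar> = 1"; simp)+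
  have "(\<integral>s. ?g s \<partial>N) = 1 - h \<beta>"
    using assms integrable_fst[of \<alpha>] integrable_fst[of \<beta>] integral_fst
    by (simp add: h_def M.prob_space)
  moreover have "0 \<le> (\<integral>s. ?g s \<partial>N)" using pos by (intro integral_nonneg_AE) auto
  moreover have "(\<integral>s. ?g s \<partial>N) \<noteq> 0"
  proof
    assume "(\<integral>s. ?g s \<partial>N) = 0"
    then have "AE s in N. ?g s = 0"
      using pos by (subst (asm) integral_nonneg_eq_0_iff_AE[OF int]) auto
    then have "AE s in N. \<bar>fst s\<bar> = 1"
      by eventually_elim (metis pos(2) less_irrefl)
    then show False using not_unimodular by contradiction
  qed
  ultimately show ?thesis by linarith
qed

lemma h_tendsto_1:
  assumes "\<And>n. 0 \<le> \<beta> n" "\<And>n. \<beta> n \<le> \<alpha>" "\<beta> \<longlonglongrightarrow> \<alpha>"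
  shows "(\<lambda>n. h (\<beta> n)) \<longlonglongrightarrow> 1"
proof -
  have "(\<lambda>n. h (\<beta> n)) \<longlonglongrightarrow> (\<integral>s. \<bar>fst s\<bar> powr \<alpha> \<partial>N)"
    unfolding h_def
  proof (rule integral_dominated_convergence[where w = "\<lambda>s. 1 + \<bar>fst s\<bar> powr \<alpha>"])
    show "integrable N (\<lambda>s. 1 + \<bar>fst s\<bar> powr \<alpha>)" using integrable_fst[of \<alpha>] \<alpha>_pos by simp
    show "AE s in N. (\<lambda>n. \<bar>fst s\<bar> powr \<beta> n) \<longlonglongrightarrow> \<bar>fst s\<bar> powr \<alpha>"
    proof (intro AE_I2)
      fix s :: "real \<times> 'v"
      show "(\<lambda>n. \<bar>fst s\<bar> powr \<beta> n) \<longlonglongrightarrow> \<bar>fst s\<bar> powr \<alpha>"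
        using assms by (cases "fst s = 0") (auto intro!: tendsto_intros)
    qed
  qed (use assms in \<open>auto intro!: AE_I2 powr_le_one_add_powr\<close>)
  then show ?thesis by (simp add: integral_fst)
qed

lemma nn_integral_snd_finite:
  assumes "0 \<le> \<beta>" "\<beta> \<le> \<alpha>"
  shows "(\<integral>\<^sup>+s. ennreal (norm (snd s) powr \<beta>) \<partial>N) \<le> 1 + (\<integral>\<^sup>+s. ennreal (norm (snd s) powr \<alpha>) \<partial>N)"
proof -
  have "(\<integral>\<^sup>+s. ennreal (norm (snd s) powr \<beta>) \<partial>N) \<le> (\<integral>\<^sup>+s. 1 + ennreal (norm (snd s) powr \<alpha>) \<partial>N)"
    using assms powr_le_one_add_powr[of "norm (snd _)" \<beta> \<alpha>]
    by (intro nn_integral_mono) (simp flip: ennreal_1 ennreal_plus)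
  also have "\<dots> = 1 + (\<integral>\<^sup>+s. ennreal (norm (snd s) powr \<alpha>) \<partial>N)"
    by (simp add: nn_integral_add M.emeasure_space_1)
  finally show ?thesis .
qed

end

subsection \<open>Upper bounds for moments of the series\<close>

lemma geometric_recursion_bound:
  fixes e :: "nat \<Rightarrow> ennreal"
  assumes "e 0 = 0" and step: "\<And>n. e (Suc n) \<le> ennreal r * e n + ennreal C"
    and "0 \<le> r" "r < 1" "0 \<le> C"
  shows "e n \<le> ennreal (C / (1 - r))"
proof (induction n)
  case 0
  then show ?case using assms by simp
next
  case (Suc n)
  have "e (Suc n) \<le> ennreal r * ennreal (C / (1 - r)) + ennreal C"
    using step[of n] Suc.IH by (meson add_right_mono mult_left_mono order_trans zero_le)
  also have "\<dots> = ennreal (r * (C / (1 - r)) + C)"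
    using assms by (simp flip: ennreal_mult ennreal_plus)
  also have "r * (C / (1 - r)) + C = C / (1 - r)" using assms by (simp add: field_simps)
  finally show ?case .
qed

context perpetuity
begin

lemma nn_integral_asum_Suc_le:
  assumes g: "\<And>x y. 0 \<le> x \<Longrightarrow> 0 \<le> y \<Longrightarrow> (x + y) powr \<beta> \<le> g x y"
    and [measurable]: "(\<lambda>(x, y). g x y) \<in> borel_measurable (borel \<Otimes>\<^sub>M borel)"
  shows "(\<integral>\<^sup>+z. ennreal (asum (Suc n) z powr \<beta>) \<partial>S) \<le>
    (\<integral>\<^sup>+s. (\<integral>\<^sup>+z. ennreal (g (\<bar>fst s\<bar> * asum n z) (norm (snd s))) \<partial>S) \<partial>N)"
  by (subst nn_integral_iter, measurable)
    (auto intro!: nn_integral_mono ennreal_leI g simp: asum_nonneg)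

text \<open>Splitting off the first step with \<open>powr_add_le_weighted\<close> multiplies the
  moment by \<open>(1 + \<delta>) powr \<beta> * h \<beta>\<close>, which a small \<delta> keeps
  below 1. The constant is not controlled as \<beta> approaches \<alpha>; its use is for one fixed
  order below \<alpha>.\<close>

lemma asum_moment_bounded:
  assumes \<beta>: "0 < \<beta>" "\<beta> < \<alpha>"
  obtains C where "0 \<le> C" "\<And>n. (\<integral>\<^sup>+z. ennreal (asum n z powr \<beta>) \<partial>S) \<le> ennreal C"
proof -
  obtain \<delta> where \<delta>: "0 < \<delta>" "(1 + \<delta>) powr \<beta> * h \<beta> < 1"
  proof -
    have "((\<lambda>d. (1 + d) powr \<beta> * h \<beta>) \<longlongrightarrow> (1 + 0) powr \<beta> * h \<beta>) (at_right 0)"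
      by (intro tendsto_intros) auto
    then have "\<forall>\<^sub>F d in at_right 0. (1 + d) powr \<beta> * h \<beta> < 1"
      using h_less_1[OF \<beta>] by (auto intro: order_tendstoD)
    moreover have "\<forall>\<^sub>F d in at_right 0. (0::real) < d"
      by (simp add: eventually_at_right_less)
    ultimately have "\<forall>\<^sub>F d in at_right 0. 0 < d \<and> (1 + d) powr \<beta> * h \<beta> < 1"
      by eventually_elim simp
    from eventually_happens[OF this] show ?thesis using that by auto
  qed
  let ?q = "\<integral>s. norm (snd s) powr \<beta> \<partial>N"
  let ?e = "\<lambda>n. (\<integral>\<^sup>+z. ennreal (asum n z powr \<beta>) \<partial>S)"
  have int: "integrable N (\<lambda>s. norm (snd s) powr \<beta>)"
  proof (rule Bochner_Integration.integrable_bound)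
    show "integrable N (\<lambda>s. 1 + norm (snd s) powr \<alpha>)" using integrable_snd by simp
  qed (use \<beta> in \<open>auto intro!: AE_I2 powr_le_one_add_powr\<close>)
  define C where "C = (1 + 1 / \<delta>) powr \<beta> * ?q"
  have "0 \<le> C" by (auto simp: C_def intro!: mult_nonneg_nonneg integral_nonneg_AE)
  have step: "?e (Suc n) \<le> ennreal ((1 + \<delta>) powr \<beta> * h \<beta>) * ?e n + ennreal C" for n
  proof -
    have "?e (Suc n) \<le> (\<integral>\<^sup>+s. (\<integral>\<^sup>+z. ennreal ((1 + \<delta>) powr \<beta> * (\<bar>fst s\<bar> * asum n z) powr \<beta> +
        (1 + 1 / \<delta>) powr \<beta> * norm (snd s) powr \<beta>) \<partial>S) \<partial>N)"
      using \<beta> \<delta> by (intro nn_integral_asum_Suc_le powr_add_le_weighted) auto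
    also have "\<dots> = (\<integral>\<^sup>+s. (\<integral>\<^sup>+z. ennreal ((1 + \<delta>) powr \<beta>) * ennreal (\<bar>fst s\<bar> powr \<beta>) * ennreal (asum n z powr \<beta>) +
        ennreal ((1 + 1 / \<delta>) powr \<beta>) * ennreal (norm (snd s) powr \<beta>) \<partial>S) \<partial>N)"
      by (intro nn_integral_cong) (simp add: powr_mult asum_nonneg mult_ac flip: ennreal_mult ennreal_plus)
    also have "\<dots> = ennreal ((1 + \<delta>) powr \<beta>) * (\<integral>\<^sup>+s. ennreal (\<bar>fst s\<bar> powr \<beta>) \<partial>N) * ?e n +
        ennreal ((1 + 1 / \<delta>) powr \<beta>) * (\<integral>\<^sup>+s. ennreal (norm (snd s) powr \<beta>) \<partial>N)"
      by (simp add: nn_integral_add nn_integral_cmult nn_integral_multc P.emeasure_space_1)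
    also have "\<dots> = ennreal ((1 + \<delta>) powr \<beta> * h \<beta>) * ?e n + ennreal C"
      using \<beta> int by (simp add: nn_integral_fst nn_integral_eq_integral C_def ennreal_mult h_nonneg integral_nonneg_AE)
    finally show ?thesis .
  qed
  have "?e n \<le> ennreal (C / (1 - (1 + \<delta>) powr \<beta> * h \<beta>))" for n
    using \<delta> \<open>0 \<le> C\<close> by (intro geometric_recursion_bound step) (auto simp: h_nonneg asum_def)
  then show ?thesis
    using that \<delta> \<open>0 \<le> C\<close> by (meson diff_ge_0_iff_ge divide_nonneg_nonneg less_imp_le)
qed

text \<open>Minkowski's inequality would give the order \<open>(1 - h \<beta>) powr - \<beta>\<close> for \<open>\<beta> > 1\<close>; the exact order comes
  from bounding \<open>(x + y) powr \<beta> - x powr \<beta>\<close> by moments of order less than \<open>\<alpha> - \<theta>\<close>.\<close>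
lemma asum_moment_uniform:
  obtains C where "0 \<le> C"
    "\<And>\<beta> n. \<alpha> / 2 \<le> \<beta> \<Longrightarrow> \<beta> < \<alpha> \<Longrightarrow>
      (\<integral>\<^sup>+z. ennreal (asum n z powr \<beta>) \<partial>S) \<le> ennreal (C / (1 - h \<beta>))"
proof -
  \<comment> \<open>\<open>\<theta> \<le> 1\<close> is what the interpolated inequality requires,
    and \<open>\<theta> \<le> \<alpha> / 4\<close> keeps \<open>\<beta> - \<theta>\<close> positive
    for \<open>\<beta> \<ge> \<alpha> / 2\<close>. All orders \<open>\<beta> - \<theta>\<close> stay
    below \<open>\<alpha> - \<theta>\<close>, so the single constant \<open>K\<close> serves every
    \<beta>.\<close>
  define \<theta> where "\<theta> = min 1 (\<alpha> / 4)"
  have \<theta>: "0 < \<theta>" "\<theta> \<le> 1" "\<theta> \<le> \<alpha> / 4" using \<alpha>_pos by (auto simp: \<theta>_def)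
  obtain K where K: "0 \<le> K" "\<And>n. (\<integral>\<^sup>+z. ennreal (asum n z powr (\<alpha> - \<theta>)) \<partial>S) \<le> ennreal K"
    using asum_moment_bounded[of "\<alpha> - \<theta>"] \<theta> \<alpha>_pos by auto
  define q where "q = 1 + (\<integral>s. norm (snd s) powr \<alpha> \<partial>N)"
  have q: "1 \<le> q" unfolding q_def by (simp add: integral_nonneg_AE)
  have snd_le: "(\<integral>\<^sup>+s. ennreal (norm (snd s) powr \<beta>) \<partial>N) \<le> ennreal q" if "0 \<le> \<beta>" "\<beta> \<le> \<alpha>" for \<beta>
    using nn_integral_snd_finite[OF that] integrable_snd
    by (simp add: q_def nn_integral_eq_integral integral_nonneg_AE)
  define C where "C = \<alpha> * 2 powr \<alpha> * ((q + 1) * (1 + K)) + 2 powr \<alpha> * q"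
  have "0 \<le> C" using \<alpha>_pos q K by (simp add: C_def)
  moreover
  {
    fix \<beta> n assume \<beta>: "\<alpha> / 2 \<le> \<beta>" "\<beta> < \<alpha>"
    let ?e = "\<lambda>n. (\<integral>\<^sup>+z. ennreal (asum n z powr \<beta>) \<partial>S)"
    have low: "(\<integral>\<^sup>+z. ennreal (asum n z powr (\<beta> - \<theta>)) \<partial>S) \<le> ennreal (1 + K)" for n
    proof -
      have "(\<integral>\<^sup>+z. ennreal (asum n z powr (\<beta> - \<theta>)) \<partial>S) \<le> (\<integral>\<^sup>+z. 1 + ennreal (asum n z powr (\<alpha> - \<theta>)) \<partial>S)"
        using \<beta> \<theta> powr_le_one_add_powr[of "asum n _" "\<beta> - \<theta>" "\<alpha> - \<theta>"]
        by (intro nn_integral_mono) (simp add: asum_nonneg flip: ennreal_1 ennreal_plus)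
      also have "\<dots> \<le> 1 + ennreal K"
        using K(2)[of n] by (simp add: nn_integral_add P.emeasure_space_1)
      finally show ?thesis using K(1) by simp
    qed
    have mixed: "(\<integral>\<^sup>+s. ennreal (norm (snd s) powr \<theta>) * ennreal (\<bar>fst s\<bar> powr (\<beta> - \<theta>)) \<partial>N) \<le> ennreal (q + 1)"
    proof -
      have "(\<integral>\<^sup>+s. ennreal (norm (snd s) powr \<theta>) * ennreal (\<bar>fst s\<bar> powr (\<beta> - \<theta>)) \<partial>N) \<le>
        (\<integral>\<^sup>+s. ennreal (norm (snd s) powr \<beta>) + ennreal (\<bar>fst s\<bar> powr \<beta>) \<partial>N)"
        using \<theta> \<beta> powr_mult_powr_le[of "\<bar>fst _\<bar>" "norm (snd _)" \<theta> \<beta>]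
        by (intro nn_integral_mono) (simp flip: ennreal_mult ennreal_plus)
      also have "\<dots> = (\<integral>\<^sup>+s. ennreal (norm (snd s) powr \<beta>) \<partial>N) + ennreal (h \<beta>)"
        using \<beta> \<alpha>_pos by (simp add: nn_integral_add nn_integral_fst)
      also have "\<dots> \<le> ennreal q + ennreal 1"
        using \<beta> \<alpha>_pos h_less_1[of \<beta>] by (intro add_mono snd_le ennreal_leI) auto
      finally show ?thesis using q by simp
    qed
    have "?e (Suc n) \<le> ennreal (h \<beta>) * ?e n + ennreal C" for n
    proof -
      have "?e (Suc n) \<le> (\<integral>\<^sup>+s. (\<integral>\<^sup>+z. ennreal ((\<bar>fst s\<bar> * asum n z) powr \<beta> +
          \<alpha> * 2 powr \<alpha> * (norm (snd s) powr \<theta> * (\<bar>fst s\<bar> * asum n z) powr (\<beta> - \<theta>)) +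
          2 powr \<alpha> * norm (snd s) powr \<beta>) \<partial>S) \<partial>N)"
        using \<beta> \<theta> \<alpha>_pos by (intro nn_integral_asum_Suc_le powr_add_le_interpolated) auto
      also have "\<dots> = (\<integral>\<^sup>+s. (\<integral>\<^sup>+z. ennreal (\<bar>fst s\<bar> powr \<beta>) * ennreal (asum n z powr \<beta>) +
          ennreal (\<alpha> * 2 powr \<alpha>) * (ennreal (norm (snd s) powr \<theta>) * ennreal (\<bar>fst s\<bar> powr (\<beta> - \<theta>))) * ennreal (asum n z powr (\<beta> - \<theta>)) +
          ennreal (2 powr \<alpha>) * ennreal (norm (snd s) powr \<beta>) \<partial>S) \<partial>N)"
        using \<alpha>_pos
        by (intro nn_integral_cong) (simp add: powr_mult asum_nonneg mult_ac flip: ennreal_mult ennreal_plus)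
      also have "\<dots> = (\<integral>\<^sup>+s. ennreal (\<bar>fst s\<bar> powr \<beta>) \<partial>N) * ?e n +
          ennreal (\<alpha> * 2 powr \<alpha>) * (\<integral>\<^sup>+s. ennreal (norm (snd s) powr \<theta>) * ennreal (\<bar>fst s\<bar> powr (\<beta> - \<theta>)) \<partial>N)
            * (\<integral>\<^sup>+z. ennreal (asum n z powr (\<beta> - \<theta>)) \<partial>S) +
          ennreal (2 powr \<alpha>) * (\<integral>\<^sup>+s. ennreal (norm (snd s) powr \<beta>) \<partial>N)"
        by (simp add: nn_integral_add nn_integral_cmult nn_integral_multc P.emeasure_space_1)
      also have "\<dots> \<le> ennreal (h \<beta>) * ?e n + ennreal (\<alpha> * 2 powr \<alpha>) * ennreal (q + 1) * ennreal (1 + K) +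
          ennreal (2 powr \<alpha>) * ennreal q"
        using \<beta> \<alpha>_pos
        by (intro add_mono mult_mono mixed low snd_le) (auto simp: nn_integral_fst)
      also have "\<dots> = ennreal (h \<beta>) * ?e n + ennreal C"
        using \<alpha>_pos q K(1) by (simp add: C_def add.assoc mult_ac flip: ennreal_mult ennreal_plus)
      finally show ?thesis .
    qed
    then have "?e n \<le> ennreal (C / (1 - h \<beta>))"
      using \<beta> \<alpha>_pos \<open>0 \<le> C\<close> h_less_1[of \<beta>]
      by (intro geometric_recursion_bound) (auto simp: h_nonneg asum_def)
  }
  ultimately show ?thesis using that by blast
qed

text \<open>Monotone convergence carries the bound, uniform in n, to the moment of the supremum,
  which is therefore almost surely finite. Absolute convergence of the series thus comes from a
  moment of order \<open>\<alpha> / 2\<close>.\<close>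

lemma AE_bounded_asum: "AE z in S. \<exists>B. \<forall>n. asum n z \<le> B"
proof -
  define \<beta> where "\<beta> = \<alpha> / 2"
  have \<beta>: "0 < \<beta>" "\<beta> < \<alpha>" using \<alpha>_pos by (auto simp: \<beta>_def)
  obtain C where C: "\<And>n. (\<integral>\<^sup>+z. ennreal (asum n z powr \<beta>) \<partial>S) \<le> ennreal C"
    using asum_moment_bounded[OF \<beta>] by metis
  have mono: "asum m z \<le> asum n z" if "m \<le> n" for m n and z :: "nat \<Rightarrow> real \<times> 'v"
    unfolding asum_def using that by (intro sum_mono2) auto
  have "(\<integral>\<^sup>+z. (SUP n. ennreal (asum n z powr \<beta>)) \<partial>S) = (SUP n. \<integral>\<^sup>+z. ennreal (asum n z powr \<beta>) \<partial>S)"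
    using \<beta> by (intro nn_integral_monotone_convergence_SUP)
      (auto simp: incseq_def le_fun_def intro!: ennreal_leI powr_mono2 mono asum_nonneg)
  also have "\<dots> \<le> ennreal C" using C by (intro SUP_least)
  finally have "AE z in S. (SUP n. ennreal (asum n z powr \<beta>)) \<noteq> \<infinity>"
    by (intro nn_integral_PInf_AE) (auto simp: top_unique)
  then show ?thesis
  proof eventually_elim
    case (elim z)
    then obtain b where b: "0 \<le> b" "(SUP n. ennreal (asum n z powr \<beta>)) = ennreal b"
      by (cases "SUP n. ennreal (asum n z powr \<beta>)") auto
    have "asum n z \<le> b powr (1 / \<beta>)" for n
    proof -
      have "ennreal (asum n z powr \<beta>) \<le> ennreal b" unfolding b(2)[symmetric] by (rule SUP_upper) simp
      then have "asum n z powr \<beta> \<le> b" using b(1) by simp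
      then have "(asum n z powr \<beta>) powr (1 / \<beta>) \<le> b powr (1 / \<beta>)" using \<beta> by (intro powr_mono2) auto
      then show ?thesis using \<beta> by (simp add: powr_powr asum_nonneg)
    qed
    then show ?case by blast
  qed
qed

lemma AE_summable: "AE z in S. summable (\<lambda>n. cprod n z *\<^sub>R snd (z n))"
  using AE_bounded_asum
proof eventually_elim
  case (elim z)
  then obtain B where B: "\<And>n. asum n z \<le> B" by auto
  have "summable (\<lambda>n. norm (cprod n z *\<^sub>R snd (z n)))"
  proof (rule bounded_imp_summable)
    show "(\<Sum>k\<le>n. norm (cprod k z *\<^sub>R snd (z k))) \<le> B" for n
      using B[of "Suc n"] by (simp add: asum_def lessThan_Suc_atMost del: sum.lessThan_Suc)
  qed simp
  then show ?case by (rule summable_norm_cancel)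
qed

text \<open>Fatou's lemma along the partial sums, whose norms are dominated by
  \<open>asum\<close>.\<close>

lemma perp_moment_uniform:
  obtains C where "0 \<le> C"
    "\<And>\<beta>. \<alpha> / 2 \<le> \<beta> \<Longrightarrow> \<beta> < \<alpha> \<Longrightarrow>
      (\<integral>\<^sup>+z. ennreal (norm (perp_series z) powr \<beta>) \<partial>S) \<le> ennreal (C / (1 - h \<beta>))"
proof -
  obtain C where C: "0 \<le> C" "\<And>\<beta> n. \<alpha> / 2 \<le> \<beta> \<Longrightarrow> \<beta> < \<alpha> \<Longrightarrow>
      (\<integral>\<^sup>+z. ennreal (asum n z powr \<beta>) \<partial>S) \<le> ennreal (C / (1 - h \<beta>))"
    using asum_moment_uniform by metis
  {
    fix \<beta> assume \<beta>: "\<alpha> / 2 \<le> \<beta>" "\<beta> < \<alpha>"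
    have "(\<integral>\<^sup>+z. ennreal (norm (perp_series z) powr \<beta>) \<partial>S) \<le> (\<integral>\<^sup>+z. liminf (\<lambda>n. ennreal (asum n z powr \<beta>)) \<partial>S)"
    proof (rule nn_integral_mono_AE)
      show "AE z in S. ennreal (norm (perp_series z) powr \<beta>) \<le> liminf (\<lambda>n. ennreal (asum n z powr \<beta>))"
        using AE_summable
      proof eventually_elim
        case (elim z)
        then have "(\<lambda>n. psum n z) \<longlonglongrightarrow> perp_series z"
          unfolding perp_series_def psum_def by (rule summable_LIMSEQ)
        then have "(\<lambda>n. ennreal (norm (psum n z) powr \<beta>)) \<longlonglongrightarrow> ennreal (norm (perp_series z) powr \<beta>)"
          using \<beta> \<alpha>_pos by (intro tendsto_ennrealI tendsto_powr' tendsto_norm tendsto_const) auto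
        then have "ennreal (norm (perp_series z) powr \<beta>) = liminf (\<lambda>n. ennreal (norm (psum n z) powr \<beta>))"
          by (intro lim_imp_Liminf[symmetric]) auto
        also have "\<dots> \<le> liminf (\<lambda>n. ennreal (asum n z powr \<beta>))"
        proof (intro Liminf_mono always_eventually allI ennreal_leI powr_mono2)
          fix n
          show "norm (psum n z) \<le> asum n z"
            unfolding psum_def asum_def by (rule order_trans[OF norm_sum]) simp
        qed (use \<beta> \<alpha>_pos in auto)
        finally show ?case .
      qed
    qed
    also have "\<dots> \<le> liminf (\<lambda>n. \<integral>\<^sup>+z. ennreal (asum n z powr \<beta>) \<partial>S)"
      by (rule nn_integral_liminf) measurable
    also have "\<dots> \<le> liminf (\<lambda>n::nat. ennreal (C / (1 - h \<beta>)))"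
      using C(2)[OF \<beta>] by (intro Liminf_mono always_eventually allI)
    also have "\<dots> = ennreal (C / (1 - h \<beta>))" by (simp add: Liminf_const)
    finally have "(\<integral>\<^sup>+z. ennreal (norm (perp_series z) powr \<beta>) \<partial>S) \<le> ennreal (C / (1 - h \<beta>))" .
  }
  then show ?thesis using that C(1) by blast
qed

end

subsection \<open>Lower bounds for moments of the running maximum\<close>

context perpetuity
begin

text \<open>\<open>ennreal\<close> sends negative numbers to 0, so
  \<open>ennreal (1 - t powr \<beta>)\<close> is a positive part, and
  \<open>max 1 t powr \<beta>\<close> equals \<open>t powr \<beta>\<close> plus this positive part.
  Applied after splitting off the first step, this makes the recursion an identity.\<close>

lemma cmax_moment_recursion:
  assumes "0 < \<beta>" "\<beta> \<le> \<alpha>"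
  shows "(\<integral>\<^sup>+z. ennreal (cmax (Suc n) z powr \<beta>) \<partial>S) =
    ennreal (h \<beta>) * (\<integral>\<^sup>+z. ennreal (cmax n z powr \<beta>) \<partial>S) +
    (\<integral>\<^sup>+s. (\<integral>\<^sup>+z. ennreal (1 - (\<bar>fst s\<bar> * cmax n z) powr \<beta>) \<partial>S) \<partial>N)"
proof -
  have split: "ennreal (max 1 t powr \<beta>) = ennreal (t powr \<beta>) + ennreal (1 - t powr \<beta>)" if "0 \<le> t" for t
  proof (cases "t \<le> 1")
    case True
    then have "t powr \<beta> \<le> 1" using assms that by (intro powr_le1) auto
    then show ?thesis using True by (simp add: max_def flip: ennreal_plus)
  next
    case False
    then have "1 \<le> t powr \<beta>" using assms by (intro ge_one_powr_ge_zero) auto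
    then show ?thesis using False by (simp add: max_def ennreal_neg)
  qed
  have cpos: "0 \<le> cmax n z" for z :: "nat \<Rightarrow> real \<times> 'v" using cmax_ge_1[of n z] by linarith
  have "(\<integral>\<^sup>+z. ennreal (cmax (Suc n) z powr \<beta>) \<partial>S) =
    (\<integral>\<^sup>+s. (\<integral>\<^sup>+z. ennreal (\<bar>fst s\<bar> powr \<beta>) * ennreal (cmax n z powr \<beta>) +
      ennreal (1 - (\<bar>fst s\<bar> * cmax n z) powr \<beta>) \<partial>S) \<partial>N)"
  proof (subst nn_integral_iter)
    show "(\<integral>\<^sup>+s. (\<integral>\<^sup>+z. ennreal (cmax (Suc n) (case_nat s z) powr \<beta>) \<partial>S) \<partial>N) =
      (\<integral>\<^sup>+s. (\<integral>\<^sup>+z. ennreal (\<bar>fst s\<bar> powr \<beta>) * ennreal (cmax n z powr \<beta>) +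
        ennreal (1 - (\<bar>fst s\<bar> * cmax n z) powr \<beta>) \<partial>S) \<partial>N)"
      unfolding cmax_case_nat
      by (intro nn_integral_cong, subst split) (simp_all add: cpos powr_mult ennreal_mult)
  qed measurable
  also have "\<dots> = (\<integral>\<^sup>+s. ennreal (\<bar>fst s\<bar> powr \<beta>) \<partial>N) * (\<integral>\<^sup>+z. ennreal (cmax n z powr \<beta>) \<partial>S) +
    (\<integral>\<^sup>+s. (\<integral>\<^sup>+z. ennreal (1 - (\<bar>fst s\<bar> * cmax n z) powr \<beta>) \<partial>S) \<partial>N)"
    by (simp add: nn_integral_add nn_integral_cmult nn_integral_multc)
  finally show ?thesis using assms by (simp add: nn_integral_fst)
qed

text \<open>The last term of the recursion increases with \<open>\<beta>\<close>,
  and at \<open>\<gamma>\<close> it is at least \<open>1 - h \<gamma>\<close> because the moments are nondecreasing in \<open>n\<close>.\<close>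
lemma cmax_moment_lower:
  assumes \<gamma>: "0 < \<gamma>" "\<gamma> \<le> \<beta>" and \<beta>: "\<beta> < \<alpha>"
  shows "ennreal ((1 - h \<gamma>) * (1 - h \<beta> ^ Suc n) / (1 - h \<beta>)) \<le> (\<integral>\<^sup>+z. ennreal (cmax n z powr \<beta>) \<partial>S)"
proof -
  let ?m = "\<lambda>\<beta> n. \<integral>\<^sup>+z. ennreal (cmax n z powr \<beta>) \<partial>S"
  let ?J = "\<lambda>\<beta> n. \<integral>\<^sup>+s. (\<integral>\<^sup>+z. ennreal (1 - (\<bar>fst s\<bar> * cmax n z) powr \<beta>) \<partial>S) \<partial>N"
  have h: "0 \<le> h \<gamma>" "h \<gamma> < 1" "0 \<le> h \<beta>" "h \<beta> < 1" using assms h_less_1[of \<gamma>] h_less_1[of \<beta>] h_nonneg by auto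
  have cpos: "0 \<le> cmax n z" for n and z :: "nat \<Rightarrow> real \<times> 'v" using cmax_ge_1[of n z] by linarith
  have rec: "?m \<delta> (Suc n) = ennreal (h \<delta>) * ?m \<delta> n + ?J \<delta> n" if "\<delta> \<in> {\<gamma>, \<beta>}" for \<delta> n
    using that assms by (intro cmax_moment_recursion) auto
  have J_le_1: "?J \<gamma> n \<le> 1" for n
  proof -
    have "?J \<gamma> n \<le> (\<integral>\<^sup>+s. (\<integral>\<^sup>+z. 1 \<partial>S) \<partial>N)"
      by (intro nn_integral_mono) (auto simp flip: ennreal_1)
    then show ?thesis by (simp add: P.emeasure_space_1 M.emeasure_space_1)
  qed
  \<comment> \<open>Finiteness allows the moment to be moved across the inequality when
    \<open>J\<gamma>\<close> is derived.\<close>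
  have fin: "?m \<gamma> n < \<infinity>" for n
  proof (induction n)
    case (Suc n)
    then show ?case using rec[of \<gamma> n] J_le_1[of n]
      by (auto simp: ennreal_mult_less_top order_le_less_trans)
  qed (simp add: P.emeasure_space_1)
  have m_ge_1: "1 \<le> ?m \<gamma> n" for n
  proof -
    have "(\<integral>\<^sup>+z. 1 \<partial>S) \<le> ?m \<gamma> n"
      using \<gamma> by (intro nn_integral_mono) (simp add: cmax_ge_1 ge_one_powr_ge_zero flip: ennreal_1)
    then show ?thesis by (simp add: P.emeasure_space_1)
  qed
  have J\<gamma>: "ennreal (1 - h \<gamma>) \<le> ?J \<gamma> n" for n
  proof -
    have "?m \<gamma> n \<le> ?m \<gamma> (Suc n)"
      using \<gamma> by (intro nn_integral_mono ennreal_leI powr_mono2 cmax_le_Suc cpos) auto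
    then have *: "?m \<gamma> n \<le> ennreal (h \<gamma>) * ?m \<gamma> n + ?J \<gamma> n" by (simp only: rec insertI1)
    obtain m where m: "?m \<gamma> n = ennreal m" "0 \<le> m" using fin[of n] by (cases "?m \<gamma> n") auto
    obtain j where j: "?J \<gamma> n = ennreal j" "0 \<le> j"
      using J_le_1[of n] by (cases "?J \<gamma> n") (auto simp: top_unique)
    have "1 \<le> m" using m_ge_1[of n] m by simp
    have "m \<le> h \<gamma> * m + j"
      using * m j h by (simp flip: ennreal_mult ennreal_plus)
    then have "(1 - h \<gamma>) * m \<le> j" by (simp add: algebra_simps)
    moreover have "1 - h \<gamma> \<le> (1 - h \<gamma>) * m"
      using mult_left_mono[OF \<open>1 \<le> m\<close>, of "1 - h \<gamma>"] h by simp
    ultimately have "1 - h \<gamma> \<le> j" by (rule order_trans[rotated])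
    then show ?thesis using j by simp
  qed
  have J\<beta>: "ennreal (1 - h \<gamma>) \<le> ?J \<beta> n" for n
  proof -
    have "ennreal (1 - t powr \<gamma>) \<le> ennreal (1 - t powr \<beta>)" if "0 \<le> t" for t
    proof (cases "t \<le> 1")
      case True
      then have "t powr \<beta> \<le> t powr \<gamma>" using that \<gamma> by (intro powr_mono') auto
      then show ?thesis by (intro ennreal_leI) simp
    next
      case False
      then have "1 \<le> t powr \<gamma>" using \<gamma> by (intro ge_one_powr_ge_zero) auto
      then show ?thesis by (simp add: ennreal_neg)
    qed
    then have "?J \<gamma> n \<le> ?J \<beta> n" by (intro nn_integral_mono) (simp add: cpos)
    then show ?thesis using J\<gamma>[of n] by (rule order_trans[rotated])
  qed
  \<comment> \<open>The claimed bound is \<open>1 - h \<gamma>\<close> times the sum of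
    \<open>h \<beta> ^ i\<close> over \<open>i \<le> n\<close>, that is, the unrolled recursion. It
    starts from the moment 1 of \<open>cmax 0\<close>, which is at least
    \<open>1 - h \<gamma>\<close>.\<close>
  show ?thesis
  proof (induction n)
    case 0
    then show ?case using h by (simp add: P.emeasure_space_1)
  next
    case (Suc n)
    let ?c = "1 - h \<gamma>"
    have nn: "0 \<le> 1 - h \<beta> ^ Suc n" using h by (simp add: power_le_one del: power_Suc)
    have "?c * (1 - h \<beta> ^ Suc (Suc n)) / (1 - h \<beta>) = h \<beta> * (?c * (1 - h \<beta> ^ Suc n) / (1 - h \<beta>)) + ?c"
      using h by (simp add: field_simps)
    then have "ennreal (?c * (1 - h \<beta> ^ Suc (Suc n)) / (1 - h \<beta>)) =
        ennreal (h \<beta>) * ennreal (?c * (1 - h \<beta> ^ Suc n) / (1 - h \<beta>)) + ennreal ?c"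
      using h nn by (simp flip: ennreal_mult ennreal_plus del: power_Suc)
    also have "\<dots> \<le> ennreal (h \<beta>) * ?m \<beta> n + ?J \<beta> n"
      using Suc.IH by (intro add_mono mult_left_mono J\<beta>) auto
    also have "\<dots> = ?m \<beta> (Suc n)" by (simp only: rec insertI1 insertI2)
    finally show ?case .
  qed
qed

end

subsection \<open>First passage\<close>

text \<open>The normalisation in \<open>spectral_component\<close>. The default
  \<open>dir 0 = 0\<close> lies off the sphere, which is why nonzero vectors are singled out
  below.\<close>

definition dir :: "'v::euclidean_space \<Rightarrow> 'v" where
  "dir v = inverse (infnorm v) *\<^sub>R v"

lemma dir_scaleR: "0 < c \<Longrightarrow> dir (c *\<^sub>R v) = dir v"
  by (simp add: dir_def infnorm_mul)

lemma isCont_dir: "v \<noteq> 0 \<Longrightarrow> isCont dir v"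
  unfolding dir_def by (intro continuous_intros) (simp add: infnorm_eq_0)

lemma borel_measurable_infnorm [measurable]: "infnorm \<in> borel_measurable borel"
  by (intro borel_measurable_continuous_onI continuous_intros)

lemma borel_measurable_dir [measurable]: "dir \<in> borel_measurable borel"
  unfolding dir_def by measurable

text \<open>Membership of u in the asymptotic cone of K: some points \<open>y n\<close> of K and
  scales \<open>r n\<close> tending to infinity satisfy
  \<open>y n / r n \<rightarrow> u\<close>.\<close>

definition asymptotic_direction :: "'v::real_normed_vector set \<Rightarrow> 'v \<Rightarrow> bool" where
  "asymptotic_direction K u \<longleftrightarrow> (\<forall>\<rho>>0. \<forall>r0. \<exists>r>r0. \<exists>y\<in>K. norm (y - r *\<^sub>R u) < \<rho> * r)"

text \<open>Seen from far out, a perturbation of bounded size barely turns a vector. In the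
  application \<sigma> is the sign of the product at first passage, and e is the partial sum divided
  by the modulus of that product.\<close>

lemma asymptotic_direction_far_point:
  fixes u :: "'v::euclidean_space"
  assumes "infnorm u = 1" "\<bar>\<sigma>\<bar> = 1" "asymptotic_direction K (\<sigma> *\<^sub>R u)" "0 < \<rho>" "0 \<le> B"
  obtains y where "y \<in> K"
    "\<And>w e. w \<in> ball y 1 \<Longrightarrow> norm e \<le> B \<Longrightarrow>
      1 \<le> infnorm (\<sigma> *\<^sub>R w + e) \<and> dir (\<sigma> *\<^sub>R w + e) \<in> ball u \<rho>"
proof -
  have u: "u \<noteq> 0" "dir u = u" using assms(1) by (auto simp: infnorm_0 dir_def)
  have "(dir \<longlongrightarrow> dir u) (nhds u)"
    using isCont_dir[OF u(1)] by (simp add: tendsto_nhds_iff isCont_def)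
  moreover have "(infnorm \<longlongrightarrow> infnorm u) (nhds u)"
    by (rule tendsto_infnorm[OF filterlim_ident])
  ultimately have "\<forall>\<^sub>F v in nhds u. dir v \<in> ball u \<rho>" "\<forall>\<^sub>F v in nhds u. 1 / 2 < infnorm v"
    using assms(1,4) u(2) topological_tendstoD[of dir "dir u" "nhds u" "ball u \<rho>"]
      order_tendstoD(1)[of infnorm "infnorm u" "nhds u" "1 / 2"] by simp_all
  then have "\<forall>\<^sub>F v in nhds u. dir v \<in> ball u \<rho> \<and> 1 / 2 < infnorm v"
    by eventually_elim simp
  then obtain \<delta> where \<delta>: "0 < \<delta>"
      "\<And>v. dist v u < \<delta> \<Longrightarrow> dir v \<in> ball u \<rho> \<and> 1 / 2 < infnorm v"
    unfolding eventually_nhds_metric by auto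
  \<comment> \<open>The bound \<open>r > 2\<close> turns \<open>infnorm (v / r) > 1 / 2\<close> into
    \<open>infnorm v \<ge> 1\<close>; the other one makes the total perturbation
    \<open>1 + B\<close> less than \<open>\<delta> / 2 * r\<close>, leaving the same amount for the
    distance of y from the ray.\<close>
  obtain r y where r: "max 2 (2 * (1 + B) / \<delta>) < r" and y: "y \<in> K"
      "norm (y - r *\<^sub>R \<sigma> *\<^sub>R u) < \<delta> / 2 * r"
    using assms(3) \<delta>(1) unfolding asymptotic_direction_def by (meson half_gt_zero)
  have "0 < r" using r by simp
  have \<sigma>: "\<sigma> = 1 \<or> \<sigma> = - 1" using assms(2) by linarith
  show ?thesis
  proof (rule that[OF y(1)])
    fix w e :: 'v assume w: "w \<in> ball y 1" and e: "norm e \<le> B"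
    define v where "v = \<sigma> *\<^sub>R w + e"
    have "v - r *\<^sub>R u = \<sigma> *\<^sub>R (w - y) + \<sigma> *\<^sub>R (y - r *\<^sub>R \<sigma> *\<^sub>R u) + e"
      using \<sigma> by (elim disjE) (simp_all add: v_def algebra_simps)
    then have "norm (v - r *\<^sub>R u) \<le> norm (w - y) + norm (y - r *\<^sub>R \<sigma> *\<^sub>R u) + norm e"
      using assms(2) norm_triangle_ineq[of "\<sigma> *\<^sub>R (w - y) + \<sigma> *\<^sub>R (y - r *\<^sub>R \<sigma> *\<^sub>R u)" e]
        norm_triangle_ineq[of "\<sigma> *\<^sub>R (w - y)" "\<sigma> *\<^sub>R (y - r *\<^sub>R \<sigma> *\<^sub>R u)"] by simp
    also have "\<dots> < 1 + \<delta> / 2 * r + B"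
      using w e y(2) by (simp add: dist_norm norm_minus_commute)
    also have "\<dots> \<le> \<delta> * r"
    proof -
      have "2 * (1 + B) < r * \<delta>" using r \<delta>(1) by (simp add: field_simps)
      then show ?thesis by (simp add: field_simps)
    qed
    finally have "norm (v - r *\<^sub>R u) / r < \<delta>" using \<open>0 < r\<close> by (simp add: field_simps)
    moreover have "norm (v - r *\<^sub>R u) / r = dist ((1 / r) *\<^sub>R v) u"
    proof -
      have "(1 / r) *\<^sub>R v - u = (1 / r) *\<^sub>R (v - r *\<^sub>R u)" using \<open>0 < r\<close> by (simp add: algebra_simps)
      then show ?thesis using \<open>0 < r\<close> by (simp add: dist_norm)
    qed
    ultimately have *: "dir ((1 / r) *\<^sub>R v) \<in> ball u \<rho>" "1 / 2 < infnorm ((1 / r) *\<^sub>R v)"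
      using \<delta>(2) by auto
    then have "1 \<le> infnorm v" "dir v \<in> ball u \<rho>"
      using \<open>0 < r\<close> r dir_scaleR[of "1 / r" v] by (simp_all add: infnorm_mul field_simps)
    then show "1 \<le> infnorm (\<sigma> *\<^sub>R w + e) \<and> dir (\<sigma> *\<^sub>R w + e) \<in> ball u \<rho>"
      unfolding v_def by blast
  qed
qed

context perpetuity
begin

text \<open>The Markov property at time k as an inequality: D is decided by the first k steps, and
  from almost every past in D an independent continuation reaches E with probability at least
  p.\<close>

lemma emeasure_comb_seq_lower:
  assumes [measurable]: "D \<in> sets S" "E \<in> sets S"
    and D: "\<And>z z'. z \<in> space S \<Longrightarrow> z' \<in> space S \<Longrightarrow> comb_seq k z z' \<in> D \<longleftrightarrow> z \<in> D"
    and p: "AE z in S. z \<in> D \<longrightarrow> p \<le> emeasure S {z' \<in> space S. comb_seq k z z' \<in> E}"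
  shows "p * emeasure S D \<le> emeasure S (D \<inter> E)"
proof -
  have "p * emeasure S D = (\<integral>\<^sup>+z. p * indicator D z \<partial>S)"
    by (simp add: nn_integral_cmult_indicator)
  also have "\<dots> \<le> (\<integral>\<^sup>+z. indicator D z * emeasure S {z' \<in> space S. comb_seq k z z' \<in> E} \<partial>S)"
    using p by (intro nn_integral_mono_AE) (auto simp: indicator_def)
  also have "\<dots> = (\<integral>\<^sup>+z. (\<integral>\<^sup>+z'. indicator (D \<inter> E) (comb_seq k z z') \<partial>S) \<partial>S)"
  proof (rule nn_integral_cong)
    fix z assume z [measurable]: "z \<in> space S"
    have "(\<integral>\<^sup>+z'. indicator (D \<inter> E) (comb_seq k z z') \<partial>S) =
        (\<integral>\<^sup>+z'. indicator D z * indicator {z' \<in> space S. comb_seq k z z' \<in> E} z' \<partial>S)"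
      using z by (intro nn_integral_cong) (auto simp: D indicator_def)
    also have "\<dots> = indicator D z * emeasure S {z' \<in> space S. comb_seq k z z' \<in> E}"
      by (subst nn_integral_cmult) simp_all
    finally show "indicator D z * emeasure S {z' \<in> space S. comb_seq k z z' \<in> E} =
      (\<integral>\<^sup>+z'. indicator (D \<inter> E) (comb_seq k z z') \<partial>S)" by simp
  qed
  also have "\<dots> = (\<integral>\<^sup>+z. indicator (D \<inter> E) z \<partial>S)"
    by (rule nn_integral_comb_seq[symmetric]) measurable
  also have "\<dots> = emeasure S (D \<inter> E)" by simp
  finally show ?thesis .
qed

text \<open>The event that x is exceeded for the first time at k. Since \<open>cprod j\<close> reads
  only the coordinates below j, it is determined by the first k steps.\<close>

definition passage :: "real \<Rightarrow> nat \<Rightarrow> (nat \<Rightarrow> real \<times> 'v) set" where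
  "passage x k = {z \<in> space S. x < \<bar>cprod k z\<bar> \<and> (\<forall>j<k. \<bar>cprod j z\<bar> \<le> x)}"

lemma sets_passage [measurable]: "passage x k \<in> sets S"
  unfolding passage_def by measurable

lemma comb_seq_in_space: "z \<in> space S \<Longrightarrow> z' \<in> space S \<Longrightarrow> comb_seq k z z' \<in> space S"
  by (auto simp: space_PiM PiE_iff comb_seq_def)

lemma comb_seq_in_passage_iff:
  "z \<in> space S \<Longrightarrow> z' \<in> space S \<Longrightarrow> comb_seq k z z' \<in> passage x k \<longleftrightarrow> z \<in> passage x k"
  by (auto simp: passage_def cprod_comb_seq_le comb_seq_in_space)

lemma disjoint_passage: "disjoint_family (passage x)"
  unfolding disjoint_family_on_def passage_def
proof safe
  fix m n :: nat and z
  assume "m \<noteq> n" "x < \<bar>cprod m z\<bar>" "\<forall>j<m. \<bar>cprod j z\<bar> \<le> x" "x < \<bar>cprod n z\<bar>" "\<forall>j<n. \<bar>cprod j z\<bar> \<le> x"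
  then show "z \<in> {}" by (metis linorder_neqE_nat not_less)
qed

lemma cmax_eq_passage:
  assumes "0 < x"
  shows "{z \<in> space S. x < cmax n z} = (\<Union>k\<le>n. passage x k)"
proof (intro set_eqI iffI)
  fix z assume "z \<in> {z \<in> space S. x < cmax n z}"
  then have z: "z \<in> space S" "\<exists>k\<le>n. x < \<bar>cprod k z\<bar>" using assms by (auto simp: less_cmax_iff)
  define k where "k = (LEAST k. x < \<bar>cprod k z\<bar>)"
  have "x < \<bar>cprod k z\<bar>" unfolding k_def using z(2) by (auto intro: LeastI)
  moreover have "\<bar>cprod j z\<bar> \<le> x" if "j < k" for j
    using not_less_Least[OF that[unfolded k_def]] by simp
  moreover have "k \<le> n" using z(2) unfolding k_def by (meson Least_le order_trans)
  ultimately show "z \<in> (\<Union>k\<le>n. passage x k)" using z(1) by (auto simp: passage_def)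
qed (use assms in \<open>auto simp: passage_def less_cmax_iff\<close>)

text \<open>The slices belong to disjoint first-passage events, so their estimates add up with no
  loss as n grows.\<close>

lemma passage_slices_le:
  assumes [measurable]: "\<And>k. D k \<in> sets S" "E \<in> sets S" and "\<And>k. D k \<subseteq> passage x k"
    and le: "\<And>k. p * emeasure S (D k) \<le> emeasure S (D k \<inter> E)"
  shows "p * (\<Sum>k\<le>n. emeasure S (D k)) \<le> emeasure S E"
proof -
  have disj: "disjoint_family_on (\<lambda>k. D k \<inter> E) {..n}"
    using disjoint_passage[of x] assms(3) unfolding disjoint_family_on_def by blast
  have "p * (\<Sum>k\<le>n. emeasure S (D k)) \<le> (\<Sum>k\<le>n. emeasure S (D k \<inter> E))"
    unfolding sum_distrib_left by (intro sum_mono le)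
  also have "\<dots> = emeasure S (\<Union>k\<le>n. D k \<inter> E)"
    using disj by (intro sum_emeasure) auto
  also have "\<dots> \<le> emeasure S E" by (intro emeasure_mono) auto
  finally show ?thesis .
qed

text \<open>Each passage at k is of type \<open>G k\<close> or \<open>H k\<close>, according to
  whether the partial sum is at most \<open>B * \<bar>cprod k z\<bar>\<close>. The coefficients
  \<open>1 / p\<close> and 2 are the inverses of the probabilities p and 1/2 with which a fresh
  continuation leads to the event on the right-hand side.\<close>

lemma cmax_tail_le:
  assumes "0 < x" "0 < B" "0 < p" and V [measurable]: "V \<in> sets borel"
    and half: "ennreal (1 / 2) \<le> emeasure S {z \<in> space S. norm (perp_series z) \<le> B / 2}"
    and far: "AE z in S. \<forall>k. cprod k z \<noteq> 0 \<longrightarrow>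
      (\<exists>Y\<in>sets borel. ennreal p \<le> emeasure S {z' \<in> space S. perp_series z' \<in> Y} \<and>
        (\<forall>w\<in>Y. \<forall>e. norm e \<le> B \<longrightarrow>
          1 \<le> infnorm (sgn (cprod k z) *\<^sub>R w + e) \<and> dir (sgn (cprod k z) *\<^sub>R w + e) \<in> V))"
  shows "emeasure S {z \<in> space S. x < cmax n z} \<le>
    ennreal (1 / p) * emeasure S {z \<in> space S. x < infnorm (perp_series z) \<and> dir (perp_series z) \<in> V} +
    2 * emeasure S {z \<in> space S. x < 2 / B * norm (perp_series z)}"
proof -
  define G where "G k = passage x k \<inter> {z \<in> space S. norm (psum k z) \<le> B * \<bar>cprod k z\<bar>}" for k
  define H where "H k = passage x k \<inter> {z \<in> space S. B * \<bar>cprod k z\<bar> < norm (psum k z)}" for k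
  define E where "E = {z \<in> space S. x < infnorm (perp_series z) \<and> dir (perp_series z) \<in> V}"
  define F where "F = {z \<in> space S. x < 2 / B * norm (perp_series z)}"
  have [measurable]: "G k \<in> sets S" "H k \<in> sets S" "E \<in> sets S" "F \<in> sets S" for k
    unfolding G_def H_def E_def F_def by measurable
  have comb: "comb_seq k z z' \<in> G k \<longleftrightarrow> z \<in> G k" "comb_seq k z z' \<in> H k \<longleftrightarrow> z \<in> H k"
    if "z \<in> space S" "z' \<in> space S" for k z z'
    using that unfolding G_def H_def
    by (simp_all add: comb_seq_in_passage_iff comb_seq_in_space psum_comb_seq cprod_comb_seq_le)
  have good: "ennreal p * emeasure S (G k) \<le> emeasure S (G k \<inter> E)" for k
  proof (rule emeasure_comb_seq_lower[where k = k])
    show "AE z in S. z \<in> G k \<longrightarrow> ennreal p \<le> emeasure S {z' \<in> space S. comb_seq k z z' \<in> E}"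
      using far
    proof eventually_elim
      case (elim z)
      show ?case
      proof
        assume zG: "z \<in> G k"
        define c where "c = cprod k z"
        have z [measurable]: "z \<in> space S" and c: "x < \<bar>c\<bar>" "norm (psum k z) \<le> B * \<bar>c\<bar>"
          using zG by (auto simp: G_def passage_def c_def)
        have "c \<noteq> 0" using c(1) \<open>0 < x\<close> by auto
        have "\<exists>Y\<in>sets borel. ennreal p \<le> emeasure S {z' \<in> space S. perp_series z' \<in> Y} \<and>
            (\<forall>w\<in>Y. \<forall>e. norm e \<le> B \<longrightarrow>
              1 \<le> infnorm (sgn c *\<^sub>R w + e) \<and> dir (sgn c *\<^sub>R w + e) \<in> V)"
          using elim[rule_format, of k, folded c_def, OF \<open>c \<noteq> 0\<close>] .
        then obtain Y where Y [measurable]: "Y \<in> sets borel"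
          and Y': "ennreal p \<le> emeasure S {z' \<in> space S. perp_series z' \<in> Y} \<and>
            (\<forall>w\<in>Y. \<forall>e. norm e \<le> B \<longrightarrow>
              1 \<le> infnorm (sgn c *\<^sub>R w + e) \<and> dir (sgn c *\<^sub>R w + e) \<in> V)"
          by (rule bexE)
        note pY = conjunct1[OF Y'] and farY = conjunct2[OF Y', rule_format]
        have "AE z' in S. z' \<in> {z' \<in> space S. perp_series z' \<in> Y} \<longrightarrow> z' \<in> {z' \<in> space S. comb_seq k z z' \<in> E}"
          using AE_summable
        proof eventually_elim
          case (elim z')
          show ?case
          proof safe
            assume z': "z' \<in> space S" "perp_series z' \<in> Y"
            \<comment> \<open>Dividing by \<open>\<bar>c\<bar>\<close> instead of c keeps the
              direction; the sign stays with the continuation, and the partial sum becomes a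
              perturbation of size at most B.\<close>
            define v where "v = sgn c *\<^sub>R perp_series z' + (1 / \<bar>c\<bar>) *\<^sub>R psum k z"
            have "norm ((1 / \<bar>c\<bar>) *\<^sub>R psum k z) \<le> B"
              using c \<open>c \<noteq> 0\<close> by (simp add: field_simps)
            then have v: "1 \<le> infnorm v" "dir v \<in> V" using farY[OF z'(2)] by (auto simp: v_def)
            have "perp_series (comb_seq k z z') = \<bar>c\<bar> *\<^sub>R v"
              using \<open>c \<noteq> 0\<close> perp_comb_seq[OF elim, of k z]
              by (simp add: v_def c_def algebra_simps abs_mult_sgn)
            moreover have "x < \<bar>c\<bar> * infnorm v"
              using c(1) mult_left_mono[OF v(1) abs_ge_zero[of c]] by linarith
            ultimately show "comb_seq k z z' \<in> E"
              using \<open>c \<noteq> 0\<close> c(1) v z' z by (simp add: E_def comb_seq_in_space infnorm_mul dir_scaleR)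
          qed
        qed
        then have "emeasure S {z' \<in> space S. perp_series z' \<in> Y} \<le> emeasure S {z' \<in> space S. comb_seq k z z' \<in> E}"
          by (rule emeasure_mono_AE) measurable
        with pY show "ennreal p \<le> emeasure S {z' \<in> space S. comb_seq k z z' \<in> E}" by (rule order_trans)
      qed
    qed
  qed (auto simp: comb)
  have bad: "ennreal (1 / 2) * emeasure S (H k) \<le> emeasure S (H k \<inter> F)" for k
  proof (rule emeasure_comb_seq_lower[where k = k])
    show "AE z in S. z \<in> H k \<longrightarrow> ennreal (1 / 2) \<le> emeasure S {z' \<in> space S. comb_seq k z z' \<in> F}"
    proof (intro AE_I2 impI)
      fix z assume zH: "z \<in> H k"
      define c where "c = cprod k z"
      have z [measurable]: "z \<in> space S" and c: "x < \<bar>c\<bar>" "B * \<bar>c\<bar> < norm (psum k z)"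
        using zH by (auto simp: H_def passage_def c_def)
      have "AE z' in S. z' \<in> {z' \<in> space S. norm (perp_series z') \<le> B / 2} \<longrightarrow>
          z' \<in> {z' \<in> space S. comb_seq k z z' \<in> F}"
        using AE_summable
      proof eventually_elim
        case (elim z')
        show ?case
        proof safe
          assume z': "z' \<in> space S" "norm (perp_series z') \<le> B / 2"
          have "\<bar>c\<bar> * norm (perp_series z') \<le> \<bar>c\<bar> * (B / 2)" using z' by (intro mult_left_mono) auto
          moreover have "B / 2 * x < B / 2 * \<bar>c\<bar>" using c \<open>0 < B\<close> by simp
          \<comment> \<open>The partial sum exceeds \<open>B * \<bar>c\<bar>\<close> and the rest of
            the series takes away at most half of that, so more than
            \<open>B / 2 * \<bar>c\<bar>\<close> remains.\<close>
          moreover have "norm (psum k z) - norm (c *\<^sub>R perp_series z') \<le> norm (perp_series (comb_seq k z z'))"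
            unfolding perp_comb_seq[OF elim] c_def[symmetric] by (rule norm_diff_ineq)
          ultimately have "B / 2 * x < norm (perp_series (comb_seq k z z'))"
            using c by (simp add: mult_ac)
          then show "comb_seq k z z' \<in> F"
            using z z' \<open>0 < B\<close> by (simp add: F_def comb_seq_in_space field_simps)
        qed
      qed
      then have "emeasure S {z' \<in> space S. norm (perp_series z') \<le> B / 2} \<le> emeasure S {z' \<in> space S. comb_seq k z z' \<in> F}"
        by (rule emeasure_mono_AE) measurable
      with half show "ennreal (1 / 2) \<le> emeasure S {z' \<in> space S. comb_seq k z z' \<in> F}"
        by (rule order_trans)
    qed
  qed (auto simp: comb)
  have "{z \<in> space S. x < cmax n z} = (\<Union>k\<le>n. passage x k)" using \<open>0 < x\<close> by (rule cmax_eq_passage)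
  then have "emeasure S {z \<in> space S. x < cmax n z} \<le> (\<Sum>k\<le>n. emeasure S (passage x k))"
    by (simp add: emeasure_subadditive_finite image_subset_iff)
  also have "\<dots> \<le> (\<Sum>k\<le>n. emeasure S (G k) + emeasure S (H k))"
  proof (rule sum_mono)
    fix k
    have "passage x k = G k \<union> H k" by (auto simp: G_def H_def passage_def)
    then show "emeasure S (passage x k) \<le> emeasure S (G k) + emeasure S (H k)"
      by (simp add: emeasure_subadditive)
  qed
  also have "\<dots> = (\<Sum>k\<le>n. emeasure S (G k)) + (\<Sum>k\<le>n. emeasure S (H k))" by (rule sum.distrib)
  also have "\<dots> \<le> ennreal (1 / p) * emeasure S E + 2 * emeasure S F"
  proof (rule add_mono)
    have "ennreal (1 / p) * (ennreal p * (\<Sum>k\<le>n. emeasure S (G k))) \<le> ennreal (1 / p) * emeasure S E"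
      by (intro mult_left_mono passage_slices_le[where x = x] good) (auto simp: G_def)
    then show "(\<Sum>k\<le>n. emeasure S (G k)) \<le> ennreal (1 / p) * emeasure S E"
      using \<open>0 < p\<close> by (simp add: mult.assoc[symmetric] flip: ennreal_mult)
    have "2 * (ennreal (1 / 2) * (\<Sum>k\<le>n. emeasure S (H k))) \<le> 2 * emeasure S F"
      by (intro mult_left_mono passage_slices_le[where x = x] bad) (auto simp: H_def)
    moreover have "2 * ennreal (1 / 2) = 1"
      using ennreal_mult[of 2 "1 / 2"] by simp
    ultimately show "(\<Sum>k\<le>n. emeasure S (H k)) \<le> 2 * emeasure S F"
      by (simp add: mult.assoc[symmetric])
  qed
  finally show ?thesis by (simp add: E_def F_def)
qed

text \<open>Both requirements hold for all large B, the second by tightness of a single law. Because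
  \<open>2 \<le> B\<close>, the bound at exponent \<open>\<alpha> / 2\<close> also covers all larger
  exponents.\<close>

lemma exists_large_ball:
  assumes "0 < \<delta>"
  obtains B where "2 \<le> B" "(2 / B) powr (\<alpha> / 2) \<le> \<delta>"
    "ennreal (1 / 2) \<le> emeasure S {z \<in> space S. norm (perp_series z) \<le> B / 2}"
proof -
  have "((\<lambda>B. (2 / B) powr (\<alpha> / 2)) \<longlongrightarrow> 0) at_top"
    using \<alpha>_pos by real_asymp
  then have "\<forall>\<^sub>F B in at_top. (2 / B) powr (\<alpha> / 2) < \<delta>"
    using assms by (rule order_tendstoD)
  moreover have "\<forall>\<^sub>F B in at_top. 1 / 2 < measure S {z \<in> space S. norm (perp_series z) \<le> B / 2}"
  proof -
    interpret D: real_distribution "distr S borel (\<lambda>z. norm (perp_series z))"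
      by (rule P.real_distribution_distr) measurable
    have "\<forall>\<^sub>F y in at_top. 1 / 2 < cdf (distr S borel (\<lambda>z. norm (perp_series z))) y"
      using D.cdf_lim_at_top_prob by (rule order_tendstoD) simp
    then have "\<forall>\<^sub>F y in at_top. 1 / 2 < cdf (distr S borel (\<lambda>z. norm (perp_series z))) (y / 2)"
      by (rule eventually_compose_filterlim) real_asymp
    then show ?thesis
      by (rule eventually_mono) (simp add: cdf_def measure_distr vimage_def Int_def conj_commute)
  qed
  ultimately have "\<forall>\<^sub>F B in at_top. 2 \<le> B \<and> (2 / B) powr (\<alpha> / 2) < \<delta> \<and>
      1 / 2 < measure S {z \<in> space S. norm (perp_series z) \<le> B / 2}"
    using eventually_ge_at_top[of 2] by eventually_elim simp
  from eventually_happens[OF this] obtain B where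
    "2 \<le> B" "(2 / B) powr (\<alpha> / 2) < \<delta>" "1 / 2 < measure S {z \<in> space S. norm (perp_series z) \<le> B / 2}"
    by auto
  moreover from this have "ennreal (1 / 2) \<le> emeasure S {z \<in> space S. norm (perp_series z) \<le> B / 2}"
    unfolding P.emeasure_eq_measure by (intro ennreal_leI) simp
  ultimately show ?thesis by (intro that[of B]) simp_all
qed

lemma AE_cprod_nonneg:
  assumes "AE s in N. 0 \<le> fst s"
  shows "AE z in S. \<forall>k. 0 \<le> cprod k z"
proof -
  have "AE z in S. \<forall>i. 0 \<le> fst (z i)"
    unfolding AE_all_countable
    using assms by (intro allI AE_PiM_component prob_space) auto
  then show ?thesis by eventually_elim (simp add: cprod_def prod_nonneg)
qed

lemma open_meets_supp_pos:
  assumes "open U" "y \<in> U" "y \<in> supp S perp_series"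
  shows "0 < measure S {z \<in> space S. perp_series z \<in> U}"
proof -
  have "0 < measure (distr S borel perp_series) U" using assms by (auto simp: supp_def)
  also have "measure (distr S borel perp_series) U = measure S {z \<in> space S. perp_series z \<in> U}"
    using assms(1) by (simp add: measure_distr vimage_def Int_def conj_commute)
  finally show ?thesis .
qed

text \<open>Only the sign of \<open>cprod k z\<close> matters, so two balls suffice, one for each
  sign, and p is uniform in k and z. If the multipliers are nonnegative, only the sign 1
  occurs.\<close>

lemma exists_far_sets:
  assumes u: "infnorm u = 1" "asymptotic_direction (supp S perp_series) u"
    and neg: "asymptotic_direction (supp S perp_series) (- u) \<or> (AE s in N. 0 \<le> fst s)"
    and "0 < \<rho>" "0 \<le> B"
  obtains p where "0 < p" "AE z in S. \<forall>k. cprod k z \<noteq> 0 \<longrightarrow>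
      (\<exists>Y\<in>sets borel. ennreal p \<le> emeasure S {z' \<in> space S. perp_series z' \<in> Y} \<and>
        (\<forall>w\<in>Y. \<forall>e. norm e \<le> B \<longrightarrow>
          1 \<le> infnorm (sgn (cprod k z) *\<^sub>R w + e) \<and> dir (sgn (cprod k z) *\<^sub>R w + e) \<in> ball u \<rho>))"
proof -
  define far where "far \<sigma> p \<longleftrightarrow> (\<exists>Y\<in>sets borel. ennreal p \<le> emeasure S {z' \<in> space S. perp_series z' \<in> Y} \<and>
      (\<forall>w\<in>Y. \<forall>e. norm e \<le> B \<longrightarrow> 1 \<le> infnorm (\<sigma> *\<^sub>R w + e) \<and> dir (\<sigma> *\<^sub>R w + e) \<in> ball u \<rho>))"
    for \<sigma> p
  have mono: "far \<sigma> p" if "far \<sigma> q" "p \<le> q" for \<sigma> p q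
    using that unfolding far_def by (meson ennreal_leI order_trans)
  have ex: "\<exists>p>0. far \<sigma> p" if \<sigma>: "\<bar>\<sigma>\<bar> = 1" "asymptotic_direction (supp S perp_series) (\<sigma> *\<^sub>R u)" for \<sigma>
  proof -
    obtain y where y: "y \<in> supp S perp_series" "\<And>w e. w \<in> ball y 1 \<Longrightarrow> norm e \<le> B \<Longrightarrow>
        1 \<le> infnorm (\<sigma> *\<^sub>R w + e) \<and> dir (\<sigma> *\<^sub>R w + e) \<in> ball u \<rho>"
      using asymptotic_direction_far_point[OF u(1) \<sigma> assms(4,5)] by metis
    define p where "p = measure S {z \<in> space S. perp_series z \<in> ball y 1}"
    have "0 < p" unfolding p_def using y(1) by (intro open_meets_supp_pos[of _ y]) auto
    moreover have "far \<sigma> p"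
      unfolding far_def using y(2) by (intro bexI[of _ "ball y 1"]) (auto simp: p_def P.emeasure_eq_measure)
    ultimately show ?thesis by blast
  qed
  obtain p1 where p1: "0 < p1" "far 1 p1" using ex[of 1] u(2) by auto
  show ?thesis
    using neg
  proof
    assume "asymptotic_direction (supp S perp_series) (- u)"
    then obtain p2 where p2: "0 < p2" "far (- 1) p2" using ex[of "- 1"] by auto
    show ?thesis
    proof (rule that[of "min p1 p2"])
      have "far (sgn c) (min p1 p2)" if "c \<noteq> 0" for c :: real
        using that mono[OF p1(2), of "min p1 p2"] mono[OF p2(2), of "min p1 p2"]
        by (cases "0 < c") auto
      then show "AE z in S. \<forall>k. cprod k z \<noteq> 0 \<longrightarrow>
        (\<exists>Y\<in>sets borel. ennreal (min p1 p2) \<le> emeasure S {z' \<in> space S. perp_series z' \<in> Y} \<and>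
          (\<forall>w\<in>Y. \<forall>e. norm e \<le> B \<longrightarrow>
            1 \<le> infnorm (sgn (cprod k z) *\<^sub>R w + e) \<and> dir (sgn (cprod k z) *\<^sub>R w + e) \<in> ball u \<rho>))"
        unfolding far_def by simp
    qed (use p1 p2 in simp)
  next
    assume "AE s in N. 0 \<le> fst s"
    then have "AE z in S. \<forall>k. 0 \<le> cprod k z" by (rule AE_cprod_nonneg)
    then have "AE z in S. \<forall>k. cprod k z \<noteq> 0 \<longrightarrow> far (sgn (cprod k z)) p1"
    proof eventually_elim
      case (elim z)
      then have "sgn (cprod k z) = 1" if "cprod k z \<noteq> 0" for k
        using that by (metis order_le_less sgn_pos)
      then show ?case using p1(2) by simp
    qed
    then show ?thesis using that[of p1] p1(1) unfolding far_def by simp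
  qed
qed

text \<open>If the directional tail were eventually at most \<epsilon> times the whole tail, the
  moment of \<open>cmax\<close>, which grows with n to at least \<open>c / (1 - h \<beta>)\<close>,
  would be at most a bounded term plus 3/4 of \<open>c / (1 - h \<beta>)\<close>. Moments only
  exclude that the inequality holds at all large levels; this is enough because the weak limit
  exists.\<close>

theorem perp_tail_direction:
  assumes u: "infnorm u = 1" "asymptotic_direction (supp S perp_series) u"
    and neg: "asymptotic_direction (supp S perp_series) (- u) \<or> (AE s in N. 0 \<le> fst s)"
    and "0 < \<rho>"
  shows "\<exists>\<epsilon>>0. \<not> (\<forall>\<^sub>F x in at_top.
    measure S {z \<in> space S. x < infnorm (perp_series z) \<and> dir (perp_series z) \<in> ball u \<rho>} \<le>
    \<epsilon> * measure S {z \<in> space S. x < infnorm (perp_series z)})"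
proof -
  define \<gamma> where "\<gamma> = \<alpha> / 2"
  have \<gamma>: "0 < \<gamma>" "\<gamma> < \<alpha>" using \<alpha>_pos by (auto simp: \<gamma>_def)
  define c where "c = 1 - h \<gamma>"
  have c: "0 < c" using h_less_1[OF \<gamma>] by (simp add: c_def)
  obtain C where C: "0 \<le> C" "\<And>\<beta>. \<gamma> \<le> \<beta> \<Longrightarrow> \<beta> < \<alpha> \<Longrightarrow>
      (\<integral>\<^sup>+z. ennreal (norm (perp_series z) powr \<beta>) \<partial>S) \<le> ennreal (C / (1 - h \<beta>))"
    using perp_moment_uniform unfolding \<gamma>_def by metis
  obtain B where B: "2 \<le> B" "(2 / B) powr \<gamma> \<le> c / (4 * (C + 1))"
    "ennreal (1 / 2) \<le> emeasure S {z \<in> space S. norm (perp_series z) \<le> B / 2}"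
    using exists_large_ball[of "c / (4 * (C + 1))"] c C(1) unfolding \<gamma>_def by auto
  obtain p where p: "0 < p" "AE z in S. \<forall>k. cprod k z \<noteq> 0 \<longrightarrow>
      (\<exists>Y\<in>sets borel. ennreal p \<le> emeasure S {z' \<in> space S. perp_series z' \<in> Y} \<and>
        (\<forall>w\<in>Y. \<forall>e. norm e \<le> B \<longrightarrow>
          1 \<le> infnorm (sgn (cprod k z) *\<^sub>R w + e) \<and> dir (sgn (cprod k z) *\<^sub>R w + e) \<in> ball u \<rho>))"
    using exists_far_sets[OF u neg \<open>0 < \<rho>\<close>, of B] B(1) by auto
  \<comment> \<open>With this \<epsilon> and the choice of B the two kinds of passage receive the
    coefficients \<open>c / (4 * (C + 1))\<close> and \<open>c / (2 * (C + 1))\<close>. The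
    \<open>C + 1\<close> in place of C avoids a zero denominator.\<close>
  define \<epsilon> where "\<epsilon> = p * c / (4 * (C + 1))"
  have "0 < \<epsilon>" using p(1) c C(1) by (simp add: \<epsilon>_def)
  have False if small: "\<forall>\<^sub>F x in at_top.
      measure S {z \<in> space S. x < infnorm (perp_series z) \<and> dir (perp_series z) \<in> ball u \<rho>} \<le>
      \<epsilon> * measure S {z \<in> space S. x < infnorm (perp_series z)}"
  proof -
    obtain x0 where x0: "0 < x0" "\<And>x. x0 \<le> x \<Longrightarrow>
        measure S {z \<in> space S. x < infnorm (perp_series z) \<and> dir (perp_series z) \<in> ball u \<rho>} \<le>
        \<epsilon> * measure S {z \<in> space S. x < infnorm (perp_series z)}"
    proof -
      obtain x1 where "\<And>x. x1 \<le> x \<Longrightarrow>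
        measure S {z \<in> space S. x < infnorm (perp_series z) \<and> dir (perp_series z) \<in> ball u \<rho>} \<le>
        \<epsilon> * measure S {z \<in> space S. x < infnorm (perp_series z)}"
        using small unfolding eventually_at_top_linorder by blast
      then show ?thesis using that[of "max 1 x1"] by auto
    qed
    have [measurable]: "ball u \<rho> \<in> sets borel" by simp
    \<comment> \<open>Setting the norm to 0 off the directions near u makes the directional tail an
      ordinary tail, as the moment comparison requires.\<close>
    define f where "f z = (if dir (perp_series z) \<in> ball u \<rho> then infnorm (perp_series z) else 0)" for z :: "nat \<Rightarrow> real \<times> 'v"
    have [measurable]: "f \<in> borel_measurable S" unfolding f_def by measurable
    have f_nonneg: "0 \<le> f z" for z by (simp add: f_def infnorm_pos_le)
    have f_iff: "x < f z \<longleftrightarrow> x < infnorm (perp_series z) \<and> dir (perp_series z) \<in> ball u \<rho>" if "0 < x" for x z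
      using that by (auto simp: f_def)
    have sf: "sigma_finite_measure S" by (rule P.sigma_finite_measure_axioms)
    have cpos: "0 \<le> cmax n z" for n and z :: "nat \<Rightarrow> real \<times> 'v" using cmax_ge_1[of n z] by linarith
    {
      fix \<beta> n assume \<beta>: "\<gamma> \<le> \<beta>" "\<beta> < \<alpha>"
      have h: "0 \<le> h \<beta>" "h \<beta> < 1" using \<beta> \<gamma> h_less_1[of \<beta>] h_nonneg by auto
      have "0 < \<beta>" using \<beta> \<gamma> by simp
      define T where "T = C / (1 - h \<beta>)"
      have T: "0 \<le> T" "(\<integral>\<^sup>+z. ennreal (norm (perp_series z) powr \<beta>) \<partial>S) \<le> ennreal T"
        using C h \<beta> by (auto simp: T_def)
      \<comment> \<open>Below \<open>x0\<close> the assumption says nothing; there the tail of f is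
        bounded by 1, the tail of the constant \<open>x0\<close>. Its moment stays bounded as
        \<open>\<beta> \<rightarrow> \<alpha>\<close>, and the factor \<open>1 - h \<beta>\<close>
        removes it.\<close>
      have f_moment: "(\<integral>\<^sup>+z. ennreal (f z powr \<beta>) \<partial>S) \<le> ennreal (x0 powr \<beta> + \<epsilon> * T)"
      proof -
        have "(\<integral>\<^sup>+z. ennreal (f z powr \<beta>) \<partial>S) \<le>
          1 * (\<integral>\<^sup>+z. ennreal (x0 powr \<beta>) \<partial>S) + ennreal \<epsilon> * (\<integral>\<^sup>+z. ennreal (norm (perp_series z) powr \<beta>) \<partial>S)"
        proof (rule nn_integral_powr_tail_mono[OF sf])
          fix x :: real assume "0 < x"
          show "emeasure S {z \<in> space S. x < f z} \<le>
            1 * emeasure S {z \<in> space S. x < x0} + ennreal \<epsilon> * emeasure S {z \<in> space S. x < norm (perp_series z)}"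
          proof (cases "x < x0")
            case True
            then show ?thesis using P.emeasure_le_1 P.emeasure_space_1 by (auto intro: add_increasing2)
          next
            case False
            have "emeasure S {z \<in> space S. x < f z} \<le> ennreal \<epsilon> * emeasure S {z \<in> space S. x < infnorm (perp_series z)}"
              using x0(2)[of x] False \<open>0 < \<epsilon>\<close> \<open>0 < x\<close>
              by (simp add: f_iff P.emeasure_eq_measure flip: ennreal_mult)
            also have "\<dots> \<le> ennreal \<epsilon> * emeasure S {z \<in> space S. x < norm (perp_series z)}"
              using infnorm_le_norm
              by (intro mult_left_mono emeasure_mono) (auto intro: less_le_trans)
            finally show ?thesis by (simp add: add_increasing)
          qed
        qed (use f_nonneg \<open>0 < \<beta>\<close> x0(1) in auto)
        also have "\<dots> \<le> ennreal (x0 powr \<beta>) + ennreal \<epsilon> * ennreal T"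
          using T(2) by (intro add_mono mult_left_mono) (simp_all add: P.emeasure_space_1)
        also have "\<dots> = ennreal (x0 powr \<beta> + \<epsilon> * T)"
          using T(1) \<open>0 < \<epsilon>\<close> by (simp flip: ennreal_mult ennreal_plus)
        finally show ?thesis .
      qed
      have "ennreal (c * (1 - h \<beta> ^ Suc n) / (1 - h \<beta>)) \<le> (\<integral>\<^sup>+z. ennreal (cmax n z powr \<beta>) \<partial>S)"
        unfolding c_def using \<gamma> \<beta> by (intro cmax_moment_lower)
      also have "\<dots> \<le> ennreal (1 / p) * (\<integral>\<^sup>+z. ennreal (f z powr \<beta>) \<partial>S) +
          2 * (\<integral>\<^sup>+z. ennreal ((2 / B * norm (perp_series z)) powr \<beta>) \<partial>S)"
      proof (rule nn_integral_powr_tail_mono[OF sf])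
        fix x :: real assume "0 < x"
        then show "emeasure S {z \<in> space S. x < cmax n z} \<le>
          ennreal (1 / p) * emeasure S {z \<in> space S. x < f z} +
          2 * emeasure S {z \<in> space S. x < 2 / B * norm (perp_series z)}"
          using cmax_tail_le[OF _ _ p(1) _ B(3) p(2), of x n] B(1) by (simp add: f_iff)
      qed (use f_nonneg \<open>0 < \<beta>\<close> B(1) cpos in auto)
      also have "\<dots> = ennreal (1 / p) * (\<integral>\<^sup>+z. ennreal (f z powr \<beta>) \<partial>S) +
          2 * (ennreal ((2 / B) powr \<beta>) * (\<integral>\<^sup>+z. ennreal (norm (perp_series z) powr \<beta>) \<partial>S))"
      proof -
        have "(2 / B * norm (perp_series z)) powr \<beta> = (2 / B) powr \<beta> * norm (perp_series z) powr \<beta>" for z :: "nat \<Rightarrow> real \<times> 'v"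
          by (rule powr_mult)
        then show ?thesis by (simp add: nn_integral_cmult ennreal_mult del: times_divide_eq_left)
      qed
      also have "\<dots> \<le> ennreal (1 / p) * ennreal (x0 powr \<beta> + \<epsilon> * T) +
          ennreal 2 * (ennreal (c / (4 * (C + 1))) * ennreal T)"
      proof (intro add_mono mult_mono f_moment T(2) ennreal_leI)
        have "(2 / B) powr \<beta> \<le> (2 / B) powr \<gamma>" using B(1) \<beta> by (intro powr_mono') auto
        then show "(2 / B) powr \<beta> \<le> c / (4 * (C + 1))" using B(2) by simp
      qed auto
      also have "\<dots> = ennreal ((x0 powr \<beta> + \<epsilon> * T) / p + c * T / (2 * (C + 1)))"
      proof -
        have sum_eq: "ennreal (1 / p) * ennreal q + ennreal 2 * (ennreal d * ennreal T) = ennreal (1 / p * q + 2 * (d * T))"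
          if "0 \<le> q" "0 \<le> d" for q d
          using that p(1) T(1) by (simp add: ennreal_mult del: times_divide_eq_left)
        have "1 / p * q + 2 * (c / (4 * D) * T) = q / p + c * T / (2 * D)" for q D by simp
        from this[of _ "C + 1"] show ?thesis
          using p(1) T(1) C(1) c \<open>0 < \<epsilon>\<close> by (subst sum_eq) (simp_all del: distrib_left_numeral)
      qed
      finally have "c * (1 - h \<beta> ^ Suc n) / (1 - h \<beta>) \<le> (x0 powr \<beta> + \<epsilon> * T) / p + c * T / (2 * (C + 1))"
        using p(1) T(1) C(1) c \<open>0 < \<epsilon>\<close> by (subst (asm) ennreal_le_iff) auto
      then have "c * (1 - h \<beta> ^ Suc n) \<le> (1 - h \<beta>) * ((x0 powr \<beta> + \<epsilon> * T) / p + c * T / (2 * (C + 1)))"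
        using h by (simp add: pos_divide_le_eq mult.commute)
      also have "\<dots> = (1 - h \<beta>) * x0 powr \<beta> / p + (\<epsilon> / p + c / (2 * (C + 1))) * ((1 - h \<beta>) * T)"
        by (simp add: algebra_simps add_divide_distrib diff_divide_distrib)
      also have "(1 - h \<beta>) * T = C" using h by (simp add: T_def)
      finally have "c * (1 - h \<beta> ^ Suc n) \<le> (1 - h \<beta>) * x0 powr \<beta> / p + (\<epsilon> / p + c / (2 * (C + 1))) * C" .
    }
    note bound = this
    \<comment> \<open>First n tends to infinity with \<beta> fixed, so that
      \<open>h \<beta> ^ Suc n\<close> disappears; only afterwards does \<beta> approach \<alpha>,
      where \<open>h \<beta>\<close> tends to 1.\<close>
    have limit: "c \<le> (1 - h \<beta>) * x0 powr \<beta> / p + (\<epsilon> / p + c / (2 * (C + 1))) * C" if \<beta>: "\<gamma> \<le> \<beta>" "\<beta> < \<alpha>" for \<beta>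
    proof (rule LIMSEQ_le_const2)
      have "(\<lambda>n. h \<beta> ^ Suc n) \<longlonglongrightarrow> 0"
        using \<beta> \<gamma> h_less_1[of \<beta>] h_nonneg[of \<beta>] LIMSEQ_Suc[OF LIMSEQ_power_zero[of "h \<beta>"]] by simp
      then have "(\<lambda>n. c * (1 - h \<beta> ^ Suc n)) \<longlonglongrightarrow> c * (1 - 0)" by (intro tendsto_intros)
      then show "(\<lambda>n. c * (1 - h \<beta> ^ Suc n)) \<longlonglongrightarrow> c" by simp
    qed (use bound[OF \<beta>] in blast)
    define b where "b n = \<alpha> - \<gamma> / real (Suc n)" for n
    have b: "\<gamma> \<le> b n" "b n < \<alpha>" for n
      using \<gamma> by (auto simp: b_def \<gamma>_def field_simps)
    have "b \<longlonglongrightarrow> \<alpha>" unfolding b_def by real_asymp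
    then have "(\<lambda>n. (1 - h (b n)) * x0 powr b n / p + (\<epsilon> / p + c / (2 * (C + 1))) * C)
        \<longlonglongrightarrow> (1 - 1) * x0 powr \<alpha> / p + (\<epsilon> / p + c / (2 * (C + 1))) * C"
      using b \<gamma> x0(1) p(1) by (intro tendsto_intros h_tendsto_1) (auto intro: less_imp_le order_trans)
    then have "c \<le> (1 - 1) * x0 powr \<alpha> / p + (\<epsilon> / p + c / (2 * (C + 1))) * C"
      using limit[OF b] by (intro LIMSEQ_le_const[of _ _ c]) auto
    also have "\<dots> = 3 / 4 * c * (C / (C + 1))"
    proof -
      have "(c / (4 * D) + c / (2 * D)) * C = 3 / 4 * c * (C / D)" if "0 < D" for D
        using that by (simp add: field_simps)
      from this[of "C + 1"] show ?thesis
        using p(1) C(1) by (simp add: \<epsilon>_def del: distrib_left_numeral)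
    qed
    also have "\<dots> \<le> 3 / 4 * c * 1"
      using c C(1) by (intro mult_left_mono) auto
    finally show False using c by simp
  qed
  then show ?thesis using \<open>0 < \<epsilon>\<close> by blast
qed

end

subsection \<open>Supports and asymptotic directions\<close>

lemma closed_supp: "closed (supp P Y)"
  unfolding closed_def open_subopen[of "- supp P Y"]
proof
  fix y assume "y \<in> - supp P Y"
  then obtain U where "open U" "y \<in> U" "\<not> measure (distr P borel Y) U > 0"
    by (auto simp: supp_def)
  then show "\<exists>T. open T \<and> y \<in> T \<and> T \<subseteq> - supp P Y"
    by (intro exI[of _ U]) (auto simp: supp_def)
qed

text \<open>The complement of the support is covered by the null sets of a countable basis.\<close>

lemma AE_in_supp:
  fixes Y :: "'a \<Rightarrow> 'b::second_countable_topology"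
  assumes "finite_measure P" and [measurable]: "Y \<in> borel_measurable P"
  shows "AE \<omega> in P. Y \<omega> \<in> supp P Y"
proof -
  interpret finite_measure P by fact
  obtain B :: "'b set set" where B: "countable B" "topological_basis B"
    using ex_countable_basis by auto
  define B0 where "B0 = {U \<in> B. measure (distr P borel Y) U = 0}"
  have "AE \<omega> in P. Y \<omega> \<notin> U" if "U \<in> B0" for U
  proof -
    have [measurable]: "U \<in> sets borel"
      using that topological_basis_open[OF B(2)] by (auto simp: B0_def)
    have "measure P {\<omega> \<in> space P. Y \<omega> \<in> U} = 0"
      using that by (simp add: B0_def measure_distr vimage_def Int_def conj_commute)
    then have "{\<omega> \<in> space P. Y \<omega> \<in> U} \<in> null_sets P"
      by (intro null_setsI) (auto simp: emeasure_eq_measure)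
    then show ?thesis by (auto dest!: AE_not_in intro: AE_mp)
  qed
  then have "AE \<omega> in P. \<forall>U\<in>B0. Y \<omega> \<notin> U"
    using countable_subset[OF _ B(1), of B0] by (subst AE_ball_countable) (auto simp: B0_def)
  then show ?thesis
  proof eventually_elim
    case (elim \<omega>)
    show ?case
    proof (rule ccontr)
      assume "Y \<omega> \<notin> supp P Y"
      then obtain U where U: "open U" "Y \<omega> \<in> U" "\<not> measure (distr P borel Y) U > 0"
        by (auto simp: supp_def)
      obtain V where V: "V \<in> B" "Y \<omega> \<in> V" "V \<subseteq> U"
        using topological_basisE[OF B(2) U(1,2)] by metis
      interpret D: finite_measure "distr P borel Y" by (rule finite_measure_distr) measurable
      have "measure (distr P borel Y) V \<le> measure (distr P borel Y) U"
        using V U(1) by (intro D.finite_measure_mono) auto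
      then have "V \<in> B0" using U(3) V(1) by (simp add: B0_def antisym not_less)
      then show False using elim V(2) by auto
    qed
  qed
qed

lemma asymptotic_directionI:
  assumes "\<And>r. 0 < r \<Longrightarrow> r *\<^sub>R u + q \<in> K"
  shows "asymptotic_direction K u"
  unfolding asymptotic_direction_def
proof (intro allI impI)
  fix \<rho> r0 :: real assume "0 < \<rho>"
  define r where "r = max 0 (max r0 (norm q / \<rho>)) + 1"
  have r: "0 < r" "r0 < r" "norm q / \<rho> < r" by (auto simp: r_def)
  have "norm ((r *\<^sub>R u + q) - r *\<^sub>R u) < \<rho> * r" using r(3) \<open>0 < \<rho>\<close> by (simp add: field_simps)
  then show "\<exists>r>r0. \<exists>y\<in>K. norm (y - r *\<^sub>R u) < \<rho> * r" using r assms by blast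
qed

text \<open>The multiplier 0 shows that E is contained in K. The induction then carries entire lines
  \<open>t u + q\<close>, with q in E; having all t available provides the point
  \<open>y / c\<close> that a further term of the span calls for.\<close>

lemma asymptotic_direction_span:
  assumes K: "\<And>a x q. x \<in> K \<Longrightarrow> q \<in> E \<Longrightarrow> a *\<^sub>R x + q \<in> K"
    and "K \<noteq> {}" "E \<noteq> {}" and u: "u \<in> span E"
  shows "asymptotic_direction K u"
proof -
  have E: "E \<subseteq> K" using K[of _ _ 0] \<open>K \<noteq> {}\<close> by auto
  have "\<forall>t. \<forall>q\<in>E. t *\<^sub>R u + q \<in> K"
    using u
  proof (induction rule: span_induct_alt)
    case base
    then show ?case using E by auto
  next
    case (step c x y)
    show ?case
    proof (intro allI ballI)
      fix t q assume q: "q \<in> E"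
      show "t *\<^sub>R (c *\<^sub>R x + y) + q \<in> K"
      proof (cases "c = 0")
        case True
        then show ?thesis using step q by simp
      next
        case False
        have "(t * c) *\<^sub>R ((1 / c) *\<^sub>R y + x) + q \<in> K" using step q K by blast
        then show ?thesis using False by (simp add: algebra_simps)
      qed
    qed
  qed
  moreover obtain q where "q \<in> E" using \<open>E \<noteq> {}\<close> by auto
  ultimately show ?thesis by (intro asymptotic_directionI[where q = q]) auto
qed

text \<open>Iterating \<open>x \<mapsto> b x + q\<close>, starting from \<open>a x + q\<close> with \<open>a = t / b ^ n\<close>,
  leads to \<open>t x\<close> plus a quantity tending to \<open>q / (1 - b)\<close>.\<close>
lemma closed_affine_invariant_limit:
  fixes K E :: "'v::real_normed_vector set"
  assumes K: "\<And>a x q. b \<le> a \<Longrightarrow> x \<in> K \<Longrightarrow> q \<in> E \<Longrightarrow> a *\<^sub>R x + q \<in> K"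
    and "closed K" and b: "0 < b" "b < 1" and "0 < t" and xq: "x \<in> K" "q \<in> E"
  shows "t *\<^sub>R x + (1 / (1 - b)) *\<^sub>R q \<in> K"
proof -
  have iter: "(b ^ n * a) *\<^sub>R x + (\<Sum>i\<le>n. b ^ i) *\<^sub>R q \<in> K" if "b \<le> a" for n a
  proof (induction n)
    case 0
    then show ?case using K[OF that xq] by simp
  next
    case (Suc n)
    have "b *\<^sub>R ((b ^ n * a) *\<^sub>R x + (\<Sum>i\<le>n. b ^ i) *\<^sub>R q) + q \<in> K"
      using K[OF order_refl Suc.IH xq(2)] .
    also have "b *\<^sub>R ((b ^ n * a) *\<^sub>R x + (\<Sum>i\<le>n. b ^ i) *\<^sub>R q) + q =
        (b ^ Suc n * a) *\<^sub>R x + (\<Sum>i\<le>Suc n. b ^ i) *\<^sub>R q"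
      unfolding sum.atMost_Suc_shift by (simp add: algebra_simps sum_distrib_left)
    finally show ?case .
  qed
  have "(\<lambda>n. b ^ n) \<longlonglongrightarrow> 0" using b by (intro LIMSEQ_power_zero) auto
  then have "\<forall>\<^sub>F n in sequentially. b ^ n < t / b" using b \<open>0 < t\<close> by (intro order_tendstoD) auto
  then have "\<forall>\<^sub>F n in sequentially. t *\<^sub>R x + (\<Sum>i\<le>n. b ^ i) *\<^sub>R q \<in> K"
  proof eventually_elim
    case (elim n)
    then have "b \<le> t / b ^ n" using b by (simp add: field_simps)
    from iter[OF this, of n] show ?case using b by simp
  qed
  moreover have "(\<lambda>n. t *\<^sub>R x + (\<Sum>i\<le>n. b ^ i) *\<^sub>R q) \<longlonglongrightarrow> t *\<^sub>R x + (1 / (1 - b)) *\<^sub>R q"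
  proof -
    have "(\<lambda>n. \<Sum>i\<le>n. b ^ i) \<longlonglongrightarrow> 1 / (1 - b)"
      using geometric_sums[of b] b by (simp add: sums_def_le)
    then show ?thesis by (intro tendsto_intros)
  qed
  ultimately show ?thesis
    using Lim_in_closed_set[OF \<open>closed K\<close>] by (metis sequentially_bot)
qed

text \<open>\<open>closed_affine_invariant_limit\<close> removes the restriction
  \<open>b \<le> a\<close> on the multiplier: K contains \<open>t x + d q\<close> for every
  \<open>t > 0\<close>. Letting t tend to 0 gives \<open>d q\<close>; adding one generator at a time
  then gives a multiple of every positive combination, and one more application a whole ray.\<close>

lemma asymptotic_direction_positive_combinations:
  fixes K E :: "(real ^ 'd) set"
  assumes K: "\<And>a x q. b \<le> a \<Longrightarrow> x \<in> K \<Longrightarrow> q \<in> E \<Longrightarrow> a *\<^sub>R x + q \<in> K"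
    and "closed K" "K \<noteq> {}" and b: "0 < b" "b < 1" and u: "u \<in> positive_combinations E"
  shows "asymptotic_direction K u"
proof -
  note lim = closed_affine_invariant_limit[where b = b and K = K and E = E, OF K \<open>closed K\<close> b]
  define d where "d = 1 / (1 - b)"
  have d: "0 < d" using b by (simp add: d_def)
  have fixed: "d *\<^sub>R q \<in> K" if q: "q \<in> E" for q
  proof -
    obtain x where x: "x \<in> K" using \<open>K \<noteq> {}\<close> by auto
    have "(\<lambda>n. inverse (real (Suc n)) *\<^sub>R x + d *\<^sub>R q) \<longlonglongrightarrow> 0 *\<^sub>R x + d *\<^sub>R q"
      by (intro tendsto_intros LIMSEQ_inverse_real_of_nat)
    moreover have "inverse (real (Suc n)) *\<^sub>R x + d *\<^sub>R q \<in> K" for n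
      unfolding d_def using x q by (intro lim) auto
    ultimately show ?thesis
      using closed_sequentially[OF \<open>closed K\<close>, of "\<lambda>n. inverse (real (Suc n)) *\<^sub>R x + d *\<^sub>R q"] by simp
  qed
  \<comment> \<open>Each application of \<open>lim\<close> adds exactly \<open>d q\<close>, so the
    combination is scaled to have last coefficient d. The ratio of consecutive coefficients restores
    this scaling.\<close>
  have comb: "(d / a (Suc n)) *\<^sub>R (\<Sum>i=1..Suc n. a i *\<^sub>R q i) \<in> K"
    if "\<And>i. i \<in> {1..Suc n} \<Longrightarrow> 0 < a i \<and> q i \<in> E" for n a q
    using that
  proof (induction n)
    case 0
    then show ?case using fixed[of "q 1"] by (auto simp: less_le)
  next
    case (Suc n)
    have pos: "0 < a (Suc n)" "0 < a (Suc (Suc n))" "q (Suc (Suc n)) \<in> E" using Suc.prems by auto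
    have "(d / a (Suc n)) *\<^sub>R (\<Sum>i=1..Suc n. a i *\<^sub>R q i) \<in> K"
      using Suc.prems by (intro Suc.IH) auto
    then have "(a (Suc n) / a (Suc (Suc n))) *\<^sub>R ((d / a (Suc n)) *\<^sub>R (\<Sum>i=1..Suc n. a i *\<^sub>R q i)) + d *\<^sub>R q (Suc (Suc n)) \<in> K"
      unfolding d_def using pos by (intro lim) auto
    moreover have "(a (Suc n) / a (Suc (Suc n))) *\<^sub>R ((d / a (Suc n)) *\<^sub>R v) + d *\<^sub>R w =
        (d / a (Suc (Suc n))) *\<^sub>R (v + a (Suc (Suc n)) *\<^sub>R w)" for v w :: "real ^ 'd"
      using pos by (simp add: scaleR_add_right)
    moreover have "(\<Sum>i=1..Suc (Suc n). a i *\<^sub>R q i) =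
        (\<Sum>i=1..Suc n. a i *\<^sub>R q i) + a (Suc (Suc n)) *\<^sub>R q (Suc (Suc n))"
      by simp
    ultimately show ?case by (simp only:)
  qed
  obtain n :: nat and a q where u: "u = (\<Sum>i=1..n. a i *\<^sub>R q i)" "1 \<le> n"
      "\<And>i. i \<in> {1..n} \<Longrightarrow> 0 < a i \<and> q i \<in> E"
    using u unfolding positive_combinations_def by blast
  obtain m where m: "n = Suc m" using u(2) by (cases n) auto
  define s where "s = d / a n"
  have s: "0 < s" using u(2,3) d by (simp add: s_def)
  have su: "s *\<^sub>R u \<in> K" using comb[of m a q] u(3) unfolding s_def u(1) m by simp
  have q1: "q 1 \<in> E" using u(2) u(3)[of 1] by simp
  show ?thesis
  proof (rule asymptotic_directionI)
    fix r :: real assume "0 < r"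
    have "(r / s) *\<^sub>R (s *\<^sub>R u) + d *\<^sub>R q 1 \<in> K"
      unfolding d_def using su q1 s \<open>0 < r\<close> by (intro lim) auto
    then show "r *\<^sub>R u + d *\<^sub>R q 1 \<in> K" using s by simp
  qed
qed

context perpetuity
begin

text \<open>Prepending an independent step leaves the law of the series unchanged. By continuity a
  product of neighbourhoods of \<open>s0\<close> and x is mapped into W, and it has positive
  probability.\<close>

lemma supp_perp_affine:
  assumes s0: "s0 \<in> supp N (\<lambda>s. s)" and x: "x \<in> supp S perp_series"
  shows "fst s0 *\<^sub>R x + snd s0 \<in> supp S perp_series"
  unfolding supp_def
proof (intro CollectI allI impI)
  fix W :: "'v set" assume W: "open W \<and> fst s0 *\<^sub>R x + snd s0 \<in> W"
  then have W_sets [measurable]: "W \<in> sets borel" by auto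
  let ?f = "\<lambda>p :: (real \<times> 'v) \<times> 'v. fst (fst p) *\<^sub>R snd p + snd (fst p)"
  have "continuous_on UNIV ?f" by (intro continuous_intros)
  then have "open (?f -` W)" using W by (intro open_vimage) simp_all
  moreover have "(s0, x) \<in> ?f -` W" using W by simp
  ultimately obtain A B where AB: "open A" "open B" "(s0, x) \<in> A \<times> B" "A \<times> B \<subseteq> ?f -` W"
    by (rule open_prod_elim)
  have [measurable]: "A \<in> sets borel" "B \<in> sets borel" using AB(1,2) by auto
  have A [measurable]: "A \<in> sets N" by (simp add: sets_N)
  have "distr N borel (\<lambda>s. s) = N" by (rule distr_id2) (simp add: sets_N)
  moreover have "0 < measure (distr N borel (\<lambda>s. s)) A"
    using s0 AB(1,3) unfolding supp_def by blast
  ultimately have "0 < measure N A" by metis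
  moreover have "0 < measure S {z \<in> space S. perp_series z \<in> B}"
    using AB(2,3) x by (intro open_meets_supp_pos[of B x]) simp_all
  ultimately have "0 < emeasure N A * emeasure S {z \<in> space S. perp_series z \<in> B}"
    by (simp add: M.emeasure_eq_measure P.emeasure_eq_measure ennreal_zero_less_mult_iff)
  also have "\<dots> = (\<integral>\<^sup>+s. (\<integral>\<^sup>+z. indicator A s * indicator {z \<in> space S. perp_series z \<in> B} z \<partial>S) \<partial>N)"
    by (simp add: nn_integral_cmult nn_integral_multc)
  also have "\<dots> \<le> (\<integral>\<^sup>+s. (\<integral>\<^sup>+z. indicator {z \<in> space S. perp_series z \<in> W} (case_nat s z) \<partial>S) \<partial>N)"
  proof (rule nn_integral_mono, rule nn_integral_mono_AE)
    fix s assume s: "s \<in> space N"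
    show "AE z in S. indicator A s * indicator {z \<in> space S. perp_series z \<in> B} z \<le>
        (indicator {z \<in> space S. perp_series z \<in> W} (case_nat s z) :: ennreal)"
      using AE_summable
    proof eventually_elim
      case (elim z)
      have "(\<lambda>_. s) \<in> space S" using s by (simp add: space_PiM PiE_iff)
      then have "case_nat s z \<in> space S" if "z \<in> space S"
        using comb_seq_in_space[of "\<lambda>_. s" z 1] that by simp
      moreover have "perp_series (case_nat s z) \<in> W" if "s \<in> A" "perp_series z \<in> B"
        using subsetD[OF AB(4), of "(s, perp_series z)"] that unfolding perp_case_nat[OF elim] by simp
      ultimately show ?case by (auto simp: indicator_def)
    qed
  qed
  also have "\<dots> = (\<integral>\<^sup>+z. indicator {z \<in> space S. perp_series z \<in> W} z \<partial>S)"
    by (rule nn_integral_iter[symmetric]) measurable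
  also have "\<dots> = emeasure S {z \<in> space S. perp_series z \<in> W}" by simp
  finally have "0 < measure S {z \<in> space S. perp_series z \<in> W}"
    by (simp add: P.emeasure_eq_measure)
  then show "0 < measure (distr S borel perp_series) W"
    by (simp add: measure_distr vimage_def Int_def conj_commute)
qed

lemma supp_perp_nonempty: "supp S perp_series \<noteq> {}"
proof
  assume "supp S perp_series = {}"
  with AE_in_supp[OF P.finite_measure_axioms measurable_perp_series] have "AE z in S. False"
    by (simp only: empty_iff)
  then show False by (simp only: P.AE_False)
qed

text \<open>The index \<open>Suc n\<close> leaves out the empty partial sum 0, which need not be a
  positive combination.\<close>

lemma AE_perp_in_closed:
  assumes "closed C" and C: "\<And>n z. (\<And>i. z i \<in> D) \<Longrightarrow> psum (Suc n) z \<in> C"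
    and D: "AE s in N. s \<in> D"
  shows "AE z in S. perp_series z \<in> C"
proof -
  have "AE z in S. \<forall>i. z i \<in> D"
    unfolding AE_all_countable
    using D by (intro allI AE_PiM_component prob_space) auto
  then show ?thesis
    using AE_summable
  proof eventually_elim
    case (elim z)
    have "(\<lambda>n. psum (Suc n) z) \<longlonglongrightarrow> perp_series z"
      unfolding perp_series_def psum_def using summable_LIMSEQ[OF elim(2)] by (rule LIMSEQ_Suc)
    then show ?case
    proof (rule closed_sequentially[OF \<open>closed C\<close>, rotated])
      show "psum (Suc n) z \<in> C" for n using elim(1) by (intro C) blast
    qed
  qed
qed

end

subsection \<open>Testing the spectral component\<close>

text \<open>Weak convergence sees only continuous functions. The tent replaces the indicator of a
  ball: it vanishes off the ball of radius \<delta> and is at least 1/2 on the ball of half that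
  radius.\<close>

lemma spectral_component_test:
  fixes X :: "'a \<Rightarrow> real ^ 'd"
  assumes "spectral_component P X R \<Theta>" "0 < \<delta>"
  shows "((\<lambda>x::real. \<integral>v. max 0 (1 - dist v u / \<delta>) \<partial>distr (uniform_measure P {\<omega> \<in> space P. infnorm (X \<omega>) > x}) borel (\<lambda>\<omega>. dir (X \<omega>)))
    \<longlongrightarrow> (\<integral>v. max 0 (1 - dist v u / \<delta>) \<partial>distr R borel \<Theta>)) at_top"
proof -
  have "continuous_on UNIV (\<lambda>v. max 0 (1 - dist v u / \<delta>))"
    by (intro continuous_intros) (use assms in auto)
  moreover have "bounded (range (\<lambda>v. max 0 (1 - dist v u / \<delta>)))"
    using assms(2) by (intro boundedI[of _ 1]) (auto simp: max_def)
  ultimately show ?thesis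
    using assms(1) unfolding spectral_component_def weak_limit_def dir_def by blast
qed

text \<open>A tent around a point outside the closed set F, narrow enough to miss F, integrates to 0
  before the limit and hence in the limit.\<close>

lemma supp_spectral_component_subset:
  fixes X :: "'a \<Rightarrow> real ^ 'd"
  assumes "prob_space P" "prob_space R" and [measurable]: "X \<in> borel_measurable P" "\<Theta> \<in> borel_measurable R"
    and spec: "spectral_component P X R \<Theta>"
    and "closed F" and F: "AE \<omega> in P. X \<omega> \<noteq> 0 \<longrightarrow> dir (X \<omega>) \<in> F"
  shows "supp R \<Theta> \<subseteq> F"
proof
  interpret R: prob_space R by fact
  interpret D: prob_space "distr R borel \<Theta>" by (rule R.prob_space_distr) measurable
  fix u assume u: "u \<in> supp R \<Theta>"
  show "u \<in> F"
  proof (rule ccontr)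
    assume "u \<notin> F"
    then obtain \<delta> where \<delta>: "0 < \<delta>" "ball u \<delta> \<subseteq> - F"
      using \<open>closed F\<close> by (metis ComplI open_Compl open_contains_ball)
    define \<phi> where "\<phi> v = max 0 (1 - dist v u / \<delta>)" for v :: "real ^ 'd"
    have [measurable]: "\<phi> \<in> borel_measurable borel" unfolding \<phi>_def by measurable
    have \<phi>: "0 \<le> \<phi> v" "\<phi> v \<le> 1" "v \<in> ball u \<delta> \<Longrightarrow> \<phi> v \<noteq> 0" "v \<notin> ball u \<delta> \<Longrightarrow> \<phi> v = 0" for v
      using \<delta>(1) by (auto simp: \<phi>_def max_def dist_commute field_simps)
    \<comment> \<open>Levels \<open>x \<ge> 0\<close> exclude \<open>X \<omega> = 0\<close>, for
      which nothing is assumed about the direction.\<close>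
    have zero: "(\<integral>v. \<phi> v \<partial>distr (uniform_measure P {\<omega> \<in> space P. infnorm (X \<omega>) > x}) borel (\<lambda>\<omega>. dir (X \<omega>))) = 0"
      if "0 \<le> x" for x
    proof -
      have "AE \<omega> in uniform_measure P {\<omega> \<in> space P. infnorm (X \<omega>) > x}. \<phi> (dir (X \<omega>)) = 0"
      proof (rule AE_uniform_measureI)
        show "AE \<omega> in P. \<omega> \<in> {\<omega> \<in> space P. infnorm (X \<omega>) > x} \<longrightarrow> \<phi> (dir (X \<omega>)) = 0"
          using F
        proof eventually_elim
          case (elim \<omega>)
          have "dir (X \<omega>) \<notin> ball u \<delta>" if "x < infnorm (X \<omega>)"
            using elim that \<open>0 \<le> x\<close> \<delta>(2) infnorm_pos_lt[of "X \<omega>"] by auto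
          then show ?case using \<phi>(4) by simp
        qed
      qed measurable
      then show ?thesis
        by (subst integral_distr) (auto intro!: integral_eq_zero_AE simp: measurable_cong_sets[OF sets_uniform_measure refl])
    qed
    have "((\<lambda>x::real. 0::real) \<longlongrightarrow> (\<integral>v. \<phi> v \<partial>distr R borel \<Theta>)) at_top"
      using spectral_component_test[OF spec \<delta>(1), of u, folded \<phi>_def]
      by (rule Lim_transform_eventually) (rule eventually_mono[OF eventually_ge_at_top[of 0]], erule zero)
    then have "(\<integral>v. \<phi> v \<partial>distr R borel \<Theta>) = 0"
      by (intro tendsto_unique[OF trivial_limit_at_top_linorder _ tendsto_const])
    moreover have "integrable (distr R borel \<Theta>) \<phi>"
      using \<phi>(1,2) by (intro D.integrable_const_bound[where B = 1]) auto
    ultimately have "AE v in distr R borel \<Theta>. \<phi> v = 0"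
      using \<phi>(1) by (subst (asm) integral_nonneg_eq_0_iff_AE) auto
    then have "AE v in distr R borel \<Theta>. v \<notin> ball u \<delta>" by eventually_elim (use \<phi>(3) in blast)
    then have "measure (distr R borel \<Theta>) (ball u \<delta>) = 0"
      by (subst D.prob_eq_0) auto
    moreover have "0 < measure (distr R borel \<Theta>) (ball u \<delta>)"
      using u \<delta>(1) unfolding supp_def by (metis (mono_tags) centre_in_ball mem_Collect_eq open_ball)
    ultimately show False by simp
  qed
qed

text \<open>The exact negation of what \<open>perp_tail_direction\<close> produces. The conditional
  probability is multiplied out, so that levels with a null tail are covered too.\<close>

lemma notin_supp_spectral_component:
  fixes X :: "'a \<Rightarrow> real ^ 'd"
  assumes "prob_space P" "prob_space R" and [measurable]: "X \<in> borel_measurable P" "\<Theta> \<in> borel_measurable R"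
    and spec: "spectral_component P X R \<Theta>" and u: "u \<notin> supp R \<Theta>"
  obtains \<rho> where "0 < \<rho>" "\<forall>\<epsilon>>0. \<forall>\<^sub>F x in at_top.
    measure P {\<omega> \<in> space P. x < infnorm (X \<omega>) \<and> dir (X \<omega>) \<in> ball u \<rho>} \<le>
    \<epsilon> * measure P {\<omega> \<in> space P. x < infnorm (X \<omega>)}"
proof -
  interpret P: prob_space P by (rule assms(1))
  interpret R: prob_space R by (rule assms(2))
  interpret D: prob_space "distr R borel \<Theta>" by (rule R.prob_space_distr) measurable
  obtain U where U: "open U" "u \<in> U" "\<not> measure (distr R borel \<Theta>) U > 0"
    using u unfolding supp_def by blast
  obtain \<delta> where \<delta>: "0 < \<delta>" "ball u \<delta> \<subseteq> U" using U(1,2) open_contains_ball by blast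
  define \<phi> where "\<phi> v = max 0 (1 - dist v u / \<delta>)" for v :: "real ^ 'd"
  have [measurable]: "\<phi> \<in> borel_measurable borel" unfolding \<phi>_def by measurable
  have \<phi>: "0 \<le> \<phi> v" "\<phi> v \<le> 1" "v \<in> ball u (\<delta> / 2) \<Longrightarrow> 1 / 2 \<le> \<phi> v" "v \<notin> ball u \<delta> \<Longrightarrow> \<phi> v = 0" for v
    using \<delta>(1) by (auto simp: \<phi>_def max_def dist_commute field_simps)
  have "measure (distr R borel \<Theta>) U = 0"
    using U(3) measure_nonneg[of "distr R borel \<Theta>" U] by linarith
  then have "AE v in distr R borel \<Theta>. v \<notin> U"
    using U(1) by (subst (asm) D.prob_eq_0) auto
  then have "AE v in distr R borel \<Theta>. \<phi> v = 0" by eventually_elim (use \<phi>(4) \<delta>(2) in blast)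
  then have "(\<integral>v. \<phi> v \<partial>distr R borel \<Theta>) = 0" by (rule integral_eq_zero_AE)
  then have lim: "((\<lambda>x::real. \<integral>v. \<phi> v \<partial>distr (uniform_measure P {\<omega> \<in> space P. infnorm (X \<omega>) > x}) borel (\<lambda>\<omega>. dir (X \<omega>)))
      \<longlongrightarrow> 0) at_top"
    using spectral_component_test[OF spec \<delta>(1), of u, folded \<phi>_def] by simp
  show ?thesis
  \<comment> \<open>On the ball of half the radius the tent is at least 1/2, so an integral below
    \<open>\<epsilon> / 2\<close> gives conditional probability below \<epsilon>.\<close>
  proof (rule that[of "\<delta> / 2"], goal_cases)
    case 1
    show ?case using \<delta> by simp
  next
    case 2
    show ?case
    proof (intro allI impI)
      fix \<epsilon> :: real assume "0 < \<epsilon>"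
      then have "\<forall>\<^sub>F x in at_top. (\<integral>v. \<phi> v \<partial>distr (uniform_measure P {\<omega> \<in> space P. infnorm (X \<omega>) > x}) borel (\<lambda>\<omega>. dir (X \<omega>))) < \<epsilon> / 2"
        by (intro order_tendstoD[OF lim]) simp
      then show "\<forall>\<^sub>F x in at_top.
        measure P {\<omega> \<in> space P. x < infnorm (X \<omega>) \<and> dir (X \<omega>) \<in> ball u (\<delta> / 2)} \<le>
        \<epsilon> * measure P {\<omega> \<in> space P. x < infnorm (X \<omega>)}"
      proof eventually_elim
        case (elim x)
        define G where "G = {\<omega> \<in> space P. x < infnorm (X \<omega>)}"
        have [measurable]: "G \<in> sets P" unfolding G_def by measurable
        have eq: "{\<omega> \<in> space P. x < infnorm (X \<omega>) \<and> dir (X \<omega>) \<in> ball u (\<delta> / 2)} =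
            G \<inter> {\<omega> \<in> space P. dir (X \<omega>) \<in> ball u (\<delta> / 2)}"
          by (auto simp: G_def)
        show ?case
        proof (cases "measure P G = 0")
          case True
          have "measure P (G \<inter> {\<omega> \<in> space P. dir (X \<omega>) \<in> ball u (\<delta> / 2)}) \<le> measure P G"
            by (intro P.finite_measure_mono) auto
          then show ?thesis using True unfolding eq by (simp add: G_def)
        next
          case False
          then have G: "emeasure P G \<noteq> 0" "emeasure P G \<noteq> \<infinity>" "0 < measure P G"
            by (auto simp: P.emeasure_eq_measure less_le)
          interpret U: prob_space "uniform_measure P G" using G by (intro prob_space_uniform_measure) auto
          have [measurable]: "X \<in> borel_measurable (uniform_measure P G)"
            by (simp add: measurable_cong_sets[OF sets_uniform_measure refl])
          have [measurable]: "ball u (\<delta> / 2) \<in> sets borel" by simp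
          let ?B = "{\<omega> \<in> space P. dir (X \<omega>) \<in> ball u (\<delta> / 2)}"
          have "measure (uniform_measure P G) ?B / 2 = (\<integral>\<omega>. 1 / 2 * indicator ?B \<omega> \<partial>uniform_measure P G)"
            by simp
          also have "\<dots> \<le> (\<integral>\<omega>. \<phi> (dir (X \<omega>)) \<partial>uniform_measure P G)"
          proof (rule integral_mono)
            show "integrable (uniform_measure P G) (\<lambda>\<omega>. 1 / 2 * indicator ?B \<omega> :: real)"
              by (intro U.integrable_const_bound[where B = 1]) (auto simp: indicator_def)
            show "integrable (uniform_measure P G) (\<lambda>\<omega>. \<phi> (dir (X \<omega>)))"
              using \<phi>(1,2) by (intro U.integrable_const_bound[where B = 1]) auto
          qed (use \<phi>(1,3) in \<open>auto simp: indicator_def\<close>)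
          also have "\<dots> < \<epsilon> / 2"
            using elim unfolding G_def[symmetric] by (subst (asm) integral_distr) auto
          finally have "measure (uniform_measure P G) ?B < \<epsilon>" by simp
          then have "measure P (G \<inter> ?B) / measure P G < \<epsilon>"
            using G by (subst (asm) measure_uniform_measure) auto
          then show ?thesis using G(3) unfolding eq by (simp add: G_def[symmetric] field_simps)
        qed
      qed
    qed
  qed
qed

subsection \<open>Positive combinations on the sphere\<close>

lemma closed_max_sphere: "closed max_sphere"
  unfolding max_sphere_def
  by (intro closed_Collect_eq continuous_on_infnorm continuous_on_id continuous_on_const)

lemma dir_in_max_sphere: "v \<noteq> 0 \<Longrightarrow> dir v \<in> max_sphere"
  by (simp add: max_sphere_def dir_def infnorm_mul infnorm_pos_le infnorm_eq_0)

lemma positive_combinations_scaleR: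
  assumes "u \<in> positive_combinations E" "0 < t"
  shows "t *\<^sub>R u \<in> positive_combinations E"
proof -
  obtain n :: nat and a q where u: "u = (\<Sum>i=1..n. a i *\<^sub>R q i)" "1 \<le> n"
      "\<And>i. i \<in> {1..n} \<Longrightarrow> 0 < a i \<and> q i \<in> E"
    using assms(1) unfolding positive_combinations_def by blast
  have "t *\<^sub>R u = (\<Sum>i=1..n. (t * a i) *\<^sub>R q i)"
    unfolding u(1) by (simp add: scaleR_sum_right)
  moreover have "\<forall>i\<in>{1..n}. 0 < t * a i \<and> q i \<in> E" using u(3) assms(2) by simp
  ultimately show ?thesis
    unfolding positive_combinations_def using u(2)
    by (intro CollectI exI[of _ n] exI[of _ "\<lambda>i. t * a i"] exI[of _ q]) simp
qed

text \<open>The cone need not be closed, so the approximating points are normalised along with v.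
  They are eventually nonzero, and \<open>dir\<close> is continuous at \<open>v\<close>.\<close>

lemma dir_in_closure_cone:
  fixes C :: "(real ^ 'd) set"
  assumes v: "v \<in> closure C" "v \<noteq> 0" and C: "\<And>u t. u \<in> C \<Longrightarrow> 0 < t \<Longrightarrow> t *\<^sub>R u \<in> C"
  shows "dir v \<in> closure (C \<inter> max_sphere)"
proof -
  obtain f where f: "\<And>n. f n \<in> C" "f \<longlonglongrightarrow> v" using v(1) unfolding closure_sequential by blast
  have "(\<lambda>n. dir (f n)) \<longlonglongrightarrow> dir v" using isCont_dir[OF v(2)] f(2) by (rule isCont_tendsto_compose)
  moreover have "\<forall>\<^sub>F n in sequentially. dir (f n) \<in> closure (C \<inter> max_sphere)"
    using tendsto_imp_eventually_ne[OF f(2) v(2)]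
  proof eventually_elim
    case (elim n)
    then have "dir (f n) \<in> C"
      unfolding dir_def by (intro C[OF f(1)]) (simp add: infnorm_pos_lt)
    then have "dir (f n) \<in> C \<inter> max_sphere" using dir_in_max_sphere[OF elim] by (rule IntI)
    then show ?case by (rule subsetD[OF closure_subset])
  qed
  ultimately show ?thesis
    by (rule Lim_in_closed_set[OF closed_closure _ sequentially_bot, rotated])
qed

lemma psum_in_positive_combinations:
  fixes z :: "nat \<Rightarrow> real \<times> (real ^ 'd)"
  assumes "\<And>i. 0 < fst (z i)" "\<And>i. snd (z i) \<in> E"
  shows "psum (Suc n) z \<in> positive_combinations E"
proof -
  have "psum (Suc n) z = (\<Sum>i=1..Suc n. cprod (i - 1) z *\<^sub>R snd (z (i - 1)))"
    unfolding psum_def by (simp add: sum.atLeast1_atMost_eq del: sum.lessThan_Suc sum.cl_ivl_Suc)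
  moreover have "0 < cprod k z" for k using assms(1) by (simp add: cprod_def prod_pos)
  ultimately show ?thesis
    unfolding positive_combinations_def using assms(2)
    by (intro CollectI exI[of _ "Suc n"] exI[of _ "\<lambda>i. cprod (i - 1) z"] exI[of _ "\<lambda>i. snd (z (i - 1))"]) auto
qed

subsection \<open>Pairing independent families\<close>

lemma Int_stable_vimage: "Int_stable {f -` A \<inter> X |A. A \<in> sets N}"
proof (rule Int_stableI, clarify)
  fix A B assume "A \<in> sets N" "B \<in> sets N"
  then show "\<exists>C. (f -` A \<inter> X) \<inter> (f -` B \<inter> X) = f -` C \<inter> X \<and> C \<in> sets N"
    by (intro exI[of _ "A \<inter> B"]) auto
qed

context prob_space
begin

text \<open>Serves to pass from times in \<open>int\<close> to the steps of the series via
  \<open>n \<mapsto> int (Suc n)\<close>. Events indexed by J are carried to its image by the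
  inverse of f.\<close>

lemma indep_vars_reindex_inj:
  assumes "indep_vars M' X (f ` I)" "inj_on f I"
  shows "indep_vars (\<lambda>i. M' (f i)) (\<lambda>i. X (f i)) I"
proof -
  let ?F = "\<lambda>i. {X i -` A \<inter> space M |A. A \<in> sets (M' i)}"
  have X: "indep_sets ?F (f ` I)" "\<forall>i\<in>f ` I. random_variable (M' i) (X i)"
    using assms(1) unfolding indep_vars_def2 by auto
  have "indep_sets (\<lambda>i. ?F (f i)) I"
  proof (rule indep_setsI)
    fix i assume "i \<in> I"
    then have "random_variable (M' (f i)) (X (f i))" using X(2) by simp
    then show "?F (f i) \<subseteq> events" by (auto intro: measurable_sets)
  next
    fix A J assume J: "J \<noteq> {}" "J \<subseteq> I" "finite J" "\<forall>j\<in>J. A j \<in> ?F (f j)"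
    have inj: "inj_on f J" using J(2) assms(2) by (rule inj_on_subset[rotated])
    have "prob (\<Inter>k\<in>f ` J. A (the_inv_into J f k)) = (\<Prod>k\<in>f ` J. prob (A (the_inv_into J f k)))"
    proof (rule indep_setsD[OF X(1)])
      show "\<forall>k\<in>f ` J. A (the_inv_into J f k) \<in> ?F k"
      proof
        fix k assume "k \<in> f ` J"
        then obtain j where j: "j \<in> J" "k = f j" by blast
        then show "A (the_inv_into J f k) \<in> ?F k"
          using J(4)[rule_format, OF j(1)] by (simp only: the_inv_into_f_f[OF inj])
      qed
    qed (use J in auto)
    then show "prob (\<Inter>j\<in>J. A j) = (\<Prod>j\<in>J. prob (A j))"
      using inj by (simp add: prod.reindex the_inv_into_f_f)
  qed
  then show ?thesis using X(2) unfolding indep_vars_def2 by auto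
qed

text \<open>Finite intersections of preimages lie in the generated sigma-algebras. The extra
  \<open>space M\<close> makes the empty intersection the whole space instead of
  \<open>UNIV\<close>.\<close>

lemma indep_families_prob:
  fixes Y :: "'i \<Rightarrow> 'a \<Rightarrow> 'b::topological_space" and Z :: "'j \<Rightarrow> 'a \<Rightarrow> 'c::topological_space"
  assumes "indep_families M Y Z" "finite I" "finite J"
    and A: "\<And>i. i \<in> I \<Longrightarrow> A i \<in> sets borel" and B: "\<And>j. j \<in> J \<Longrightarrow> B j \<in> sets borel"
  shows "prob ((\<Inter>i\<in>I. Y i -` A i \<inter> space M) \<inter> (\<Inter>j\<in>J. Z j -` B j \<inter> space M) \<inter> space M) =
    prob ((\<Inter>i\<in>I. Y i -` A i \<inter> space M) \<inter> space M) * prob ((\<Inter>j\<in>J. Z j -` B j \<inter> space M) \<inter> space M)"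
proof -
  let ?V = "\<lambda>Y. vimage_algebra (space M) (\<lambda>\<omega> t. Y t \<omega>) (\<Pi>\<^sub>M i\<in>UNIV. borel)"
  have V: "(\<Inter>i\<in>I. Y i -` A i \<inter> space M) \<inter> space M \<in> sets (?V Y)"
    if "finite I" "\<And>i. i \<in> I \<Longrightarrow> A i \<in> sets borel"
    for I and Y :: "'k \<Rightarrow> 'a \<Rightarrow> 'd::topological_space" and A :: "'k \<Rightarrow> 'd set"
  proof -
    have "(\<lambda>\<omega> t. Y t \<omega>) \<in> ?V Y \<rightarrow>\<^sub>M (\<Pi>\<^sub>M i\<in>UNIV. borel)"
      by (rule measurable_vimage_algebra1) (auto simp: space_PiM)
    then have "Y i \<in> borel_measurable (?V Y)" for i
      using measurable_compose[OF _ measurable_component_singleton[of i UNIV "\<lambda>_. borel"]] by simp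
    then have "Y i -` A i \<inter> space M \<in> sets (?V Y)" if "i \<in> I" for i
      using measurable_sets[of "Y i" "?V Y" borel "A i"] that \<open>\<And>i. i \<in> I \<Longrightarrow> A i \<in> sets borel\<close> by simp
    moreover have "space M \<in> sets (?V Y)" using sets.top[of "?V Y"] by simp
    ultimately show ?thesis
    proof (cases "I = {}")
      case False
      then have "(\<Inter>i\<in>I. Y i -` A i \<inter> space M) \<in> sets (?V Y)"
        using \<open>finite I\<close> \<open>\<And>i. i \<in> I \<Longrightarrow> Y i -` A i \<inter> space M \<in> sets (?V Y)\<close>
        by (intro sets.finite_INT)
      then show ?thesis using \<open>space M \<in> sets (?V Y)\<close> by (rule sets.Int)
    qed simp
  qed
  have "prob (((\<Inter>i\<in>I. Y i -` A i \<inter> space M) \<inter> space M) \<inter> ((\<Inter>j\<in>J. Z j -` B j \<inter> space M) \<inter> space M)) =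
    prob ((\<Inter>i\<in>I. Y i -` A i \<inter> space M) \<inter> space M) * prob ((\<Inter>j\<in>J. Z j -` B j \<inter> space M) \<inter> space M)"
    by (rule indep_setD[OF assms(1)[unfolded indep_families_def] V[OF assms(2) A] V[OF assms(3) B]])
  then show ?thesis by (simp add: Int_ac)
qed

text \<open>Labelling Y by \<open>(i, True)\<close> and Z by \<open>(i, False)\<close> gives one
  independent family of events: the two families separate first, then each factorises. Grouping the
  labels by i yields independent sigma-algebras, and the i-th one makes the i-th pair
  measurable.\<close>

lemma indep_vars_Pair:
  fixes Y :: "'i \<Rightarrow> 'a \<Rightarrow> 'b::topological_space" and Z :: "'i \<Rightarrow> 'a \<Rightarrow> 'c::topological_space"
  assumes Y: "indep_vars (\<lambda>_. borel) Y UNIV" and Z: "indep_vars (\<lambda>_. borel) Z UNIV"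
    and YZ: "indep_families M Y Z"
  shows "indep_vars (\<lambda>_. borel \<Otimes>\<^sub>M borel) (\<lambda>i \<omega>. (Y i \<omega>, Z i \<omega>)) UNIV"
proof -
  have mY [measurable]: "Y i \<in> borel_measurable M" and mZ [measurable]: "Z i \<in> borel_measurable M" for i
    using Y Z unfolding indep_vars_def by auto
  let ?FY = "\<lambda>i. {Y i -` A \<inter> space M |A. A \<in> sets borel}"
  let ?FZ = "\<lambda>i. {Z i -` A \<inter> space M |A. A \<in> sets borel}"
  have FY: "indep_sets ?FY UNIV" and FZ: "indep_sets ?FZ UNIV"
    using Y Z unfolding indep_vars_def2 by blast+
  define F where "F = (\<lambda>(i, d). if d then ?FY i else ?FZ i)"
  have "indep_sets F (\<Union>i. {(i, True), (i, False)})"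
  proof (rule indep_setsI)
    fix k :: "'i \<times> bool"
    show "F k \<subseteq> events" by (auto simp: F_def split: prod.splits if_splits)
  next
    fix A and J :: "('i \<times> bool) set"
    assume J: "J \<noteq> {}" "finite J" "\<forall>j\<in>J. A j \<in> F j"
    define I where "I = fst ` J"
    have I: "finite I" "I \<noteq> {}" using J by (auto simp: I_def)
    \<comment> \<open>Labels missing from J receive \<open>space M\<close>, the preimage of
      \<open>UNIV\<close>, so that every i in I carries one event of each family.\<close>
    have "\<exists>B\<in>sets borel. (if (i, True) \<in> J then A (i, True) else space M) = Y i -` B \<inter> space M" for i
    proof (cases "(i, True) \<in> J")
      case True
      then show ?thesis using J(3) by (fastforce simp: F_def)
    qed (auto intro: bexI[of _ UNIV])
    then obtain BY where BY: "\<And>i. BY i \<in> sets borel"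
      "\<And>i. (if (i, True) \<in> J then A (i, True) else space M) = Y i -` BY i \<inter> space M" by metis
    have "\<exists>B\<in>sets borel. (if (i, False) \<in> J then A (i, False) else space M) = Z i -` B \<inter> space M" for i
    proof (cases "(i, False) \<in> J")
      case True
      then show ?thesis using J(3) by (fastforce simp: F_def)
    qed (auto intro: bexI[of _ UNIV])
    then obtain BZ where BZ: "\<And>i. BZ i \<in> sets borel"
      "\<And>i. (if (i, False) \<in> J then A (i, False) else space M) = Z i -` BZ i \<inter> space M" by metis
    define a where "a i = Y i -` BY i \<inter> space M" for i
    define b where "b i = Z i -` BZ i \<inter> space M" for i
    have sub: "A j \<subseteq> space M" if "j \<in> J" for j
      using J(3)[rule_format, OF that] by (auto simp: F_def split: prod.splits if_splits)
    have ab: "a i = (if (i, True) \<in> J then A (i, True) else space M)"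
      "b i = (if (i, False) \<in> J then A (i, False) else space M)" for i
      using BY(2) BZ(2) by (auto simp: a_def b_def)
    have "(\<Inter>j\<in>J. A j) = (\<Inter>i\<in>I. a i) \<inter> (\<Inter>i\<in>I. b i) \<inter> space M"
    proof (intro set_eqI iffI)
      fix \<omega> assume \<omega>: "\<omega> \<in> (\<Inter>j\<in>J. A j)"
      then have "\<omega> \<in> space M" using sub J(1) by blast
      then show "\<omega> \<in> (\<Inter>i\<in>I. a i) \<inter> (\<Inter>i\<in>I. b i) \<inter> space M" using \<omega> by (auto simp: ab)
    next
      fix \<omega> assume \<omega>: "\<omega> \<in> (\<Inter>i\<in>I. a i) \<inter> (\<Inter>i\<in>I. b i) \<inter> space M"
      show "\<omega> \<in> (\<Inter>j\<in>J. A j)"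
      proof
        fix j assume j: "j \<in> J"
        obtain i d where id: "j = (i, d)" by (cases j)
        have "i \<in> I" using j id by (force simp: I_def)
        then have "\<omega> \<in> a i" "\<omega> \<in> b i" using \<omega> by auto
        then show "\<omega> \<in> A j" using j unfolding id by (cases d) (auto simp: ab)
      qed
    qed
    then have "prob (\<Inter>j\<in>J. A j) = prob ((\<Inter>i\<in>I. a i) \<inter> space M) * prob ((\<Inter>i\<in>I. b i) \<inter> space M)"
      using indep_families_prob[OF YZ I(1) I(1), of BY BZ] BY(1) BZ(1) unfolding a_def b_def by simp
    also have "(\<Inter>i\<in>I. a i) \<inter> space M = (\<Inter>i\<in>I. a i)" using I(2) by (auto simp: a_def)
    also have "(\<Inter>i\<in>I. b i) \<inter> space M = (\<Inter>i\<in>I. b i)" using I(2) by (auto simp: b_def)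
    also have "prob (\<Inter>i\<in>I. a i) = (\<Prod>i\<in>I. prob (a i))"
    proof (rule indep_setsD[OF FY _ I(2,1)])
      show "\<forall>i\<in>I. a i \<in> ?FY i" using BY(1) unfolding a_def by blast
    qed simp
    also have "prob (\<Inter>i\<in>I. b i) = (\<Prod>i\<in>I. prob (b i))"
    proof (rule indep_setsD[OF FZ _ I(2,1)])
      show "\<forall>i\<in>I. b i \<in> ?FZ i" using BZ(1) unfolding b_def by blast
    qed simp
    also have "(\<Prod>i\<in>I. prob (a i)) * (\<Prod>i\<in>I. prob (b i)) =
        (\<Prod>i\<in>I. \<Prod>d\<in>UNIV. if (i, d) \<in> J then prob (A (i, d)) else 1)"
    proof -
      have "prob (a i) = (if (i, True) \<in> J then prob (A (i, True)) else 1)"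
        "prob (b i) = (if (i, False) \<in> J then prob (A (i, False)) else 1)" for i
        by (simp_all add: ab prob_space)
      then show ?thesis by (simp add: prod.distrib UNIV_bool mult.commute)
    qed
    also have "\<dots> = (\<Prod>j\<in>I \<times> UNIV. if j \<in> J then prob (A j) else 1)"
      unfolding prod.cartesian_product by (rule prod.cong) auto
    also have "\<dots> = (\<Prod>j\<in>J. prob (A j))"
    proof -
      have "(I \<times> UNIV) \<inter> J = J" by (force simp: I_def)
      then show ?thesis using I(1) prod.inter_restrict[of "I \<times> UNIV" "\<lambda>j. prob (A j)" J] by simp
    qed
    finally show "prob (\<Inter>j\<in>J. A j) = (\<Prod>j\<in>J. prob (A j))" .
  qed
  then have "indep_sets (\<lambda>i. sigma_sets (space M) (\<Union>k\<in>{(i, True), (i, False)}. F k)) UNIV"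
  proof (rule indep_sets_collect_sigma)
    fix i k assume "k \<in> {(i :: 'i, True), (i, False)}"
    then show "Int_stable (F k)" by (auto simp: F_def Int_stable_vimage)
  qed (auto simp: disjoint_family_on_def)
  then have "indep_sets (\<lambda>i. {(\<lambda>\<omega>. (Y i \<omega>, Z i \<omega>)) -` A \<inter> space M |A. A \<in> sets (borel \<Otimes>\<^sub>M borel)}) UNIV"
  proof (rule indep_sets_mono_sets)
    fix i
    define G where "G = (\<Union>k\<in>{(i, True), (i, False)}. F k)"
    have G: "G = ?FY i \<union> ?FZ i" by (auto simp: G_def F_def)
    have sub: "G \<subseteq> Pow (space M)" by (auto simp: G)
    have "Y i \<in> borel_measurable (sigma (space M) G)"
    proof (rule measurableI)
      fix A :: "'b set" assume "A \<in> sets borel"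
      then have "Y i -` A \<inter> space M \<in> G" unfolding G by blast
      then show "Y i -` A \<inter> space (sigma (space M) G) \<in> sets (sigma (space M) G)"
        using sub by (simp add: space_measure_of sets_measure_of)
    qed simp
    moreover have "Z i \<in> borel_measurable (sigma (space M) G)"
    proof (rule measurableI)
      fix A :: "'c set" assume "A \<in> sets borel"
      then have "Z i -` A \<inter> space M \<in> G" unfolding G by blast
      then show "Z i -` A \<inter> space (sigma (space M) G) \<in> sets (sigma (space M) G)"
        using sub by (simp add: space_measure_of sets_measure_of)
    qed simp
    ultimately have "(\<lambda>\<omega>. (Y i \<omega>, Z i \<omega>)) \<in> sigma (space M) G \<rightarrow>\<^sub>M borel \<Otimes>\<^sub>M borel"
      by (rule measurable_Pair)
    note meas = measurable_sets[OF this, unfolded space_measure_of[OF sub] sets_measure_of[OF sub]]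
    show "{(\<lambda>\<omega>. (Y i \<omega>, Z i \<omega>)) -` A \<inter> space M |A. A \<in> sets (borel \<Otimes>\<^sub>M borel)} \<subseteq>
        sigma_sets (space M) (\<Union>k\<in>{(i, True), (i, False)}. F k)"
      unfolding G_def[symmetric] using meas by blast
  qed
  moreover have "(\<lambda>\<omega>. (Y i \<omega>, Z i \<omega>)) \<in> M \<rightarrow>\<^sub>M borel \<Otimes>\<^sub>M borel" for i
    using mY mZ by (rule measurable_Pair)
  ultimately show ?thesis unfolding indep_vars_def2 by blast
qed

text \<open>As a product, the law of the pair depends only on the marginals; this is how the pairs
  at different times come to be equally distributed.\<close>

lemma distr_Pair_indep_families:
  fixes Y :: "'i \<Rightarrow> 'a \<Rightarrow> 'b::topological_space" and Z :: "'j \<Rightarrow> 'a \<Rightarrow> 'c::topological_space"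
  assumes YZ: "indep_families M Y Z"
    and [measurable]: "Y i \<in> borel_measurable M" "Z j \<in> borel_measurable M"
  shows "distr M (borel \<Otimes>\<^sub>M borel) (\<lambda>\<omega>. (Y i \<omega>, Z j \<omega>)) = distr M borel (Y i) \<Otimes>\<^sub>M distr M borel (Z j)"
proof (rule pair_measure_eqI[symmetric])
  show "sigma_finite_measure (distr M borel (Y i))" "sigma_finite_measure (distr M borel (Z j))"
    by (intro prob_space_imp_sigma_finite prob_space_distr; measurable)+
  fix A B assume "A \<in> sets (distr M borel (Y i))" "B \<in> sets (distr M borel (Z j))"
  then have [measurable]: "A \<in> sets borel" "B \<in> sets borel" by auto
  have "prob ((Y i -` A \<inter> space M) \<inter> (Z j -` B \<inter> space M)) =
      prob (Y i -` A \<inter> space M) * prob (Z j -` B \<inter> space M)"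
    using indep_families_prob[OF YZ, of "{i}" "{j}" "\<lambda>_. A" "\<lambda>_. B"] by (simp add: Int_ac)
  moreover have "(\<lambda>\<omega>. (Y i \<omega>, Z j \<omega>)) -` (A \<times> B) \<inter> space M = (Y i -` A \<inter> space M) \<inter> (Z j -` B \<inter> space M)"
    by auto
  ultimately show "emeasure (distr M borel (Y i)) A * emeasure (distr M borel (Z j)) B =
      emeasure (distr M (borel \<Otimes>\<^sub>M borel) (\<lambda>\<omega>. (Y i \<omega>, Z j \<omega>))) (A \<times> B)"
    by (simp add: emeasure_distr emeasure_eq_measure ennreal_mult)
qed simp

end

subsection \<open>Support of the spectral component\<close>

text \<open>The series reads the times 1, 2, ..., whereas the assumptions concern time 0; equality
  in law allows \<open>N\<close> to be taken at time 0.\<close>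

lemma iid_pair_sequence_law:
  fixes M :: "int \<Rightarrow> 'a \<Rightarrow> real" and Q :: "int \<Rightarrow> 'a \<Rightarrow> 'v::euclidean_space" and b c :: real
  assumes "prob_space P" "iid P M" "iid P Q" and MQ: "indep_families P M Q"
  defines "N \<equiv> distr P borel (\<lambda>\<omega>. (b + c * M 0 \<omega>, Q 0 \<omega>))"
    and "zs \<equiv> \<lambda>\<omega> n. (b + c * M (int (Suc n)) \<omega>, Q (int (Suc n)) \<omega>)"
  shows "zs \<in> P \<rightarrow>\<^sub>M (\<Pi>\<^sub>M i\<in>UNIV. borel)"
    and "distr P (\<Pi>\<^sub>M i\<in>UNIV. borel) zs = (\<Pi>\<^sub>M i\<in>UNIV. N)"
proof -
  interpret prob_space P by fact
  have M: "indep_vars (\<lambda>_. borel) M UNIV" "\<And>s t. distr P borel (M s) = distr P borel (M t)"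
    and Q: "indep_vars (\<lambda>_. borel) Q UNIV" "\<And>s t. distr P borel (Q s) = distr P borel (Q t)"
    using assms(2,3) unfolding iid_def by blast+
  have mM [measurable]: "M t \<in> borel_measurable P" and mQ [measurable]: "Q t \<in> borel_measurable P" for t
    using M(1) Q(1) unfolding indep_vars_def by auto
  define g where "g = (\<lambda>(m, q :: 'v). (b + c * m, q))"
  have g [measurable]: "g \<in> borel \<Otimes>\<^sub>M borel \<rightarrow>\<^sub>M borel"
    unfolding g_def borel_prod[symmetric] by measurable
  have "indep_vars (\<lambda>_. borel) (\<lambda>t \<omega>. g (M t \<omega>, Q t \<omega>)) UNIV"
    using indep_vars_Pair[OF M(1) Q(1) MQ] by (rule indep_vars_compose2) (rule g)
  then have "indep_vars (\<lambda>_. borel) (\<lambda>t \<omega>. g (M t \<omega>, Q t \<omega>)) (range (\<lambda>n. int (Suc n)))"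
    by (rule indep_vars_subset) simp
  then have "indep_vars (\<lambda>_. borel) (\<lambda>n \<omega>. g (M (int (Suc n)) \<omega>, Q (int (Suc n)) \<omega>)) UNIV"
    by (rule indep_vars_reindex_inj) (simp add: inj_def)
  then have indep: "indep_vars (\<lambda>_. borel) (\<lambda>n \<omega>. zs \<omega> n) UNIV"
    by (simp add: zs_def g_def)
  then have rv [measurable]: "(\<lambda>\<omega>. zs \<omega> n) \<in> borel_measurable P" for n
    unfolding indep_vars_def by auto
  then show "zs \<in> P \<rightarrow>\<^sub>M (\<Pi>\<^sub>M i\<in>UNIV. borel)"
    by (intro measurable_PiM_single') (auto simp: space_PiM)
  have law: "distr P borel (\<lambda>\<omega>. g (M t \<omega>, Q t \<omega>)) = distr (distr P borel (M t) \<Otimes>\<^sub>M distr P borel (Q t)) borel g" for t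
  proof -
    have "(\<lambda>\<omega>. (M t \<omega>, Q t \<omega>)) \<in> P \<rightarrow>\<^sub>M borel \<Otimes>\<^sub>M borel" by measurable
    then show ?thesis
      using distr_distr[OF g, of "\<lambda>\<omega>. (M t \<omega>, Q t \<omega>)" P]
      unfolding distr_Pair_indep_families[OF MQ mM mQ] by (simp add: comp_def)
  qed
  have "distr P borel (\<lambda>\<omega>. zs \<omega> n) = N" for n
  proof -
    have "distr P borel (\<lambda>\<omega>. zs \<omega> n) = distr P borel (\<lambda>\<omega>. g (M (int (Suc n)) \<omega>, Q (int (Suc n)) \<omega>))"
      by (simp add: zs_def g_def)
    also have "\<dots> = distr P borel (\<lambda>\<omega>. g (M 0 \<omega>, Q 0 \<omega>))"
      unfolding law using M(2)[of _ 0] Q(2)[of _ 0] by metis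
    also have "\<dots> = N" by (simp add: N_def g_def)
    finally show ?thesis .
  qed
  moreover have "distr P (\<Pi>\<^sub>M i\<in>UNIV. borel) (\<lambda>\<omega>. \<lambda>i\<in>UNIV. zs \<omega> i) = (\<Pi>\<^sub>M i\<in>UNIV. distr P borel (\<lambda>\<omega>. zs \<omega> i))"
    using indep by (subst (asm) indep_vars_iff_distr_eq_PiM) (auto intro: rv)
  ultimately show "distr P (\<Pi>\<^sub>M i\<in>UNIV. borel) zs = (\<Pi>\<^sub>M i\<in>UNIV. N)" by (simp add: restrict_UNIV)
qed

lemma supp_pair_law:
  fixes M :: "int \<Rightarrow> 'a \<Rightarrow> real" and Q :: "int \<Rightarrow> 'a \<Rightarrow> 'v::euclidean_space" and b c :: real
  assumes "prob_space P" and MQ: "indep_families P M Q"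
    and mM [measurable]: "M 0 \<in> borel_measurable P" and mQ [measurable]: "Q 0 \<in> borel_measurable P"
    and m: "m \<in> supp P (M 0)" and q: "q \<in> supp P (Q 0)"
  shows "(b + c * m, q) \<in> supp (distr P borel (\<lambda>\<omega>. (b + c * M 0 \<omega>, Q 0 \<omega>))) (\<lambda>s. s)"
  unfolding supp_def
proof (intro CollectI allI impI)
  interpret prob_space P by fact
  let ?N = "distr P borel (\<lambda>\<omega>. (b + c * M 0 \<omega>, Q 0 \<omega>))"
  fix W :: "(real \<times> 'v) set" assume W: "open W \<and> (b + c * m, q) \<in> W"
  let ?g = "\<lambda>p :: real \<times> 'v. (b + c * fst p, snd p)"
  have "continuous_on UNIV ?g" by (intro continuous_intros)
  then have "open (?g -` W)" using W by (intro open_vimage) simp_all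
  moreover have "(m, q) \<in> ?g -` W" using W by simp
  ultimately obtain A B where AB: "open A" "open B" "(m, q) \<in> A \<times> B" "A \<times> B \<subseteq> ?g -` W"
    by (rule open_prod_elim)
  have [measurable]: "A \<in> sets borel" "B \<in> sets borel" "W \<in> sets borel" using AB(1,2) W by auto
  have meas [measurable]: "(\<lambda>\<omega>. (b + c * M 0 \<omega>, Q 0 \<omega>)) \<in> borel_measurable P"
    unfolding borel_prod[symmetric] by measurable
  have "0 < measure (distr P borel (M 0)) A" "0 < measure (distr P borel (Q 0)) B"
    using m q AB(1-3) unfolding supp_def by auto
  then have "0 < prob (M 0 -` A \<inter> space P)" "0 < prob (Q 0 -` B \<inter> space P)"
    by (simp_all add: measure_distr)
  then have "0 < prob (M 0 -` A \<inter> space P) * prob (Q 0 -` B \<inter> space P)" by simp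
  also have "\<dots> = prob ((M 0 -` A \<inter> space P) \<inter> (Q 0 -` B \<inter> space P))"
    using indep_families_prob[OF MQ, of "{0}" "{0}" "\<lambda>_. A" "\<lambda>_. B"] by (simp add: Int_ac)
  also have "\<dots> \<le> prob ((\<lambda>\<omega>. (b + c * M 0 \<omega>, Q 0 \<omega>)) -` W \<inter> space P)"
  proof (rule finite_measure_mono)
    show "(M 0 -` A \<inter> space P) \<inter> (Q 0 -` B \<inter> space P) \<subseteq> (\<lambda>\<omega>. (b + c * M 0 \<omega>, Q 0 \<omega>)) -` W \<inter> space P"
      using AB(4) by (auto simp: subset_eq)
  qed measurable
  also have "\<dots> = measure ?N W" by (simp add: measure_distr)
  also have "?N = distr ?N borel (\<lambda>s. s)" by (rule distr_id2[symmetric]) simp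
  finally show "0 < measure (distr ?N borel (\<lambda>s. s)) W" .
qed

lemma stationary_series_eq_perp:
  "stationary_series b c M Q \<omega> = perp_series (\<lambda>n. (b + c * M (int (Suc n)) \<omega>, Q (int (Suc n)) \<omega>))"
  by (simp add: stationary_series_def perp_series_def cprod_def prod.atLeast1_atMost_eq)

theorem lemma5p2:
  fixes P :: "'a measure" and R :: "'b measure"
    and M :: "int \<Rightarrow> 'a \<Rightarrow> real"
    and Q X :: "int \<Rightarrow> 'a \<Rightarrow> real ^ 'd"
    and \<Theta> :: "'b \<Rightarrow> real ^ 'd"
    and b c \<alpha> \<epsilon> :: real
  assumes "prob_space P" and "prob_space R"
    and "b \<ge> 0" and "c > 0"
    and "iid P M" and "iid P Q" and "indep_families P M Q"
    and A1: "ext_expectation P (\<lambda>\<omega>. log_abs (b + c * M 0 \<omega>)) < 0"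
    and A2: "\<alpha> > 0" "integral\<^sup>L P (\<lambda>\<omega>. \<bar>b + c * M 0 \<omega>\<bar> powr \<alpha>) = 1"
    and A3: "\<epsilon> > 0" "integrable P (\<lambda>\<omega>. \<bar>M 0 \<omega>\<bar> powr (\<alpha> + \<epsilon>))"
      "integrable P (\<lambda>\<omega>. infnorm (Q 0 \<omega>) powr (\<alpha> + \<epsilon>))"
    and A4: "nonarithmetic P (\<lambda>\<omega>. log_abs (b + c * M 0 \<omega>))"
    and A5: "\<And>i x. measure P {\<omega> \<in> space P. (b + c * M 0 \<omega>) * x + Q 0 \<omega> $ i = x} < 1"
      "\<And>i. measure P {\<omega> \<in> space P. Q 0 \<omega> $ i > 0} > 0"
    and X_rv: "\<And>t. X t \<in> borel_measurable P"
    and recurrence: "\<And>t. AE \<omega> in P. X t \<omega> = (b + c * M t \<omega>) *\<^sub>R X (t - 1) \<omega> + Q t \<omega>"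
    and stationary: "distr P borel (X 0) = distr P borel (stationary_series b c M Q)"
    and \<Theta>_rv: "\<Theta> \<in> borel_measurable R"
    and spectral: "spectral_component P (X 0) R \<Theta>"
  shows "supp R \<Theta> \<subseteq> span (supp P (Q 0)) \<inter> max_sphere
    \<and> (b = 0 \<and> closure (supp P (M 0)) = UNIV \<longrightarrow>
         supp R \<Theta> = span (supp P (Q 0)) \<inter> max_sphere)
    \<and> (b > 0 \<and> closure (supp P (M 0)) = {0..} \<longrightarrow>
         supp R \<Theta> = closure (positive_combinations (supp P (Q 0)) \<inter> max_sphere))
    \<and> (closure (supp P (Q 0)) = UNIV \<longrightarrow> supp R \<Theta> = max_sphere)"
proof -
  interpret P: prob_space P by (rule assms(1))
  note X_rv [measurable] \<Theta>_rv [measurable]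
  have mM [measurable]: "M t \<in> borel_measurable P" and mQ [measurable]: "Q t \<in> borel_measurable P" for t
    using assms(5,6) unfolding iid_def P.indep_vars_def by auto
  define N where "N = distr P borel (\<lambda>\<omega>. (b + c * M 0 \<omega>, Q 0 \<omega>))"
  have pair [measurable]: "(\<lambda>\<omega>. (b + c * M 0 \<omega>, Q 0 \<omega>)) \<in> borel_measurable P"
    unfolding borel_prod[symmetric] by measurable
  have borel_fst [measurable]: "(fst :: real \<times> (real ^ 'd) \<Rightarrow> real) \<in> borel_measurable borel"
    and borel_snd [measurable]: "(snd :: real \<times> (real ^ 'd) \<Rightarrow> real ^ 'd) \<in> borel_measurable borel"
    by (intro borel_measurable_continuous_onI continuous_intros)+
  have AE_N: "(AE s in N. p s) \<longleftrightarrow> (AE \<omega> in P. p (b + c * M 0 \<omega>, Q 0 \<omega>))"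
    if "{s. p s} \<in> sets borel" for p
    unfolding N_def by (rule AE_distr_iff[OF pair]) (use that in simp)
  interpret N: prob_space N unfolding N_def by (rule P.prob_space_distr) (rule pair)
  interpret T: perpetuity N \<alpha>
  proof (intro perpetuity.intro perpetuity_axioms.intro sequence_space.intro product_prob_spaceI)
    show "prob_space N" by unfold_locales
    show "sets N = sets borel" by (simp add: N_def)
    show "0 < \<alpha>" by (rule A2)
    show "(\<integral>s. \<bar>fst s\<bar> powr \<alpha> \<partial>N) = 1"
      unfolding N_def by (subst integral_distr[OF pair]) (use A2(2) in simp_all)
    \<comment> \<open>If the modulus were almost surely 1, its logarithm would be 0 and lie in the
      lattice of mesh 1, against non-arithmeticity.\<close>
    show "\<not> (AE s in N. \<bar>fst s\<bar> = 1)"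
    proof
      assume "AE s in N. \<bar>fst s\<bar> = 1"
      then have "AE \<omega> in P. \<bar>b + c * M 0 \<omega>\<bar> = 1" by (subst (asm) AE_N) auto
      then have "AE \<omega> in P. log_abs (b + c * M 0 \<omega>) = - \<infinity> \<or>
          (\<exists>k::int. log_abs (b + c * M 0 \<omega>) = ereal (1 * of_int k))"
        by eventually_elim (auto simp: log_abs_def intro!: exI[of _ 0])
      moreover have "Measurable.pred P (\<lambda>\<omega>. log_abs (b + c * M 0 \<omega>) = - \<infinity> \<or>
          (\<exists>k::int. log_abs (b + c * M 0 \<omega>) = ereal (1 * of_int k)))"
        unfolding log_abs_def by measurable
      ultimately have "measure P {\<omega> \<in> space P. log_abs (b + c * M 0 \<omega>) = - \<infinity> \<or>
          (\<exists>k::int. log_abs (b + c * M 0 \<omega>) = ereal (1 * of_int k))} = 1"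
        by (simp only: P.prob_Collect_eq_1[OF predE])
      moreover have "measure P {\<omega> \<in> space P. log_abs (b + c * M 0 \<omega>) = - \<infinity> \<or>
          (\<exists>k::int. log_abs (b + c * M 0 \<omega>) = ereal (1 * of_int k))} < 1"
        using A4[unfolded nonarithmetic_def, rule_format, OF zero_less_one] .
      ultimately show False by linarith
    qed
    show "integrable N (\<lambda>s. norm (snd s) powr \<alpha>)"
      unfolding N_def
    proof (subst integrable_distr_eq[OF pair])
      \<comment> \<open>The moment is assumed for the max-norm; \<open>?d\<close> is the factor by
        which the Euclidean norm can exceed it.\<close>
      let ?d = "sqrt (real DIM(real ^ 'd))"
      have "integrable P (\<lambda>\<omega>. norm (Q 0 \<omega>) powr \<alpha>)"
      proof (rule Bochner_Integration.integrable_bound)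
        show "integrable P (\<lambda>\<omega>. ?d powr \<alpha> * (1 + infnorm (Q 0 \<omega>) powr (\<alpha> + \<epsilon>)))"
          using A3(3) by simp
        show "AE \<omega> in P. norm (norm (Q 0 \<omega>) powr \<alpha>) \<le>
            norm (?d powr \<alpha> * (1 + infnorm (Q 0 \<omega>) powr (\<alpha> + \<epsilon>)))"
        proof (rule AE_I2)
          fix \<omega>
          have "norm (Q 0 \<omega>) powr \<alpha> \<le> (?d * infnorm (Q 0 \<omega>)) powr \<alpha>"
            using A2(1) by (intro powr_mono2 norm_le_infnorm) auto
          also have "\<dots> = ?d powr \<alpha> * infnorm (Q 0 \<omega>) powr \<alpha>" by (rule powr_mult)
          also have "\<dots> \<le> ?d powr \<alpha> * (1 + infnorm (Q 0 \<omega>) powr (\<alpha> + \<epsilon>))"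
            using A2(1) A3(1) by (intro mult_left_mono powr_le_one_add_powr) (auto simp: infnorm_pos_le)
          finally show "norm (norm (Q 0 \<omega>) powr \<alpha>) \<le>
            norm (?d powr \<alpha> * (1 + infnorm (Q 0 \<omega>) powr (\<alpha> + \<epsilon>)))" by simp
        qed
      qed measurable
      then show "integrable P (\<lambda>\<omega>. norm (snd (b + c * M 0 \<omega>, Q 0 \<omega>)) powr \<alpha>)" by simp
    qed measurable
  qed
  let ?S = "\<Pi>\<^sub>M i\<in>(UNIV :: nat set). N"
  define E where "E = supp P (Q 0)"
  define K where "K = supp ?S perp_series"
  \<comment> \<open>All claims concern the law of \<open>X 0\<close>, so it may be realised on the
    sequence space, where independent continuations can be spliced in.\<close>
  have law: "distr P borel (X 0) = distr ?S borel perp_series"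
  proof -
    define zs where "zs = (\<lambda>\<omega> n. (b + c * M (int (Suc n)) \<omega>, Q (int (Suc n)) \<omega>))"
    have zs: "zs \<in> P \<rightarrow>\<^sub>M (\<Pi>\<^sub>M i\<in>UNIV. borel)" "distr P (\<Pi>\<^sub>M i\<in>UNIV. borel) zs = ?S"
      using iid_pair_sequence_law[OF assms(1,5,6,7), of b c] unfolding zs_def N_def by auto
    have "sets (\<Pi>\<^sub>M i\<in>(UNIV :: nat set). (borel :: (real \<times> (real ^ 'd)) measure)) = sets ?S"
      by (intro sets_PiM_cong) (simp_all add: N_def)
    then have "perp_series \<in> borel_measurable (\<Pi>\<^sub>M i\<in>(UNIV :: nat set). (borel :: (real \<times> (real ^ 'd)) measure))"
      using T.measurable_perp_series measurable_cong_sets by blast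
    moreover have "stationary_series b c M Q = perp_series \<circ> zs"
      by (rule ext) (simp only: zs_def stationary_series_eq_perp comp_apply)
    ultimately show ?thesis
      unfolding stationary zs(2)[symmetric] using zs(1) by (simp only: distr_distr)
  qed
  have prob_X: "measure P {\<omega> \<in> space P. X 0 \<omega> \<in> B} = measure ?S {z \<in> space ?S. perp_series z \<in> B}"
    if B: "B \<in> sets borel" for B
  proof -
    have "measure (distr P borel (X 0)) B = measure (distr ?S borel perp_series) B" by (simp only: law)
    then show ?thesis using B by (simp add: measure_distr vimage_def Int_def conj_commute)
  qed
  have AE_X: "AE \<omega> in P. X 0 \<omega> \<in> C" if "closed C" "AE z in ?S. perp_series z \<in> C" for C
  proof -
    have "{x. x \<in> C} \<in> sets borel" using that(1) by simp
    then have "AE x in distr ?S borel perp_series. x \<in> C"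
      using that(2) by (subst AE_distr_iff) auto
    then show ?thesis
      unfolding law[symmetric] using that(1) by (subst (asm) AE_distr_iff) auto
  qed
  \<comment> \<open>C is a closed set carrying the stationary law, F a closed set containing its
    directions. The sets used for C are the span and the closed cone.\<close>
  have supp_subset: "supp R \<Theta> \<subseteq> F"
    if "closed F" "closed C" "AE z in ?S. perp_series z \<in> C" "\<And>v. v \<in> C \<Longrightarrow> v \<noteq> 0 \<Longrightarrow> dir v \<in> F" for F C
  proof (rule supp_spectral_component_subset[OF assms(1,2) X_rv \<Theta>_rv spectral that(1)])
    show "AE \<omega> in P. X 0 \<omega> \<noteq> 0 \<longrightarrow> dir (X 0 \<omega>) \<in> F"
      using AE_X[OF that(2,3)] by eventually_elim (use that(4) in blast)
  qed
  \<comment> \<open>Outside the support the directional tail is at most any multiple \<epsilon> of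
    the tail at large levels, whereas \<open>perp_tail_direction\<close> supplies an \<epsilon> for
    which this fails.\<close>
  have in_supp: "u \<in> supp R \<Theta>"
    if u: "u \<in> max_sphere" "asymptotic_direction K u"
      "asymptotic_direction K (- u) \<or> (AE s in N. 0 \<le> fst s)" for u
  proof (rule ccontr)
    assume notin: "u \<notin> supp R \<Theta>"
    obtain \<rho> where \<rho>: "0 < \<rho>" "\<forall>\<epsilon>>0. \<forall>\<^sub>F x in at_top.
        measure P {\<omega> \<in> space P. x < infnorm (X 0 \<omega>) \<and> dir (X 0 \<omega>) \<in> ball u \<rho>} \<le>
        \<epsilon> * measure P {\<omega> \<in> space P. x < infnorm (X 0 \<omega>)}"
      by (rule notin_supp_spectral_component[OF assms(1,2) X_rv \<Theta>_rv spectral notin])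
    have [measurable]: "ball u \<rho> \<in> sets borel" by simp
    have "{v. x < infnorm v \<and> dir v \<in> ball u \<rho>} \<in> sets borel" "{v :: real ^ 'd. x < infnorm v} \<in> sets borel" for x
      by measurable
    from prob_X[OF this(1)] prob_X[OF this(2)]
    have "measure P {\<omega> \<in> space P. x < infnorm (X 0 \<omega>) \<and> dir (X 0 \<omega>) \<in> ball u \<rho>} =
        measure ?S {z \<in> space ?S. x < infnorm (perp_series z) \<and> dir (perp_series z) \<in> ball u \<rho>}"
      "measure P {\<omega> \<in> space P. x < infnorm (X 0 \<omega>)} = measure ?S {z \<in> space ?S. x < infnorm (perp_series z)}" for x
      by simp_all
    moreover have "infnorm u = 1" using u(1) by (simp add: max_sphere_def)
    moreover from this obtain \<epsilon> where "0 < \<epsilon>" "\<not> (\<forall>\<^sub>F x in at_top.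
        measure ?S {z \<in> space ?S. x < infnorm (perp_series z) \<and> dir (perp_series z) \<in> ball u \<rho>} \<le>
        \<epsilon> * measure ?S {z \<in> space ?S. x < infnorm (perp_series z)})"
      using T.perp_tail_direction[OF _ u(2,3)[unfolded K_def] \<rho>(1)] by blast
    ultimately show False using \<rho>(2) by (simp only: not_True_eq_False)
  qed
  have AE_E: "AE s in N. snd s \<in> E"
  proof -
    have "{s :: real \<times> (real ^ 'd). snd s \<in> E} = snd -` E \<inter> space borel" by auto
    also have "\<dots> \<in> sets borel"
      by (rule measurable_sets[OF borel_snd]) (simp add: E_def closed_supp)
    finally show ?thesis
      using AE_in_supp[OF P.finite_measure_axioms mQ, of 0] by (subst AE_N) (auto simp: E_def)
  qed
  have K_closed: "closed K" and K_nonempty: "K \<noteq> {}"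
    unfolding K_def by (rule closed_supp, rule T.supp_perp_nonempty)
  have E_nonempty: "E \<noteq> {}"
  proof
    assume "E = {}"
    with AE_E have "AE s in N. False" by (simp only: empty_iff)
    then show False by (simp only: N.AE_False)
  qed
  have K_affine: "(b + c * m) *\<^sub>R x + q \<in> K" if "m \<in> supp P (M 0)" "x \<in> K" "q \<in> E" for m x q
    using T.supp_perp_affine[OF _ that(2)[unfolded K_def]]
      supp_pair_law[OF assms(1,7) mM mQ that(1) that(3)[unfolded E_def], of b c]
    unfolding K_def N_def by fastforce
  have upper: "supp R \<Theta> \<subseteq> span E \<inter> max_sphere"
  proof (rule supp_subset)
    show "closed (span E \<inter> max_sphere)" by (intro closed_Int closed_span closed_max_sphere)
    show "closed (span E)" by (rule closed_span)
    show "AE z in ?S. perp_series z \<in> span E"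
    proof (rule T.AE_perp_in_closed[where D = "{s. snd s \<in> E}"])
      show "psum (Suc n) z \<in> span E" if "\<And>i. z i \<in> {s. snd s \<in> E}" for n z
        unfolding psum_def using that by (intro span_sum span_scale span_base) simp
    qed (use AE_E in \<open>simp_all add: closed_span\<close>)
    show "dir v \<in> span E \<inter> max_sphere" if "v \<in> span E" "v \<noteq> 0" for v
      using that dir_in_max_sphere[of v] by (simp add: dir_def span_scale)
  qed
  have case_a: "supp R \<Theta> = span E \<inter> max_sphere" if "b = 0" "closure (supp P (M 0)) = UNIV"
  proof (rule antisym[OF upper], rule subsetI)
    fix u assume u: "u \<in> span E \<inter> max_sphere"
    have "supp P (M 0) = UNIV" using that(2) by (simp add: closure_closed closed_supp)
    \<comment> \<open>For \<open>b = 0\<close> every real number a is a multiplier in the support,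
      namely for \<open>m = a / c\<close>.\<close>
    then have aff: "a *\<^sub>R x + q \<in> K" if "x \<in> K" "q \<in> E" for a x q
      using K_affine[of "a / c" x q] that \<open>b = 0\<close> \<open>c > 0\<close> by simp
    have "asymptotic_direction K v" if "v \<in> span E" for v
      using aff K_nonempty E_nonempty that by (rule asymptotic_direction_span)
    \<comment> \<open>The span is symmetric, so \<open>- u\<close> is asymptotic as well; this takes
      care of negative products.\<close>
    then show "u \<in> supp R \<Theta>" using u by (intro in_supp) (auto simp: span_neg)
  qed
  have case_b: "supp R \<Theta> = closure (positive_combinations E \<inter> max_sphere)"
    if "b > 0" "closure (supp P (M 0)) = {0..}"
  proof (rule antisym)
    have supp_M: "supp P (M 0) = {0..}" using that(2) by (simp add: closure_closed closed_supp)
    have AE_fst: "AE s in N. b \<le> fst s"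
    proof -
      have "AE \<omega> in P. 0 \<le> M 0 \<omega>"
        using AE_in_supp[OF P.finite_measure_axioms mM, of 0] unfolding supp_M by simp
      then have "AE \<omega> in P. b \<le> b + c * M 0 \<omega>"
        by eventually_elim (use \<open>c > 0\<close> in simp)
      moreover have "{s :: real \<times> (real ^ 'd). b \<le> fst s} \<in> sets borel" by measurable
      ultimately show ?thesis by (subst AE_N) simp_all
    qed
    show "supp R \<Theta> \<subseteq> closure (positive_combinations E \<inter> max_sphere)"
    proof (rule supp_subset)
      show "closed (closure (positive_combinations E \<inter> max_sphere))" "closed (closure (positive_combinations E))"
        by (rule closed_closure)+
      show "AE z in ?S. perp_series z \<in> closure (positive_combinations E)"
      proof (rule T.AE_perp_in_closed[where D = "{s. b \<le> fst s \<and> snd s \<in> E}"])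
        show "psum (Suc n) z \<in> closure (positive_combinations E)"
          if "\<And>i. z i \<in> {s. b \<le> fst s \<and> snd s \<in> E}" for n z
        proof (rule subsetD[OF closure_subset psum_in_positive_combinations])
          show "0 < fst (z i)" "snd (z i) \<in> E" for i
            using that[of i] \<open>b > 0\<close> by auto
        qed
        show "AE s in N. s \<in> {s. b \<le> fst s \<and> snd s \<in> E}" using AE_fst AE_E by eventually_elim simp
      qed (rule closed_closure)
      show "dir v \<in> closure (positive_combinations E \<inter> max_sphere)"
        if "v \<in> closure (positive_combinations E)" "v \<noteq> 0" for v
        using that by (rule dir_in_closure_cone) (rule positive_combinations_scaleR)
    qed
    \<comment> \<open>Otherwise the multiplier would almost surely be at least 1 and so would its
      moment of order \<open>\<alpha> / 2\<close>, contradicting \<open>h_less_1\<close>.\<close>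
    have "b < 1"
    proof (rule ccontr)
      assume "\<not> b < 1"
      have "1 = (\<integral>s. (1 :: real) \<partial>N)" by (simp add: N.prob_space)
      also have "\<dots> \<le> T.h (\<alpha> / 2)"
        unfolding T.h_def
      proof (rule integral_mono_AE)
        show "integrable N (\<lambda>s. \<bar>fst s\<bar> powr (\<alpha> / 2))" using A2(1) by (intro T.integrable_fst) auto
        show "AE s in N. 1 \<le> \<bar>fst s\<bar> powr (\<alpha> / 2)"
          using AE_fst by eventually_elim (use \<open>\<not> b < 1\<close> A2(1) in \<open>auto intro!: ge_one_powr_ge_zero\<close>)
      qed simp
      also have "\<dots> < 1" using A2(1) by (intro T.h_less_1) auto
      finally show False by simp
    qed
    \<comment> \<open>Every \<open>a \<ge> b\<close> is a multiplier in the support, for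
      \<open>m = (a - b) / c\<close>.\<close>
    have aff: "a *\<^sub>R x + q \<in> K" if "b \<le> a" "x \<in> K" "q \<in> E" for a x q
      using K_affine[of "(a - b) / c" x q] that \<open>c > 0\<close> supp_M by simp
    have "u \<in> supp R \<Theta>" if "u \<in> positive_combinations E \<inter> max_sphere" for u
    proof (rule in_supp)
      show "asymptotic_direction K u"
        using that by (intro asymptotic_direction_positive_combinations[OF aff K_closed K_nonempty \<open>b > 0\<close> \<open>b < 1\<close>]) auto
      have "AE s in N. 0 \<le> fst s" using AE_fst by eventually_elim (use \<open>b > 0\<close> in simp)
      then show "asymptotic_direction K (- u) \<or> (AE s in N. 0 \<le> fst s)" ..
    qed (use that in simp)
    then show "closure (positive_combinations E \<inter> max_sphere) \<subseteq> supp R \<Theta>"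
      by (intro closure_minimal closed_supp subsetI)
  qed
  have case_c: "supp R \<Theta> = max_sphere" if "closure E = UNIV"
  proof (rule antisym)
    show "supp R \<Theta> \<subseteq> max_sphere" using upper by simp
    have "E = UNIV" using that unfolding E_def by (simp add: closure_closed closed_supp)
    have "supp P (M 0) \<noteq> {}"
    proof
      assume "supp P (M 0) = {}"
      with AE_in_supp[OF P.finite_measure_axioms mM, of 0] have "AE \<omega> in P. False"
        by (simp only: empty_iff)
      then show False by (simp only: P.AE_False)
    qed
    then obtain m where m: "m \<in> supp P (M 0)" by blast
    obtain x where x: "x \<in> K" using K_nonempty by blast
    have "v \<in> K" for v
      \<comment> \<open>A single multiplier suffices: since q is arbitrary, one affine step from x
        reaches every v, so K is the whole space.\<close>
      using K_affine[OF m x, of "v - (b + c * m) *\<^sub>R x"] \<open>E = UNIV\<close> by simp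
    then have "asymptotic_direction K v" for v
      by (intro asymptotic_directionI[where q = 0])
    then show "max_sphere \<subseteq> supp R \<Theta>" by (intro subsetI in_supp) auto
  qed
  show ?thesis using upper case_a case_b case_c unfolding E_def by blast
qed

end
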